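(* Fix $(H_0,H_1)\in(0,1)^2$ such that $2H_0+H_1<1$, and let $\alpha_0:=1-(2H_0+H_1)>0$. Then for all $\alpha>\alpha_0$, $0<\kappa\le\frac{\alpha_0}{5}$, $0<\varsigma\le\min(1-5\kappa,\alpha_0-4\kappa)$ and every smooth compactly supported function $\rho:\mathbb{R}\to\mathbb{R}$, one has almost surely, for all $n\geq 1$, $$\sup_{t\in[0,1]}\big\|\rho\cdot\{\Psi^{\kappa,n}_t-\widetilde\Psi^{\kappa,n}_t\}\big\|_{\mathcal{H}^{-\alpha}(\mathbb{R})}\lesssim 2^{-\varsigma n},$$ where the (random) proportional constant does not depend on $n$.
   Context: For $s\in\mathbb{R}$, $\mathcal{H}^s(\mathbb{R})=\{f\in\mathcal{S}'(\mathbb{R}):\ \|f\|_{\mathcal{H}^s}=\|\mathcal{F}^{-1}(\{1+|\cdot|^2\}^{s/2}\mathcal{F}f)\|_{L^2(\mathbb{R})}<\infty\}$. Let $\widehat W$ be the Fourier transform of a space-time white noise on $\mathbb{R}^2$: a complex Gaussian random measure with $\mathbb{E}[\int f\,d\widehat W\,\overline{\int g\,d\widehat W}]=\int_{\mathbb{R}^2} f\bar g$ and $\widehat W(-A)=\overline{\widehat W(A)}$. For $\kappa>0$, $n\ge1$ set $$B^{\kappa,n}_{t,x}=c_{H_0}c_{H_1}\int_{|\xi|\le 2^{2\kappa n}}\int_{|\eta|\le 2^{\kappa n}}\widehat W(d\xi,d\eta)\,\frac{e^{\imath\xi t}-1}{|\xi|^{H_0+\frac12}}\frac{e^{\imath\eta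 x}-1}{|\eta|^{H_1+\frac12}},\qquad c_{H}=\frac12\Big(\int_0^\infty \frac{1-\cos\xi}{|\xi|^{2H+1}}d\xi\Big)^{-1/2}.$$ Let $G_t(x)=\frac{1}{\sqrt{4\pi t}}e^{-x^2/(4t)}\mathbf 1_{\{t>0\}}$ and $(G*f)_t(x)=\int_0^tds\int_{\mathbb{R}}dy\,G_{t-s}(x-y)f_s(y)$. $\Psi^{\kappa,n}:=G*\partial_t\partial_xB^{\kappa,n}$. Let $t_i=i/2^n$, $x_j=j/2^n$, and $\square^n_{i,j}b=b_{t_{i+1},x_{j+1}}-b_{t_{i+1},x_j}-b_{t_i,x_{j+1}}+b_{t_i,x_j}$. The discretized noise $\partial_t\partial_x\widetilde B^{\kappa,n}$ is the function on $[0,1]\times\mathbb{R}$ equal to $2^{2n}\,\square^n_{i,j}B^{\kappa,n}$ on $[t_i,t_{i+1})\times[x_j,x_{j+1})$ for $i=0,\ldots,2^n-1$, $j=-2^{2n},\ldots,2^{2n}-1$, and equal to $0$ elsewhere. Finally $\widetilde\Psi^{\kappa,n}:=G*\partial_t\partial_x\widetilde B^{\kappa,n}$. *)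

theory Defs
  imports "HOL-Probability.Probability"
begin

section \<open>Negative-order Sobolev norms on tempered distributions\<close>

definition iter_deriv :: "nat \<Rightarrow> (real \<Rightarrow> 'a::real_normed_vector) \<Rightarrow> real \<Rightarrow> 'a" where
  "iter_deriv m f = ((\<lambda>g x. vector_derivative g (at x)) ^^ m) f"

definition smooth :: "(real \<Rightarrow> 'a::real_normed_vector) \<Rightarrow> bool" where
  "smooth f \<longleftrightarrow> (\<forall>m x. iter_deriv m f differentiable (at x))"

definition schwartz :: "(real \<Rightarrow> complex) \<Rightarrow> bool" where
  "schwartz \<phi> \<longleftrightarrow>
     smooth \<phi> \<and> (\<forall>k m. bounded (range (\<lambda>x. x ^ k *\<^sub>R iter_deriv m \<phi> x)))"

definition schwartz_seminorm :: "nat \<Rightarrow> nat \<Rightarrow> (real \<Rightarrow> complex) \<Rightarrow> real" where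
  "schwartz_seminorm k m \<phi> = (SUP x. norm (x ^ k *\<^sub>R iter_deriv m \<phi> x))"

text \<open>A distribution is represented by a functional on all functions, of which only the
  values at Schwartz functions matter.\<close>

type_synonym distribution = "(real \<Rightarrow> complex) \<Rightarrow> complex"

definition tempered :: "distribution \<Rightarrow> bool" where
  "tempered T \<longleftrightarrow>
     (\<forall>\<phi> \<psi> a b. schwartz \<phi> \<longrightarrow> schwartz \<psi> \<longrightarrow>
        T (\<lambda>x. a * \<phi> x + b * \<psi> x) = a * T \<phi> + b * T \<psi>) \<and>
     (\<exists>C N. \<forall>\<phi>. schwartz \<phi> \<longrightarrow>
        cmod (T \<phi>) \<le> C * (\<Sum>k\<le>N. \<Sum>m\<le>N. schwartz_seminorm k m \<phi>))"

definition fourier :: "(real \<Rightarrow> complex) \<Rightarrow> real \<Rightarrow> complex" where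
  "fourier \<phi> \<xi> = (\<integral>x. exp (- (\<i> * of_real (\<xi> * x))) * \<phi> x \<partial>lborel)"

definition inv_fourier :: "(real \<Rightarrow> complex) \<Rightarrow> real \<Rightarrow> complex" where
  "inv_fourier \<phi> x = (1 / (2 * pi)) *\<^sub>R (\<integral>\<xi>. exp (\<i> * of_real (\<xi> * x)) * \<phi> \<xi> \<partial>lborel)"

definition dist_fourier :: "distribution \<Rightarrow> distribution" where
  "dist_fourier T = (\<lambda>\<phi>. T (fourier \<phi>))"

definition dist_inv_fourier :: "distribution \<Rightarrow> distribution" where
  "dist_inv_fourier T = (\<lambda>\<phi>. T (inv_fourier \<phi>))"

definition dist_mult :: "(real \<Rightarrow> real) \<Rightarrow> distribution \<Rightarrow> distribution" where
  "dist_mult m T = (\<lambda>\<phi>. T (\<lambda>x. of_real (m x) * \<phi> x))"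

text \<open>The \<open>L\<^sup>2\<close>-norm of a distribution is that of a square integrable function representing it,
  and is infinite (infimum of the empty set) if there is none.\<close>

definition dist_L2_norm :: "distribution \<Rightarrow> ennreal" where
  "dist_L2_norm T =
     (INF g \<in> {g. g \<in> borel_measurable lborel \<and> integrable lborel (\<lambda>x. (cmod (g x))\<^sup>2) \<and>
                  (\<forall>\<phi>. schwartz \<phi> \<longrightarrow> T \<phi> = (\<integral>x. g x * \<phi> x \<partial>lborel))}.
        ennreal (sqrt (\<integral>x. (cmod (g x))\<^sup>2 \<partial>lborel)))"

definition sobolev_norm :: "real \<Rightarrow> distribution \<Rightarrow> ennreal" where
  "sobolev_norm s T =
     (if tempered T
      then dist_L2_norm
             (dist_inv_fourier (dist_mult (\<lambda>\<xi>. (1 + \<xi>\<^sup>2) powr (s / 2)) (dist_fourier T)))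
      else \<infinity>)"

text \<open>The guard excludes functions for which the pairing with Schwartz functions
  would only have the default value 0 of a non-existent Bochner integral.\<close>

definition sobolev_norm_fun :: "real \<Rightarrow> (real \<Rightarrow> complex) \<Rightarrow> ennreal" where
  "sobolev_norm_fun s f =
     (if \<forall>\<phi>. schwartz \<phi> \<longrightarrow> integrable lborel (\<lambda>x. f x * \<phi> x)
      then sobolev_norm s (\<lambda>\<phi>. \<integral>x. f x * \<phi> x \<partial>lborel)
      else \<infinity>)"


section \<open>The Fourier transform of a space-time white noise\<close>

definition finite_sets :: "(real \<times> real) set set" where
  "finite_sets = {A \<in> sets borel. emeasure lborel A < \<infinity>}"

definition centered_gaussian :: "'w measure \<Rightarrow> ('w \<Rightarrow> real) \<Rightarrow> bool" where
  "centered_gaussian M X \<longleftrightarrow>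
     X \<in> borel_measurable M \<and>
     ((\<exists>\<sigma>>0. distributed M lborel X (\<lambda>x. ennreal (normal_density 0 \<sigma> x))) \<or>
      (AE \<omega> in M. X \<omega> = 0))"

text \<open>The fourth clause is the isometry property for indicator functions; it extends to all
  square integrable functions through the definition of the integral below.\<close>

definition fourier_white_noise ::
  "'w measure \<Rightarrow> ((real \<times> real) set \<Rightarrow> 'w \<Rightarrow> complex) \<Rightarrow> bool" where
  "fourier_white_noise M W \<longleftrightarrow>
     (\<forall>A\<in>finite_sets. W A \<in> borel_measurable M) \<and>
     (\<forall>A :: nat \<Rightarrow> (real \<times> real) set.
        range A \<subseteq> finite_sets \<longrightarrow> disjoint_family A \<longrightarrow> (\<Union>i. A i) \<in> finite_sets \<longrightarrow>
        (\<lambda>k. \<integral>\<^sup>+\<omega>. ennreal ((cmod (W (\<Union>i. A i) \<omega> - (\<Sum>i<k. W (A i) \<omega>)))\<^sup>2) \<partial>M)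
          \<longlonglongrightarrow> 0) \<and>
     (\<forall>S a b. finite S \<longrightarrow> S \<subseteq> finite_sets \<longrightarrow>
        centered_gaussian M (\<lambda>\<omega>. \<Sum>A\<in>S. a A * Re (W A \<omega>) + b A * Im (W A \<omega>))) \<and>
     (\<forall>A\<in>finite_sets. \<forall>B\<in>finite_sets.
        (\<integral>\<omega>. W A \<omega> * cnj (W B \<omega>) \<partial>M) = of_real (measure lborel (A \<inter> B))) \<and>
     (\<forall>A\<in>finite_sets. AE \<omega> in M. W (uminus ` A) \<omega> = cnj (W A \<omega>))"

text \<open>\<open>X\<close> is a version of the integral of \<open>f\<close> against \<open>W\<close>: the \<open>L\<^sup>2\<close>-limit of the integrals of
  step functions converging to \<open>f\<close> in \<open>L\<^sup>2\<close>.\<close>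

definition is_noise_integral ::
  "'w measure \<Rightarrow> ((real \<times> real) set \<Rightarrow> 'w \<Rightarrow> complex) \<Rightarrow>
   (real \<times> real \<Rightarrow> complex) \<Rightarrow> ('w \<Rightarrow> complex) \<Rightarrow> bool" where
  "is_noise_integral M W f X \<longleftrightarrow>
     f \<in> borel_measurable borel \<and> X \<in> borel_measurable M \<and>
     (\<exists>(S :: nat \<Rightarrow> (real \<times> real) set set) (c :: nat \<Rightarrow> (real \<times> real) set \<Rightarrow> complex).
        (\<forall>k. finite (S k) \<and> S k \<subseteq> finite_sets) \<and>
        (\<lambda>k. \<integral>\<^sup>+z. ennreal ((cmod (f z - (\<Sum>A\<in>S k. c k A * indicator A z)))\<^sup>2) \<partial>lborel)
          \<longlonglongrightarrow> 0 \<and>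
        (\<lambda>k. \<integral>\<^sup>+\<omega>. ennreal ((cmod (X \<omega> - (\<Sum>A\<in>S k. c k A * W A \<omega>)))\<^sup>2) \<partial>M)
          \<longlonglongrightarrow> 0)"


section \<open>The approximate fractional noise and its discretization\<close>

definition hconst :: "real \<Rightarrow> real" where
  "hconst H = 1 / 2 * (LBINT \<xi>:{0<..}. (1 - cos \<xi>) / \<bar>\<xi>\<bar> powr (2 * H + 1)) powr (- 1 / 2)"

definition fractional_kernel :: "real \<Rightarrow> real \<Rightarrow> real \<Rightarrow> complex" where
  "fractional_kernel H t \<xi> =
     (exp (\<i> * of_real (\<xi> * t)) - 1) / of_real (\<bar>\<xi>\<bar> powr (H + 1 / 2))"

definition field_kernel ::
  "real \<Rightarrow> real \<Rightarrow> real \<Rightarrow> nat \<Rightarrow> real \<Rightarrow> real \<Rightarrow> real \<times> real \<Rightarrow> complex" where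
  "field_kernel H0 H1 \<kappa> n t x = (\<lambda>(\<xi>, \<eta>).
     if \<bar>\<xi>\<bar> \<le> 2 powr (2 * \<kappa> * n) \<and> \<bar>\<eta>\<bar> \<le> 2 powr (\<kappa> * n)
     then of_real (hconst H0 * hconst H1) *
          (fractional_kernel H0 t \<xi> * fractional_kernel H1 x \<eta>)
     else 0)"

text \<open>The integral defining the field at \<open>(t, x)\<close> is determined only up to a null set depending
  on \<open>(t, x)\<close>. As usual, the field is a version with continuous sample paths. Such a version is
  unique up to indistinguishability, and its sample paths are in fact almost surely smooth since
  the kernel has compact support in frequency, so that the pathwise derivatives below make
  sense.\<close>

definition approx_field ::
  "'w measure \<Rightarrow> ((real \<times> real) set \<Rightarrow> 'w \<Rightarrow> complex) \<Rightarrow> real \<Rightarrow> real \<Rightarrow> real \<Rightarrow> nat \<Rightarrow>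
   (real \<Rightarrow> real \<Rightarrow> 'w \<Rightarrow> complex) \<Rightarrow> bool" where
  "approx_field M W H0 H1 \<kappa> n B \<longleftrightarrow>
     (\<forall>t x. is_noise_integral M W (field_kernel H0 H1 \<kappa> n t x) (B t x)) \<and>
     (AE \<omega> in M. continuous_on UNIV (\<lambda>(t, x). B t x \<omega>))"

definition mixed_deriv :: "(real \<Rightarrow> real \<Rightarrow> complex) \<Rightarrow> real \<Rightarrow> real \<Rightarrow> complex" where
  "mixed_deriv b t x =
     vector_derivative (\<lambda>s. vector_derivative (\<lambda>y. b s y) (at x)) (at t)"

definition rect_increment ::
  "nat \<Rightarrow> nat \<Rightarrow> int \<Rightarrow> (real \<Rightarrow> real \<Rightarrow> complex) \<Rightarrow> complex" where
  "rect_increment n i j b =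
     b ((real i + 1) / 2 ^ n) ((of_int j + 1) / 2 ^ n) - b ((real i + 1) / 2 ^ n) (of_int j / 2 ^ n)
     - b (real i / 2 ^ n) ((of_int j + 1) / 2 ^ n) + b (real i / 2 ^ n) (of_int j / 2 ^ n)"

definition discrete_noise ::
  "nat \<Rightarrow> (real \<Rightarrow> real \<Rightarrow> complex) \<Rightarrow> real \<Rightarrow> real \<Rightarrow> complex" where
  "discrete_noise n b t x =
     (\<Sum>i<2 ^ n. \<Sum>j\<in>{- (2 ^ (2 * n)) ..< (2 ^ (2 * n) :: int)}.
        if t \<in> {real i / 2 ^ n ..< (real i + 1) / 2 ^ n} \<and>
           x \<in> {of_int j / 2 ^ n ..< (of_int j + 1) / 2 ^ n}
        then 2 ^ (2 * n) * rect_increment n i j b else 0)"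

definition heat_kernel :: "real \<Rightarrow> real \<Rightarrow> real" where
  "heat_kernel t x = (if t > 0 then 1 / sqrt (4 * pi * t) * exp (- x\<^sup>2 / (4 * t)) else 0)"

definition heat_conv :: "(real \<Rightarrow> real \<Rightarrow> complex) \<Rightarrow> real \<Rightarrow> real \<Rightarrow> complex" where
  "heat_conv f t x = (LBINT s:{0..t}. (LBINT y. heat_kernel (t - s) (x - y) *\<^sub>R f s y))"

definition lin_sol :: "(real \<Rightarrow> real \<Rightarrow> complex) \<Rightarrow> real \<Rightarrow> real \<Rightarrow> complex" where
  "lin_sol b = heat_conv (mixed_deriv b)"

definition lin_sol_discrete :: "nat \<Rightarrow> (real \<Rightarrow> real \<Rightarrow> complex) \<Rightarrow> real \<Rightarrow> real \<Rightarrow> complex" where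
  "lin_sol_discrete n b = heat_conv (discrete_noise n b)"

end

theory Submission
  imports Defs
begin

text \<open>
  Let \<open>D\<close> be the difference between \<open>\<partial>\<^sub>t\<partial>\<^sub>xB\<close> and its discretization, so that the two solutions differ by
  the heat convolution of \<open>D\<close>. The proof is a second moment computation for \<open>D\<close>, followed by
  deterministic estimates that hold for all times at once.

  Probabilistic part. At a fixed space-time point \<open>(s, y)\<close> of a cell of the grid, \<open>D\<close> is an integral
  against the white noise, and its frequency kernel is the kernel of \<open>\<partial>\<^sub>t\<partial>\<^sub>xB\<close> with the character
  \<open>e\<^sup>i\<^sup>\<xi>\<^sup>s e\<^sup>i\<^sup>\<eta>\<^sup>y\<close> replaced by its deviation from its average over the cell. All frequencies are at most
  \<open>R = 2 powr (2\<kappa>n)\<close> and the cells have side \<open>2\<^sup>-\<^sup>n\<close>, so the deviation is at most \<open>2R/2\<^sup>n\<close>. The remaining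
  frequency integral is explicit, and altogether the variance of \<open>D(s, y)\<close> is of order
  \<open>2 powr (-2n(1 - \<kappa>(4 + \<alpha>0)))\<close> (lemmas \<open>approx_field_noise_error\<close> and \<open>noise_error_rate\<close>). Far from the
  origin the discretized noise vanishes; there \<open>1 \<le> y\<^sup>2/4\<^sup>n\<close>, so the same bound holds with an additional
  factor \<open>1 + y\<^sup>2\<close>. Since \<open>\<alpha>0 < 1\<close>, the exponent \<open>1 - \<kappa>(4 + \<alpha>0)\<close> is strictly larger than
  \<open>1 - 5\<kappa> \<ge> \<sigma>\<close>, which leaves a geometric factor for a Borel--Cantelli argument: almost surely the
  space-time integral of \<open>|D|\<^sup>2\<close> against the weight \<open>exp (- y\<^sup>2 / 8)\<close> is at most a random constant times \<open>2 powr (-2\<sigma>n)\<close>.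

  Deterministic part. The square of the heat kernel at time \<open>u\<close> is at most \<open>u powr (-1/2)\<close> times the heat
  kernel, and the singularity \<open>u powr (-1/2)\<close> is integrable. Hence, by the Cauchy--Schwarz inequality, the
  weighted integral of \<open>|D|\<^sup>2\<close> controls the heat convolution of \<open>D\<close> uniformly in \<open>t \<le> 1\<close> and in \<open>x\<close> in a
  compact set (\<open>heat_integral_norm_le\<close>). After multiplication by \<open>\<rho>\<close> this is a bounded function of compact
  support, and the Sobolev norm of order \<open>-\<alpha>\<close> of such a function is bounded by its norms in \<open>L\<^sup>1\<close> and
  \<open>L\<^sup>\<infinity>\<close> (\<open>sobolev_norm_fun_neg_le\<close>), because the multiplier \<open>(1 + \<xi>\<^sup>2) powr (-\<alpha>/2)\<close> is convolution with
  the Bessel kernel, a probability density.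

  Regularity of the paths. The derivatives of \<open>B\<close> are taken pathwise, for a version of which only
  continuity is known. As the kernel of \<open>B\<close> is band-limited, its Taylor coefficients in \<open>(t, x)\<close> are noise
  integrals whose variances grow at most geometrically. Almost surely the coefficients therefore grow at
  most geometrically, their exponential generating function is entire, and it agrees with \<open>B\<close> at
  rational points, hence everywhere. Differentiation in \<open>t\<close> and \<open>x\<close> is then a shift of the coefficients,
  and the variance of \<open>D(s, y)\<close> is computed from the partial sums by Fatou's lemma.
\<close>

abbreviation plane :: "(real \<times> real) measure" where
  "plane \<equiv> lborel \<Otimes>\<^sub>M lborel"

section \<open>Negative Sobolev norms via the Bessel kernel\<close>

lemma iter_deriv_0: "iter_deriv 0 f = f"
  by (simp add: iter_deriv_def)

lemma schwartz_has_vector_derivative: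
  assumes "schwartz \<phi>"
  shows "(iter_deriv m \<phi> has_vector_derivative iter_deriv (Suc m) \<phi> x) (at x)"
  using assms unfolding schwartz_def smooth_def
  by (simp add: iter_deriv_def vector_derivative_works)

lemma schwartz_continuous:
  assumes "schwartz \<phi>"
  shows "continuous_on UNIV (iter_deriv m \<phi>)"
  using schwartz_has_vector_derivative[OF assms]
  by (meson continuous_at_imp_continuous_on has_vector_derivative_continuous)

lemma schwartz_quadratic_decay:
  assumes "schwartz \<phi>"
  obtains C where "C \<ge> 0" "\<And>x. cmod (iter_deriv m \<phi> x) \<le> C * inverse (1 + x\<^sup>2)"
proof -
  have "bounded (range (\<lambda>x. x ^ k *\<^sub>R iter_deriv m \<phi> x))" for k
    using assms by (auto simp: schwartz_def)
  from this[of 0] this[of 2] obtain C0 C2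
    where C0: "\<And>x. cmod (iter_deriv m \<phi> x) \<le> C0"
      and C2: "\<And>x. cmod (x ^ 2 *\<^sub>R iter_deriv m \<phi> x) \<le> C2"
    unfolding bounded_iff by (auto simp: image_iff)
  have "cmod (iter_deriv m \<phi> x) \<le> (C0 + C2) * inverse (1 + x\<^sup>2)" for x
  proof -
    have "(1 + x\<^sup>2) * cmod (iter_deriv m \<phi> x) \<le> C0 + C2"
      using C0[of x] C2[of x] by (simp add: algebra_simps)
    moreover have "0 < 1 + x\<^sup>2" by (simp add: add_pos_nonneg)
    ultimately show ?thesis by (simp add: field_simps)
  qed
  moreover have "0 \<le> C0 + C2"
    using order_trans[OF norm_ge_zero C0[of 0]] order_trans[OF norm_ge_zero C2[of 0]] by simp
  ultimately show ?thesis using that by blast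
qed

lemma integrable_inverse_1_plus_sq: "integrable lborel (\<lambda>x::real. inverse (1 + x\<^sup>2))"
  using integrable_inverse_1_plus_square
  by (simp add: set_integrable_def einterval_def)

lemma integrable_quadratic_decay:
  fixes g :: "real \<Rightarrow> complex"
  assumes "g \<in> borel_measurable borel" "\<And>x. cmod (g x) \<le> C * inverse (1 + x\<^sup>2)"
  shows "integrable lborel g"
  by (rule Bochner_Integration.integrable_bound
        [OF integrable_mult_right[OF integrable_inverse_1_plus_sq, of C]])
     (use assms in \<open>auto intro: order_trans[OF _ abs_ge_self]\<close>)

lemma schwartz_integrable:
  assumes "schwartz \<phi>"
  shows "integrable lborel (iter_deriv m \<phi>)"
proof -
  obtain C where "\<And>x. cmod (iter_deriv m \<phi> x) \<le> C * inverse (1 + x\<^sup>2)"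
    using schwartz_quadratic_decay[OF assms] by metis
  then show ?thesis
    using schwartz_continuous[OF assms, of m]
    by (intro integrable_quadratic_decay[where C = C]) (auto intro: borel_measurable_continuous_onI)
qed

lemma schwartz_bounded:
  assumes "schwartz \<phi>"
  obtains C where "\<And>x. cmod (\<phi> x) \<le> C"
proof -
  have "bounded (range (\<lambda>x. x ^ 0 *\<^sub>R iter_deriv 0 \<phi> x))"
    using assms unfolding schwartz_def by blast
  then show ?thesis
    using that by (auto simp: bounded_iff iter_deriv_0)
qed

lemma integrable_iexp_mult:
  fixes g :: "real \<Rightarrow> complex"
  assumes "integrable lborel g"
  shows "integrable lborel (\<lambda>x. iexp (x * \<xi>) * g x)"
  by (rule Bochner_Integration.integrable_bound[OF assms])
     (use borel_measurable_integrable[OF assms] in \<open>auto simp: norm_mult\<close>)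

text \<open>Integration by parts on the whole line; the boundary terms vanish by the decay of \<open>\<phi>\<close>.\<close>

lemma inv_fourier_deriv:
  assumes "schwartz \<phi>"
  shows "inv_fourier (iter_deriv (Suc m) \<phi>) \<xi> = - (\<i> * of_real \<xi>) * inv_fourier (iter_deriv m \<phi>) \<xi>"
proof -
  let ?g = "iter_deriv m \<phi>" and ?g' = "iter_deriv (Suc m) \<phi>"
  let ?e = "\<lambda>x. iexp (x * \<xi>)"
  let ?F = "\<lambda>x. ?e x * ?g x" and ?f = "\<lambda>x. ?e x * ?g' x + \<i> * of_real \<xi> * (?e x * ?g x)"
  have D: "(?F has_vector_derivative ?f x) (at x)" for x
  proof -
    have "(?e has_vector_derivative \<i> * of_real \<xi> * ?e x) (at x)"
    proof -
      have "((\<lambda>z. exp (\<i> * (z * of_real \<xi>))) has_field_derivative \<i> * of_real \<xi> * exp (\<i> * (of_real x * of_real \<xi>)))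
              (at (of_real x))"
        by (auto intro!: derivative_eq_intros)
      from has_vector_derivative_real_field[OF this] show ?thesis by simp
    qed
    from has_vector_derivative_mult[OF this schwartz_has_vector_derivative[OF assms, of m x]]
    show ?thesis by (simp add: mult_ac)
  qed
  have int1: "integrable lborel (\<lambda>x. ?e x * ?g x)"
    by (intro integrable_iexp_mult schwartz_integrable assms)
  have int2: "integrable lborel (\<lambda>x. ?e x * ?g' x)"
    by (intro integrable_iexp_mult schwartz_integrable assms)
  have int: "integrable lborel ?f"
    using int1 int2 by auto
  obtain C where C: "\<And>x. cmod (?g x) \<le> C * inverse (1 + x\<^sup>2)"
    using schwartz_quadratic_decay[OF assms] by metis
  have lim: "(?F \<longlongrightarrow> 0) L" if L: "((\<lambda>x::real. C * inverse (1 + x\<^sup>2)) \<longlongrightarrow> 0) L" for L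
    by (rule Lim_null_comparison[OF _ L]) (use C in \<open>auto simp: norm_mult\<close>)
  have lim_top: "(?F \<longlongrightarrow> 0) at_top"
  proof (rule lim)
    have "((\<lambda>x::real. inverse (1 + x\<^sup>2)) \<longlongrightarrow> 0) at_top"
      by (intro tendsto_inverse_0_at_top filterlim_tendsto_add_at_top[OF tendsto_const]
            filterlim_pow_at_top filterlim_ident) auto
    then show "((\<lambda>x::real. C * inverse (1 + x\<^sup>2)) \<longlongrightarrow> 0) at_top"
      by (rule tendsto_mult_right_zero)
  qed
  have lim_bot: "(?F \<longlongrightarrow> 0) at_bot"
  proof (rule lim)
    have "((\<lambda>x::real. inverse (1 + x\<^sup>2)) \<longlongrightarrow> 0) at_bot"
      by (intro tendsto_inverse_0_at_top filterlim_tendsto_add_at_top[OF tendsto_const]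
            filterlim_pow_at_bot_even filterlim_ident) auto
    then show "((\<lambda>x::real. C * inverse (1 + x\<^sup>2)) \<longlongrightarrow> 0) at_bot"
      by (rule tendsto_mult_right_zero)
  qed
  have cont: "isCont ?f x" for x
    using schwartz_continuous[OF assms, of m] schwartz_continuous[OF assms, of "Suc m"]
    by (auto intro!: continuous_intros simp: continuous_on_eq_continuous_at)
  have "(LBINT x=-\<infinity>..\<infinity>. ?f x) = 0 - 0"
    by (rule interval_integral_FTC_integrable[of "-\<infinity>" "\<infinity>" ?F ?f 0 0])
       (use D cont int lim_top lim_bot in \<open>auto simp: set_integrable_def ereal_tendsto_simps1\<close>)
  then have "(LBINT x. ?f x) = 0"
    by (simp add: interval_lebesgue_integral_def set_lebesgue_integral_def)
  then have "(LBINT x. ?e x * ?g' x) + \<i> * of_real \<xi> * (LBINT x. ?e x * ?g x) = 0"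
    using int1 int2 by simp
  then have "(LBINT x. ?e x * ?g' x) = - (\<i> * of_real \<xi> * (LBINT x. ?e x * ?g x))"
    by (rule eq_neg_iff_add_eq_0[THEN iffD2])
  then show ?thesis
    unfolding inv_fourier_def by (simp only: scaleR_conv_of_real mult_ac mult_minus_left mult_minus_right)
qed

lemma norm_inv_fourier_le:
  assumes "integrable lborel g"
  shows "cmod (inv_fourier g \<xi>) \<le> (LBINT x. cmod (g x)) / (2 * pi)"
proof -
  have "cmod (LBINT x. iexp (x * \<xi>) * g x) \<le> (LBINT x. cmod (g x))"
    using integral_norm_bound[of lborel "\<lambda>x. iexp (x * \<xi>) * g x"] by (simp add: norm_mult)
  then show ?thesis
    unfolding inv_fourier_def by (simp add: divide_right_mono)
qed

lemma inv_fourier_measurable: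
  assumes "g \<in> borel_measurable borel"
  shows "inv_fourier g \<in> borel_measurable borel"
proof -
  have [measurable]: "g \<in> borel_measurable borel" by fact
  have "(\<lambda>\<xi>. \<integral>x. iexp (x * \<xi>) * g x \<partial>lborel) \<in> borel_measurable borel"
    by measurable
  then show ?thesis unfolding inv_fourier_def by measurable
qed

lemma schwartz_measurable: "schwartz \<phi> \<Longrightarrow> \<phi> \<in> borel_measurable borel"
  using schwartz_continuous[of \<phi> 0] by (simp add: iter_deriv_0 borel_measurable_continuous_onI)

text \<open>Two integrations by parts give decay like \<open>1 / (1 + \<xi>\<^sup>2)\<close>.\<close>

lemma inv_fourier_integrable:
  assumes "schwartz \<phi>"
  shows "integrable lborel (inv_fourier \<phi>)"
proof -
  define C where "C m = (LBINT x. cmod (iter_deriv m \<phi> x)) / (2 * pi)" for m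
  have C: "cmod (inv_fourier (iter_deriv m \<phi>) \<xi>) \<le> C m" for m \<xi>
    unfolding C_def by (rule norm_inv_fourier_le[OF schwartz_integrable[OF assms]])
  have "inv_fourier (iter_deriv 2 \<phi>) \<xi> = - (of_real (\<xi>\<^sup>2) * inv_fourier \<phi> \<xi>)" for \<xi>
    using inv_fourier_deriv[OF assms, of 0 \<xi>] inv_fourier_deriv[OF assms, of 1 \<xi>]
    by (simp add: iter_deriv_0 numeral_2_eq_2 power2_eq_square algebra_simps)
  then have "\<xi>\<^sup>2 * cmod (inv_fourier \<phi> \<xi>) \<le> C 2" for \<xi>
    using C[of 2 \<xi>] by (simp add: norm_mult norm_power)
  with C[of 0] have "(1 + \<xi>\<^sup>2) * cmod (inv_fourier \<phi> \<xi>) \<le> C 0 + C 2" for \<xi>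
    by (auto simp: iter_deriv_0 distrib_right intro: add_mono)
  then have "cmod (inv_fourier \<phi> \<xi>) \<le> (C 0 + C 2) * inverse (1 + \<xi>\<^sup>2)" for \<xi>
    using add_pos_nonneg[of 1 "\<xi>\<^sup>2"] by (simp add: field_simps)
  then show ?thesis
    by (intro integrable_quadratic_decay[where C = "C 0 + C 2"]
          inv_fourier_measurable schwartz_measurable assms)
qed

text \<open>A rescaling of the characteristic function of the standard normal distribution. The result is
  expressed by the heat kernel because the Bessel kernel will be a mixture of heat kernels.\<close>

lemma gaussian_fourier:
  assumes u: "u > 0"
  shows "integrable lborel (\<lambda>\<xi>. exp (- (u * \<xi>\<^sup>2)))"
    and "(LBINT \<xi>. iexp (\<xi> * z) * of_real (exp (- (u * \<xi>\<^sup>2))))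
           = of_real (2 * pi * heat_kernel u z)"
proof -
  define c where "c = 1 / sqrt (2 * u)"
  have c: "c > 0" "c\<^sup>2 = 1 / (2 * u)" using u by (auto simp: c_def power_divide)
  have e: "exp (- (u * (c * x)\<^sup>2)) = sqrt (2 * pi) * std_normal_density x" for x
    using u by (simp add: std_normal_density_def power_mult_distrib c)
  have "integrable lborel (\<lambda>x. exp (- (u * (0 + c * x)\<^sup>2)))"
    by (simp add: e)
  then show "integrable lborel (\<lambda>\<xi>. exp (- (u * \<xi>\<^sup>2)))"
    using lborel_integrable_real_affine_iff[of c "\<lambda>\<xi>. exp (- (u * \<xi>\<^sup>2))" 0] c by auto
  have "(LBINT \<xi>. iexp (\<xi> * z) * of_real (exp (- (u * \<xi>\<^sup>2))))
      = \<bar>c\<bar> *\<^sub>R (LBINT x. iexp ((0 + c * x) * z) * of_real (exp (- (u * (0 + c * x)\<^sup>2))))"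
    using c by (intro lborel_integral_real_affine) auto
  also have "\<dots> = of_real c * (LBINT x. of_real (sqrt (2 * pi)) * (std_normal_density x *\<^sub>R iexp (c * z * x)))"
    using c unfolding add_0_left e by (simp add: scaleR_conv_of_real mult_ac)
  also have "\<dots> = of_real (c * sqrt (2 * pi)) * (LBINT x. std_normal_density x *\<^sub>R iexp (c * z * x))"
    by (subst integral_mult_right_zero) simp
  also have "(LBINT x. std_normal_density x *\<^sub>R iexp (c * z * x)) = char std_normal_distribution (c * z)"
    unfolding char_def by (subst integral_density) auto
  also have "\<dots> = of_real (exp (- ((c * z)\<^sup>2) / 2))"
    by (simp only: char_std_normal_distribution)
  also have "exp (- ((c * z)\<^sup>2) / 2) = exp (- z\<^sup>2 / (4 * u))"
    by (simp add: power_mult_distrib c)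
  also have "of_real (c * sqrt (2 * pi)) * (of_real (exp (- z\<^sup>2 / (4 * u))) :: complex)
     = of_real (2 * pi * heat_kernel u z)"
  proof -
    have "c * sqrt (2 * pi) = 2 * pi * (1 / sqrt (4 * pi * u))"
    proof -
      have "sqrt pi * sqrt pi = pi" by simp
      then show ?thesis
        using u by (simp add: c_def real_sqrt_mult field_simps)
    qed
    then show ?thesis using u by (simp add: heat_kernel_def)
  qed
  finally show "(LBINT \<xi>. iexp (\<xi> * z) * of_real (exp (- (u * \<xi>\<^sup>2))))
           = of_real (2 * pi * heat_kernel u z)" .
qed


lemma heat_kernel_measurable[measurable (raw)]:
  assumes [measurable]: "f \<in> borel_measurable M" "g \<in> borel_measurable M"
  shows "(\<lambda>x. heat_kernel (f x) (g x)) \<in> borel_measurable M"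
  unfolding heat_kernel_def by measurable

lemma heat_kernel_nonneg: "0 \<le> heat_kernel u z"
  by (simp add: heat_kernel_def)

lemma heat_kernel_even: "heat_kernel u (- z) = heat_kernel u z"
  by (simp add: heat_kernel_def)

lemma heat_kernel_swap: "heat_kernel u (x - y) = heat_kernel u (y - x)"
  by (metis heat_kernel_even minus_diff_eq)

lemma heat_kernel_normal:
  "u > 0 \<Longrightarrow> heat_kernel u (x - y) = normal_density x (sqrt (2 * u)) y"
  by (simp add: heat_kernel_def normal_density_def power2_commute mult_ac)

lemma heat_kernel_integral:
  assumes "u > 0"
  shows "integrable lborel (\<lambda>y. heat_kernel u (x - y))" "(LBINT y. heat_kernel u (x - y)) = 1"
  using assms by (simp_all add: heat_kernel_normal)

text \<open>The density of the gamma distribution with shape \<open>a\<close> and rate 1.\<close>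

definition gamma_weight :: "real \<Rightarrow> real \<Rightarrow> real" where
  "gamma_weight a u = indicator {0<..} u * u powr (a - 1) * exp (- u) / Gamma a"

lemma gamma_weight_measurable[measurable]: "gamma_weight a \<in> borel_measurable borel"
  unfolding gamma_weight_def by measurable

lemma gamma_weight_nonneg: "a > 0 \<Longrightarrow> 0 \<le> gamma_weight a u"
  by (auto simp: gamma_weight_def Gamma_real_pos less_imp_le)

lemma gamma_weight_eq_0: "u \<le> 0 \<Longrightarrow> gamma_weight a u = 0"
  by (simp add: gamma_weight_def)

text \<open>Substituting \<open>t = (1 + c) u\<close> in the integral defining the Gamma function. For \<open>c = \<xi>\<^sup>2\<close> this exhibits the Bessel
  multiplier as a mixture of Gaussians.\<close>

lemma gamma_weight_laplace:
  assumes a: "a > 0" and c: "c \<ge> 0"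
  shows "has_bochner_integral lborel (\<lambda>u. gamma_weight a u * exp (- (u * c))) ((1 + c) powr (- a))"
proof (rule has_bochner_integral_nn_integral)
  have G: "Gamma a > 0" using a by (rule Gamma_real_pos)
  define b where "b = 1 + c"
  have b: "b > 0" using c by (simp add: b_def)
  have "ennreal (Gamma a) = (\<integral>\<^sup>+t. ennreal (indicator {0..} t * t powr (a - 1) / exp t) \<partial>lborel)"
    by (rule Gamma_conv_nn_integral_real[OF a])
  also have "\<dots> = ennreal \<bar>b\<bar> * (\<integral>\<^sup>+u. ennreal (indicator {0..} (0 + b * u) * (0 + b * u) powr (a - 1) / exp (0 + b * u)) \<partial>lborel)"
    using b by (intro nn_integral_real_affine) auto
  also have "\<dots> = ennreal b * (\<integral>\<^sup>+u. ennreal (b powr (a - 1) * Gamma a) * ennreal (gamma_weight a u * exp (- (u * c))) \<partial>lborel)"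
  proof (intro arg_cong2[where f = "(*)"] nn_integral_cong)
    fix u
    show "ennreal (indicator {0..} (0 + b * u) * (0 + b * u) powr (a - 1) / exp (0 + b * u)) =
      ennreal (b powr (a - 1) * Gamma a) * ennreal (gamma_weight a u * exp (- (u * c)))"
    proof (cases "u > 0")
      case True
      have "exp (- u) * exp (- (u * c)) = inverse (exp (b * u))"
        by (simp add: b_def algebra_simps flip: exp_add exp_minus)
      then have "gamma_weight a u * exp (- (u * c)) = u powr (a - 1) * inverse (exp (b * u)) / Gamma a"
        using True by (simp add: gamma_weight_def)
      then have "(b * u) powr (a - 1) / exp (b * u) =
         b powr (a - 1) * Gamma a * (gamma_weight a u * exp (- (u * c)))"
        using True b G by (simp add: powr_mult divide_inverse)
      then show ?thesis
        using True b G by (simp add: ennreal_mult'[symmetric] less_imp_le)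
    next
      case False
      then show ?thesis
        using b by (cases "u = 0") (auto simp: gamma_weight_def indicator_def zero_le_mult_iff)
    qed
  qed (use b in auto)
  also have "\<dots> = ennreal b * (ennreal (b powr (a - 1) * Gamma a) * (\<integral>\<^sup>+u. ennreal (gamma_weight a u * exp (- (u * c))) \<partial>lborel))"
    by (subst nn_integral_cmult) auto
  also have "\<dots> = ennreal (Gamma a) * (ennreal (b powr a) * (\<integral>\<^sup>+u. ennreal (gamma_weight a u * exp (- (u * c))) \<partial>lborel))"
  proof -
    have "b * (b powr (a - 1) * Gamma a) = Gamma a * b powr a"
      using b by (simp add: powr_diff)
    then have "ennreal b * ennreal (b powr (a - 1) * Gamma a) = ennreal (Gamma a) * ennreal (b powr a)"
      using b G by (simp only: ennreal_mult'[symmetric] less_imp_le powr_ge_zero)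
    then show ?thesis
      by (simp only: mult.assoc[symmetric])
  qed
  finally have "ennreal (Gamma a) * (ennreal (b powr a) * (\<integral>\<^sup>+u. ennreal (gamma_weight a u * exp (- (u * c))) \<partial>lborel)) = ennreal (Gamma a) * 1"
    by simp
  then have "ennreal (b powr a) * (\<integral>\<^sup>+u. ennreal (gamma_weight a u * exp (- (u * c))) \<partial>lborel) = 1"
    using G by (subst (asm) ennreal_mult_cancel_left) auto
  then have "ennreal (b powr (- a)) * (ennreal (b powr a) * (\<integral>\<^sup>+u. ennreal (gamma_weight a u * exp (- (u * c))) \<partial>lborel)) = ennreal (b powr (- a))"
    by simp
  then show "(\<integral>\<^sup>+u. ennreal (gamma_weight a u * exp (- (u * c))) \<partial>lborel) = ennreal ((1 + c) powr - a)"
    using b by (simp add: mult.assoc[symmetric] ennreal_mult'[symmetric] b_def flip: powr_add)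
qed (use gamma_weight_nonneg[OF a] in auto)

lemma gamma_weight_integral:
  assumes "a > 0"
  shows "integrable lborel (gamma_weight a)" "(LBINT u. gamma_weight a u) = 1"
  using gamma_weight_laplace[OF assms, of 0] by (simp_all add: has_bochner_integral_iff)

lemma integrable_prod_mult:
  fixes f g :: "real \<Rightarrow> complex"
  assumes f: "integrable lborel f" and g: "integrable lborel g"
  shows "integrable plane (\<lambda>(x,y). f x * g y)"
proof (rule lborel_pair.Fubini_integrable)
  have [measurable]: "f \<in> borel_measurable borel" "g \<in> borel_measurable borel"
    using f g by auto
  show "(\<lambda>(x, y). f x * g y) \<in> borel_measurable plane" by measurable
qed (use f g in \<open>auto simp: norm_mult\<close>)

lemma gamma_heat_integrable:
  assumes a: "a > 0"
  shows "integrable plane (\<lambda>(u, y). gamma_weight a u * heat_kernel u (x - y))"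
proof (rule lborel_pair.Fubini_integrable)
  have "(LBINT y. norm (gamma_weight a u * heat_kernel u (x - y))) = gamma_weight a u" for u
    by (cases "u > 0") (use gamma_weight_nonneg[OF a] in
        \<open>auto simp: abs_mult heat_kernel_nonneg heat_kernel_integral gamma_weight_eq_0\<close>)
  then show "integrable lborel (\<lambda>u. \<integral>y. norm (case (u, y) of (u, y) \<Rightarrow> gamma_weight a u * heat_kernel u (x - y)) \<partial>lborel)"
    using gamma_weight_integral[OF a] by simp
  have "integrable lborel (\<lambda>y. gamma_weight a u * heat_kernel u (x - y))" for u
    by (cases "u > 0") (auto simp: heat_kernel_integral gamma_weight_eq_0)
  then show "AE u in lborel. integrable lborel (\<lambda>y. case (u, y) of (u, y) \<Rightarrow> gamma_weight a u * heat_kernel u (x - y))"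
    by simp
qed measurable

text \<open>The function with Fourier transform \<open>(1 + \<xi>\<^sup>2) powr (-a)\<close>. As a gamma mixture of heat kernels it is visibly
  nonnegative with total mass 1.\<close>

definition bessel_kernel :: "real \<Rightarrow> real \<Rightarrow> real" where
  "bessel_kernel a z = (LBINT u. gamma_weight a u * heat_kernel u z)"

lemma bessel_kernel_measurable[measurable]: "bessel_kernel a \<in> borel_measurable borel"
  unfolding bessel_kernel_def by measurable

lemma bessel_kernel_nonneg: "a > 0 \<Longrightarrow> 0 \<le> bessel_kernel a z"
  unfolding bessel_kernel_def
  by (intro integral_nonneg_AE AE_I2 mult_nonneg_nonneg gamma_weight_nonneg heat_kernel_nonneg)

lemma bessel_kernel_swap: "bessel_kernel a (x - y) = bessel_kernel a (y - x)"
  unfolding bessel_kernel_def by (subst heat_kernel_swap) (rule refl)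

lemma bessel_kernel_integral:
  assumes a: "a > 0"
  shows "integrable lborel (\<lambda>y. bessel_kernel a (x - y))" "(LBINT y. bessel_kernel a (x - y)) = 1"
proof -
  have int: "integrable plane (\<lambda>(u, y). gamma_weight a u * heat_kernel u (x - y))"
    by (rule gamma_heat_integrable[OF a])
  show "integrable lborel (\<lambda>y. bessel_kernel a (x - y))"
    using lborel_pair.integrable_snd[OF int] by (simp add: bessel_kernel_def)
  have "(LBINT y. bessel_kernel a (x - y)) = (\<integral>u. \<integral>y. gamma_weight a u * heat_kernel u (x - y) \<partial>lborel \<partial>lborel)"
    unfolding bessel_kernel_def by (rule lborel_pair.Fubini_integral[OF int])
  also have "\<dots> = (LBINT u. gamma_weight a u)"
  proof (rule Bochner_Integration.integral_cong[OF refl])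
    fix u show "(LBINT y. gamma_weight a u * heat_kernel u (x - y)) = gamma_weight a u"
      by (cases "u > 0") (auto simp: heat_kernel_integral gamma_weight_eq_0)
  qed
  finally show "(LBINT y. bessel_kernel a (x - y)) = 1"
    using gamma_weight_integral[OF a] by simp
qed

text \<open>Fubini's theorem and the Fourier transform of the Gaussian. The Gaussian factor makes the double integral
  absolutely convergent, so integrability of \<open>\<phi>\<close> is enough, as in the usual proof of Fourier inversion.\<close>

lemma gaussian_multiplier:
  assumes u: "u > 0" and \<phi>: "integrable lborel \<phi>"
  shows "fourier (\<lambda>\<xi>. of_real (exp (- (u * \<xi>\<^sup>2))) * inv_fourier \<phi> \<xi>) x
           = (LBINT y. of_real (heat_kernel u (x - y)) * \<phi> y)"
proof -
  have [measurable]: "\<phi> \<in> borel_measurable borel" using \<phi> by auto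
  let ?E = "\<lambda>\<xi>. of_real (exp (- (u * \<xi>\<^sup>2))) :: complex"
  let ?f = "\<lambda>(\<xi>, y). exp (- (\<i> * of_real (x * \<xi>))) * ?E \<xi> * (iexp (y * \<xi>) * \<phi> y)"
  have int: "integrable plane ?f"
  proof (rule Bochner_Integration.integrable_bound)
    have "integrable lborel ?E"
      using gaussian_fourier(1)[OF u] by auto
    then show "integrable plane (\<lambda>(\<xi>, y). ?E \<xi> * \<phi> y)"
      by (rule integrable_prod_mult[OF _ \<phi>])
    show "AE p in plane. norm (?f p) \<le> norm (case p of (\<xi>, y) \<Rightarrow> ?E \<xi> * \<phi> y)"
      by (auto simp: norm_mult)
  qed measurable
  have "fourier (\<lambda>\<xi>. ?E \<xi> * inv_fourier \<phi> \<xi>) x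
      = (\<integral>\<xi>. (1 / (2 * pi)) *\<^sub>R (LBINT y. ?f (\<xi>, y)) \<partial>lborel)"
    unfolding fourier_def inv_fourier_def prod.case integral_mult_right_zero
    by (simp add: mult_ac scaleR_conv_of_real)
  also have "\<dots> = (1 / (2 * pi)) *\<^sub>R (\<integral>\<xi>. (LBINT y. ?f (\<xi>, y)) \<partial>lborel)"
    by simp
  also have "(\<integral>\<xi>. (LBINT y. ?f (\<xi>, y)) \<partial>lborel) = (\<integral>y. (LBINT \<xi>. ?f (\<xi>, y)) \<partial>lborel)"
    using lborel_pair.Fubini_integral[of "\<lambda>\<xi> y. ?f (\<xi>, y)"] int by simp
  also have "\<dots> = (LBINT y. of_real (2 * pi) * (of_real (heat_kernel u (x - y)) * \<phi> y))"
  proof (rule Bochner_Integration.integral_cong[OF refl])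
    fix y
    have "(LBINT \<xi>. ?f (\<xi>, y)) = (LBINT \<xi>. (iexp (\<xi> * (y - x)) * ?E \<xi>) * \<phi> y)"
      by (intro Bochner_Integration.integral_cong) (auto simp: algebra_simps simp flip: exp_add)
    also have "\<dots> = of_real (2 * pi * heat_kernel u (y - x)) * \<phi> y"
      by (subst integral_mult_left_zero) (simp only: gaussian_fourier(2)[OF u])
    finally show "(LBINT \<xi>. ?f (\<xi>, y)) = of_real (2 * pi) * (of_real (heat_kernel u (x - y)) * \<phi> y)"
      by (subst heat_kernel_swap) simp
  qed
  also have "\<dots> = of_real (2 * pi) * (LBINT y. of_real (heat_kernel u (x - y)) * \<phi> y)"
    by (rule integral_mult_right_zero)
  finally show ?thesis by (simp add: scaleR_conv_of_real)
qed

text \<open>Averaging the Gaussian case over the gamma distribution. Exchanging the average with the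
  frequency integral uses that the inverse Fourier transform of a Schwartz function is integrable.\<close>

lemma bessel_multiplier:
  assumes a: "a > 0" and \<phi>: "schwartz \<phi>"
  shows "fourier (\<lambda>\<xi>. of_real ((1 + \<xi>\<^sup>2) powr (- a)) * inv_fourier \<phi> \<xi>) x
           = (LBINT y. of_real (bessel_kernel a (x - y)) * \<phi> y)"
proof -
  have [measurable]: "\<phi> \<in> borel_measurable borel" by (rule schwartz_measurable[OF \<phi>])
  have [measurable]: "inv_fourier \<phi> \<in> borel_measurable borel" by (rule inv_fourier_measurable) simp
  have phi_int: "integrable lborel \<phi>"
    using schwartz_integrable[OF \<phi>, of 0] by (simp add: iter_deriv_0)
  obtain A where A: "\<And>y. cmod (\<phi> y) \<le> A"
    using schwartz_bounded[OF \<phi>] by blast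
  let ?f = "\<lambda>(\<xi>, u). exp (- (\<i> * of_real (x * \<xi>))) * inv_fourier \<phi> \<xi> * of_real (gamma_weight a u * exp (- (u * \<xi>\<^sup>2)))"
  have int: "integrable plane ?f"
  proof (rule Bochner_Integration.integrable_bound)
    have "integrable lborel (\<lambda>u. of_real (gamma_weight a u) :: complex)"
      using gamma_weight_integral(1)[OF a] by auto
    then show "integrable plane (\<lambda>(\<xi>, u). inv_fourier \<phi> \<xi> * of_real (gamma_weight a u))"
      by (rule integrable_prod_mult[OF inv_fourier_integrable[OF \<phi>]])
    have "gamma_weight a u * exp (- (u * \<xi>\<^sup>2)) \<le> gamma_weight a u" for u \<xi>
      by (cases "u > 0") (auto intro!: mult_right_le_one_le gamma_weight_nonneg[OF a] simp: gamma_weight_eq_0)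
    then show "AE p in plane. norm (?f p) \<le> norm (case p of (\<xi>, u) \<Rightarrow> inv_fourier \<phi> \<xi> * of_real (gamma_weight a u))"
      using gamma_weight_nonneg[OF a] by (intro AE_I2) (auto simp: norm_mult abs_mult intro!: mult_left_mono)
  qed measurable
  have "fourier (\<lambda>\<xi>. of_real ((1 + \<xi>\<^sup>2) powr (- a)) * inv_fourier \<phi> \<xi>) x
     = (\<integral>\<xi>. \<integral>u. ?f (\<xi>, u) \<partial>lborel \<partial>lborel)"
    unfolding fourier_def
  proof (rule Bochner_Integration.integral_cong[OF refl])
    fix \<xi> :: real
    have "(LBINT u. ?f (\<xi>, u)) = exp (- (\<i> * of_real (x * \<xi>))) * inv_fourier \<phi> \<xi> *
        of_real (LBINT u. gamma_weight a u * exp (- (u * \<xi>\<^sup>2)))"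
      by (simp only: prod.case integral_mult_right_zero integral_complex_of_real)
    also have "(LBINT u. gamma_weight a u * exp (- (u * \<xi>\<^sup>2))) = (1 + \<xi>\<^sup>2) powr (- a)"
      using gamma_weight_laplace[OF a, of "\<xi>\<^sup>2"] by (simp add: has_bochner_integral_iff)
    finally have inner: "(LBINT u. ?f (\<xi>, u))
      = exp (- (\<i> * of_real (x * \<xi>))) * inv_fourier \<phi> \<xi> * of_real ((1 + \<xi>\<^sup>2) powr (- a))" .
    show "exp (- (\<i> * of_real (x * \<xi>))) * (of_real ((1 + \<xi>\<^sup>2) powr (- a)) * inv_fourier \<phi> \<xi>)
      = (LBINT u. ?f (\<xi>, u))"
      unfolding inner by (simp only: mult_ac)
  qed
  also have "\<dots> = (\<integral>u. \<integral>\<xi>. ?f (\<xi>, u) \<partial>lborel \<partial>lborel)"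
    using lborel_pair.Fubini_integral[of "\<lambda>\<xi> u. ?f (\<xi>, u)"] int by simp
  also have "\<dots> = (\<integral>u. \<integral>y. of_real (gamma_weight a u * heat_kernel u (x - y)) * \<phi> y \<partial>lborel \<partial>lborel)"
  proof (rule Bochner_Integration.integral_cong[OF refl])
    fix u
    show "(LBINT \<xi>. ?f (\<xi>, u)) = (LBINT y. of_real (gamma_weight a u * heat_kernel u (x - y)) * \<phi> y)"
    proof (cases "u > 0")
      case True
      have "(LBINT \<xi>. ?f (\<xi>, u)) = (\<integral>\<xi>. of_real (gamma_weight a u) *
            (exp (- (\<i> * of_real (x * \<xi>))) * (of_real (exp (- (u * \<xi>\<^sup>2))) * inv_fourier \<phi> \<xi>)) \<partial>lborel)"
        by (intro Bochner_Integration.integral_cong) (auto simp: mult_ac)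
      also have "\<dots> = of_real (gamma_weight a u) * fourier (\<lambda>\<xi>. of_real (exp (- (u * \<xi>\<^sup>2))) * inv_fourier \<phi> \<xi>) x"
        unfolding fourier_def by (rule integral_mult_right_zero)
      also have "\<dots> = (LBINT y. of_real (gamma_weight a u) * (of_real (heat_kernel u (x - y)) * \<phi> y))"
        unfolding gaussian_multiplier[OF True phi_int] by (rule integral_mult_right_zero[symmetric])
      finally show ?thesis by (simp add: mult.assoc)
    qed (simp add: gamma_weight_eq_0)
  qed
  also have "\<dots> = (\<integral>y. \<integral>u. of_real (gamma_weight a u * heat_kernel u (x - y)) * \<phi> y \<partial>lborel \<partial>lborel)"
  proof (rule lborel_pair.Fubini_integral[symmetric])
    show "integrable plane (\<lambda>(u, y). of_real (gamma_weight a u * heat_kernel u (x - y)) * \<phi> y)"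
    proof (rule Bochner_Integration.integrable_bound)
      show "integrable plane (\<lambda>p. A * (case p of (u, y) \<Rightarrow> gamma_weight a u * heat_kernel u (x - y)))"
        by (intro integrable_mult_right gamma_heat_integrable[OF a])
      show "AE p in plane. norm (case p of (u, y) \<Rightarrow> of_real (gamma_weight a u * heat_kernel u (x - y)) * \<phi> y)
        \<le> norm (A * (case p of (u, y) \<Rightarrow> gamma_weight a u * heat_kernel u (x - y)))"
        using A order_trans[OF norm_ge_zero A[of 0]]
        by (intro AE_I2) (auto simp: norm_mult abs_mult mult.commute[of A] intro!: mult_left_mono)
    qed measurable
  qed
  also have "\<dots> = (LBINT y. of_real (bessel_kernel a (x - y)) * \<phi> y)"
    unfolding bessel_kernel_def
    by (simp only: integral_mult_left_zero integral_complex_of_real)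
  finally show ?thesis .
qed

text \<open>By duality the distribution in the definition of the norm is represented by the convolution \<open>g\<close> of \<open>f\<close> with the
  Bessel kernel. That kernel is a probability density, so \<open>g\<close> obeys the same \<open>L\<^sup>1\<close> and \<open>L\<^sup>\<infinity>\<close> bounds as \<open>f\<close>, and
  \<open>|g|\<^sup>2\<close> is integrated by bounding one factor by its supremum.\<close>

lemma sobolev_norm_fun_neg_le:
  fixes f :: "real \<Rightarrow> complex"
  assumes \<alpha>: "\<alpha> > 0" and f: "integrable lborel f" and A: "\<And>x. cmod (f x) \<le> A"
  shows "sobolev_norm_fun (- \<alpha>) f \<le> ennreal (sqrt (A * (LBINT x. cmod (f x))))"
proof -
  define a where "a = \<alpha> / 2"
  have a: "a > 0" using \<alpha> by (simp add: a_def)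
  have [measurable]: "f \<in> borel_measurable borel" using f by auto
  define K where "K = bessel_kernel a"
  have [measurable]: "K \<in> borel_measurable borel" by (simp add: K_def)
  have K0: "K z \<ge> 0" for z unfolding K_def by (rule bessel_kernel_nonneg[OF a])
  note Kint = bessel_kernel_integral[OF a, folded K_def]
  have A0: "A \<ge> 0" using order_trans[OF norm_ge_zero A[of 0]] .
  have fphi: "integrable lborel (\<lambda>x. f x * \<phi> x)" if phi: "schwartz \<phi>" for \<phi>
  proof -
    obtain C where C: "\<And>x. cmod (\<phi> x) \<le> C" using schwartz_bounded[OF phi] by blast
    have [measurable]: "\<phi> \<in> borel_measurable borel" by (rule schwartz_measurable[OF phi])
    show ?thesis
    proof (rule Bochner_Integration.integrable_bound)
      show "integrable lborel (\<lambda>x. of_real C * f x)" using f by simp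
      show "AE x in lborel. cmod (f x * \<phi> x) \<le> cmod (of_real C * f x)"
        using C by (auto simp: norm_mult mult.commute[of "cmod (f _)"] intro!: mult_right_mono order_trans[OF _ abs_ge_self])
    qed measurable
  qed
  \<comment> \<open>The pairing is bounded by \<open>L\<^sup>1\<close> norm times supremum, so a single seminorm suffices for continuity.\<close>
  define T where "T = (\<lambda>\<phi>. \<integral>x. f x * \<phi> x \<partial>lborel)"
  have temp: "tempered T"
    unfolding tempered_def
  proof (intro conjI exI allI impI)
    fix \<phi> \<psi> and b c :: complex
    assume "schwartz \<phi>" "schwartz \<psi>"
    then have "(LBINT x. b * (f x * \<phi> x) + c * (f x * \<psi> x)) = b * T \<phi> + c * T \<psi>"
      unfolding T_def by (subst Bochner_Integration.integral_add) (auto intro: fphi)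
    then show "T (\<lambda>x. b * \<phi> x + c * \<psi> x) = b * T \<phi> + c * T \<psi>"
      by (simp add: T_def algebra_simps)
  next
    fix \<phi> assume phi: "schwartz \<phi>"
    define S where "S = schwartz_seminorm 0 0 \<phi>"
    have S: "cmod (\<phi> x) \<le> S" for x
    proof -
      obtain C where C: "\<And>x. cmod (\<phi> x) \<le> C" using schwartz_bounded[OF phi] by blast
      show ?thesis unfolding S_def schwartz_seminorm_def
        by (rule cSUP_upper2[of _ _ x]) (auto simp: iter_deriv_0 intro!: bdd_aboveI[of _ C] C)
    qed
    have "cmod (T \<phi>) \<le> (LBINT x. cmod (f x * \<phi> x))"
      unfolding T_def by (rule integral_norm_bound)
    also have "\<dots> \<le> (LBINT x. cmod (f x) * S)"
      by (intro integral_mono integrable_norm fphi phi integrable_mult_left f)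
         (auto simp: norm_mult intro!: mult_left_mono S)
    also have "\<dots> = (LBINT x. cmod (f x)) * (\<Sum>k\<le>0. \<Sum>m\<le>0. schwartz_seminorm k m \<phi>)"
      by (simp add: S_def)
    finally show "cmod (T \<phi>) \<le> (LBINT x. cmod (f x)) * (\<Sum>k\<le>0. \<Sum>m\<le>0. schwartz_seminorm k m \<phi>)" .
  qed
  define g where "g = (\<lambda>y. \<integral>x. of_real (K (x - y)) * f x \<partial>lborel)"
  have [measurable]: "g \<in> borel_measurable borel" unfolding g_def by measurable
  have Kf: "integrable plane (\<lambda>(x, y). of_real (K (x - y)) * f x)"
  proof (rule lborel_pair.Fubini_integrable)
    show "integrable lborel (\<lambda>x. \<integral>y. norm (case (x, y) of (x, y) \<Rightarrow> of_real (K (x - y)) * f x) \<partial>lborel)"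
      using f by (simp add: norm_mult K0 Kint)
    have "integrable lborel (\<lambda>y. of_real (K (x - y)) :: complex)" for x
      using Kint(1) by auto
    then show "AE x in lborel. integrable lborel (\<lambda>y. case (x, y) of (x, y) \<Rightarrow> of_real (K (x - y)) * f x)"
      by simp
  qed measurable
  have gA: "cmod (g y) \<le> A" for y
  proof -
    have Ki: "integrable lborel (\<lambda>x. K (x - y))" "(LBINT x. K (x - y)) = 1"
      using Kint[of y] unfolding K_def by (simp_all add: bessel_kernel_swap[of a y])
    have "cmod (g y) \<le> (LBINT x. cmod (of_real (K (x - y)) * f x))"
      unfolding g_def by (rule integral_norm_bound)
    also have "\<dots> \<le> (LBINT x. K (x - y) * A)"
      by (intro integral_mono' integrable_mult_left Ki) (auto simp: norm_mult K0 A A0 intro!: mult_left_mono)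
    also have "\<dots> = A" using Ki by simp
    finally show ?thesis .
  qed
  have g_int: "integrable lborel g"
    using lborel_pair.integrable_snd[OF Kf] by (simp add: g_def)
  have gL: "(LBINT y. cmod (g y)) \<le> (LBINT x. cmod (f x))"
  proof -
    have n: "integrable plane (\<lambda>(x, y). K (x - y) * cmod (f x))"
      using integrable_norm[OF Kf] by (simp add: case_prod_unfold norm_mult K0)
    have "(LBINT y. cmod (g y)) \<le> (\<integral>y. \<integral>x. K (x - y) * cmod (f x) \<partial>lborel \<partial>lborel)"
    proof (intro integral_mono integrable_norm g_int lborel_pair.integrable_snd[OF n])
      fix y show "cmod (g y) \<le> (LBINT x. K (x - y) * cmod (f x))"
        unfolding g_def using integral_norm_bound[of lborel "\<lambda>x. of_real (K (x - y)) * f x"]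
        by (simp add: norm_mult K0)
    qed
    also have "\<dots> = (\<integral>x. \<integral>y. K (x - y) * cmod (f x) \<partial>lborel \<partial>lborel)"
      by (rule lborel_pair.Fubini_integral[OF n])
    also have "\<dots> = (LBINT x. cmod (f x))"
      by (simp add: Kint)
    finally show ?thesis .
  qed
  have sq_le: "(cmod (g y))\<^sup>2 \<le> A * cmod (g y)" for y
    using gA[of y] by (simp add: power2_eq_square mult_right_mono)
  have g2: "integrable lborel (\<lambda>y. (cmod (g y))\<^sup>2)"
  proof (rule Bochner_Integration.integrable_bound)
    show "integrable lborel (\<lambda>y. A * cmod (g y))" using g_int by simp
    show "AE y in lborel. norm ((cmod (g y))\<^sup>2) \<le> norm (A * cmod (g y))"
      using sq_le A0 by auto
  qed measurable
  have g2_le: "(LBINT y. (cmod (g y))\<^sup>2) \<le> A * (LBINT x. cmod (f x))"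
  proof -
    have "(LBINT y. (cmod (g y))\<^sup>2) \<le> (LBINT y. A * cmod (g y))"
      using g_int by (intro integral_mono g2 sq_le) simp
    also have "\<dots> \<le> A * (LBINT x. cmod (f x))"
      using gL A0 by (simp add: mult_left_mono)
    finally show ?thesis .
  qed
  let ?S = "dist_inv_fourier (dist_mult (\<lambda>\<xi>. (1 + \<xi>\<^sup>2) powr (- \<alpha> / 2)) (dist_fourier T))"
  have rep: "?S \<phi> = (LBINT y. g y * \<phi> y)" if phi: "schwartz \<phi>" for \<phi>
  proof -
    obtain C where C: "\<And>x. cmod (\<phi> x) \<le> C" using schwartz_bounded[OF phi] by blast
    have [measurable]: "\<phi> \<in> borel_measurable borel" by (rule schwartz_measurable[OF phi])
    have int: "integrable plane (\<lambda>(x, y). of_real (K (x - y)) * f x * \<phi> y)"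
    proof (rule Bochner_Integration.integrable_bound)
      show "integrable plane (\<lambda>p. of_real C * (case p of (x, y) \<Rightarrow> of_real (K (x - y)) * f x))"
        using Kf by (rule integrable_mult_right)
      show "AE p in plane. cmod (case p of (x, y) \<Rightarrow> of_real (K (x - y)) * f x * \<phi> y)
         \<le> cmod (of_real C * (case p of (x, y) \<Rightarrow> of_real (K (x - y)) * f x))"
        using C by (intro AE_I2) (auto simp: norm_mult K0 mult.commute[of _ "cmod (\<phi> _)"] intro!: mult_right_mono order_trans[OF _ abs_ge_self])
    qed measurable
    have "?S \<phi> = (\<integral>x. f x * (LBINT y. of_real (K (x - y)) * \<phi> y) \<partial>lborel)"
      using bessel_multiplier[OF a phi]
      by (simp add: dist_inv_fourier_def dist_mult_def dist_fourier_def T_def K_def a_def)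
    also have "\<dots> = (\<integral>x. \<integral>y. of_real (K (x - y)) * f x * \<phi> y \<partial>lborel \<partial>lborel)"
      by (simp add: mult_ac flip: integral_mult_right_zero)
    also have "\<dots> = (\<integral>y. \<integral>x. of_real (K (x - y)) * f x * \<phi> y \<partial>lborel \<partial>lborel)"
      by (rule lborel_pair.Fubini_integral[OF int, symmetric])
    also have "\<dots> = (LBINT y. g y * \<phi> y)"
      unfolding g_def by (simp only: integral_mult_left_zero)
    finally show ?thesis .
  qed
  have "dist_L2_norm ?S \<le> ennreal (sqrt (LBINT y. (cmod (g y))\<^sup>2))"
    unfolding dist_L2_norm_def using g2 rep by (intro INF_lower) auto
  also have "\<dots> \<le> ennreal (sqrt (A * (LBINT x. cmod (f x))))"
    by (intro ennreal_leI real_sqrt_le_mono g2_le)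
  finally show ?thesis
    using fphi temp unfolding sobolev_norm_fun_def sobolev_norm_def T_def by simp
qed

section \<open>Exponential generating functions in two variables\<close>

text \<open>The exponential generating function of a sequence. Coefficients of at most geometric growth make it an
  entire function of exponential type, and differentiation becomes a shift of the sequence.\<close>

definition egf :: "(nat \<Rightarrow> complex) \<Rightarrow> real \<Rightarrow> complex" where
  "egf a x = (\<Sum>k. a k * of_real (x ^ k / fact k))"

lemma real_exp_sums: "(\<lambda>k. y ^ k / fact k) sums exp (y::real)"
  using exp_converges[of y] by (simp add: field_simps)

lemma egf_bounds:
  assumes a: "\<And>k. cmod (a k) \<le> C * T ^ k" and T: "T \<ge> 0"
  shows "summable (\<lambda>k. cmod (a k * of_real (x ^ k / fact k)))"
    and "cmod (egf a x) \<le> C * exp (T * \<bar>x\<bar>)"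
proof -
  have s: "(\<lambda>k. C * ((T * \<bar>x\<bar>) ^ k / fact k)) sums (C * exp (T * \<bar>x\<bar>))"
    by (intro sums_mult real_exp_sums)
  have le: "cmod (a k * of_real (x ^ k / fact k)) \<le> C * ((T * \<bar>x\<bar>) ^ k / fact k)" for k
  proof -
    have "cmod (a k) * (\<bar>x\<bar> ^ k / fact k) \<le> C * T ^ k * (\<bar>x\<bar> ^ k / fact k)"
      by (intro mult_right_mono a) auto
    then show ?thesis
      by (simp add: norm_mult norm_divide norm_power power_mult_distrib mult_ac)
  qed
  show sm: "summable (\<lambda>k. cmod (a k * of_real (x ^ k / fact k)))"
    by (rule summable_comparison_test'[OF sums_summable[OF s]]) (use le in auto)
  have "cmod (egf a x) \<le> (\<Sum>k. cmod (a k * of_real (x ^ k / fact k)))"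
    unfolding egf_def by (rule summable_norm[OF sm])
  also have "\<dots> \<le> C * exp (T * \<bar>x\<bar>)"
    unfolding sums_unique[OF s] by (rule suminf_le[OF le sm sums_summable[OF s]])
  finally show "cmod (egf a x) \<le> C * exp (T * \<bar>x\<bar>)" .
qed

lemma egf_has_vector_derivative:
  assumes a: "\<And>k. cmod (a k) \<le> C * T ^ k" and T: "T \<ge> 0"
  shows "(egf a has_vector_derivative egf (\<lambda>k. a (Suc k)) x) (at x)"
proof -
  define c where "c k = a k / fact k" for k
  have cy: "norm (c n * y ^ n) = norm (a n * of_real (norm y ^ n / fact n))" for n and y :: complex
    by (simp add: c_def norm_mult norm_divide norm_power)
  have "summable (\<lambda>n. c n * y ^ n)" for y
    by (rule summable_norm_cancel) (use egf_bounds(1)[OF assms, of "norm y"] in \<open>simp add: cy\<close>)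
  then have "((\<lambda>z. \<Sum>n. c n * z ^ n) has_field_derivative (\<Sum>n. diffs c n * of_real x ^ n)) (at (of_real x))"
    by (rule termdiffs_strong_converges_everywhere)
  from has_vector_derivative_real_field[OF this]
  have "((\<lambda>x. \<Sum>n. c n * of_real x ^ n) has_vector_derivative (\<Sum>n. diffs c n * of_real x ^ n)) (at x)" .
  moreover have "diffs c n = a (Suc n) / fact n" for n
    by (simp add: diffs_def c_def del: of_nat_Suc)
  ultimately show ?thesis
    unfolding egf_def[abs_def] by (simp add: c_def)
qed

definition double_egf :: "(nat \<Rightarrow> nat \<Rightarrow> complex) \<Rightarrow> real \<Rightarrow> real \<Rightarrow> complex" where
  "double_egf a t x = egf (\<lambda>j. egf (a j) x) t"

context
  fixes a :: "nat \<Rightarrow> nat \<Rightarrow> complex" and C T :: real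
  assumes a: "\<And>j k. cmod (a j k) \<le> C * T ^ (j + k)" and T: "T \<ge> 0"
begin

lemma double_row: "cmod (a j k) \<le> (C * T ^ j) * T ^ k"
  using a[of j k] by (simp add: power_add mult_ac)

lemma double_row_egf: "cmod (egf (a j) x) \<le> (C * exp (T * \<bar>x\<bar>)) * T ^ j"
  using egf_bounds(2)[OF double_row T, of j x] by (simp add: mult_ac)

lemma double_egf_abs_summable:
  "(\<lambda>p. norm (case p of (j, k) \<Rightarrow> a j k * of_real (x ^ k / fact k) * of_real (t ^ j / fact j))) summable_on UNIV"
proof -
  let ?g = "\<lambda>(j, k). a j k * of_real (x ^ k / fact k) * of_real (t ^ j / fact j)"
  have T0: "0 \<le> T * \<bar>y\<bar>" for y using T by simp
  have row: "(\<lambda>k. norm ((T * \<bar>x\<bar>) ^ k / fact k)) summable_on UNIV" for x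
    using norm_summable_imp_summable_on[of "\<lambda>k. (T * \<bar>x\<bar>) ^ k / fact k"] sums_summable[OF real_exp_sums, of "T * \<bar>x\<bar>"] T0
    by (simp add: norm_mult norm_power)
  have sm: "(\<lambda>p. norm (case p of (j, k) \<Rightarrow> (C * ((T * \<bar>t\<bar>) ^ j / fact j)) * ((T * \<bar>x\<bar>) ^ k / fact k))) summable_on UNIV \<times> UNIV"
    by (rule Infinite_Sum.abs_summable_on_Sigma_iff[THEN iffD2])
       (use row in \<open>auto simp: norm_mult abs_mult infsum_cmult_right' intro!: summable_on_cmult_left summable_on_cmult_right simp del: times_divide_eq_left times_divide_eq_right\<close>)
  have "(\<lambda>p. norm (?g p)) summable_on UNIV \<times> UNIV"
  proof (rule Infinite_Sum.abs_summable_on_comparison_test[OF sm])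
    fix p :: "nat \<times> nat"
    obtain j k where p: "p = (j, k)" by fastforce
    have "cmod (a j k) * (\<bar>x\<bar> ^ k / fact k * (\<bar>t\<bar> ^ j / fact j)) \<le> (C * T ^ (j + k)) * (\<bar>x\<bar> ^ k / fact k * (\<bar>t\<bar> ^ j / fact j))"
      by (intro mult_right_mono a) auto
    also have "\<dots> \<le> \<bar>C * ((T * \<bar>t\<bar>) ^ j / fact j) * ((T * \<bar>x\<bar>) ^ k / fact k)\<bar>"
      by (rule order_trans[OF _ abs_ge_self]) (simp add: power_mult_distrib power_add mult_ac)
    finally show "norm (?g p) \<le> norm (case p of (j, k) \<Rightarrow> (C * ((T * \<bar>t\<bar>) ^ j / fact j)) * ((T * \<bar>x\<bar>) ^ k / fact k))"
      by (simp add: p norm_mult norm_divide norm_power mult_ac)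
  qed
  then show ?thesis by simp
qed

lemma infsum_egf:
  assumes "\<And>k. cmod (b k) \<le> C' * T ^ k"
  shows "(\<Sum>\<^sub>\<infinity>k. b k * of_real (x ^ k / fact k)) = egf b x"
proof -
  have sm: "summable (\<lambda>k. cmod (b k * of_real (x ^ k / fact k)))"
    by (rule egf_bounds(1)[OF assms T])
  show ?thesis
    unfolding egf_def
    by (rule infsumI[OF norm_summable_imp_has_sum[OF sm summable_sums[OF summable_norm_cancel[OF sm]]]])
qed

lemma double_egf_has_sum:
  "((\<lambda>(j, k). a j k * of_real (x ^ k / fact k) * of_real (t ^ j / fact j)) has_sum double_egf a t x) UNIV"
proof -
  let ?g = "\<lambda>(j, k). a j k * of_real (x ^ k / fact k) * of_real (t ^ j / fact j)"
  have sm: "?g summable_on UNIV \<times> UNIV"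
    using abs_summable_summable[OF double_egf_abs_summable] by simp
  have "infsum ?g (UNIV \<times> UNIV) = (\<Sum>\<^sub>\<infinity>j. \<Sum>\<^sub>\<infinity>k. a j k * of_real (x ^ k / fact k) * of_real (t ^ j / fact j))"
    using infsum_Sigma'_banach[of "\<lambda>j k. ?g (j, k)"] sm by simp
  also have "\<dots> = (\<Sum>\<^sub>\<infinity>j. (\<Sum>\<^sub>\<infinity>k. a j k * of_real (x ^ k / fact k)) * of_real (t ^ j / fact j))"
    by (simp only: infsum_cmult_left')
  also have "\<dots> = double_egf a t x"
    unfolding double_egf_def infsum_egf[OF double_row]
    by (rule infsum_egf[OF double_row_egf])
  finally show ?thesis using has_sum_infsum[OF sm] by (simp only: UNIV_Times_UNIV)
qed

text \<open>The sum over pairs is unconditional, so it may be taken along squares. These partial sums are the finite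
  linear combinations of noise integrals to which Fatou's lemma is applied later.\<close>

lemma double_egf_LIMSEQ:
  "(\<lambda>N. \<Sum>j<N. \<Sum>k<N. a j k * of_real (t ^ j / fact j * (x ^ k / fact k))) \<longlonglongrightarrow> double_egf a t x"
proof -
  have "filterlim (\<lambda>N::nat. {..<N} \<times> {..<N}) (finite_subsets_at_top UNIV) sequentially"
    unfolding filterlim_finite_subsets_at_top
  proof (intro allI impI)
    fix X :: "(nat \<times> nat) set" assume X: "finite X \<and> X \<subseteq> UNIV"
    then obtain n where n: "\<forall>m\<in>fst ` X \<union> snd ` X. m < n"
      using finite_nat_set_iff_bounded[of "fst ` X \<union> snd ` X"] by auto
    show "\<forall>\<^sub>F N in sequentially. finite ({..<N} \<times> {..<N}) \<and> X \<subseteq> {..<N} \<times> {..<N} \<and> {..<N} \<times> {..<N} \<subseteq> UNIV"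
      using eventually_ge_at_top[of n]
    proof eventually_elim
      case (elim N)
      then show ?case using n by (force dest: bspec)
    qed
  qed
  from filterlim_compose[OF double_egf_has_sum[of x t, unfolded has_sum_def] this]
  show ?thesis
    by (simp add: sum.cartesian_product mult_ac case_prod_unfold)
qed

end

text \<open>Both iterated sums are limits of the same sums over squares.\<close>

lemma double_egf_swap:
  assumes a: "\<And>j k. cmod (a j k) \<le> C * T ^ (j + k)" and T: "T \<ge> 0"
  shows "double_egf a t x = double_egf (\<lambda>k j. a j k) x t"
proof -
  have a': "cmod (a k j) \<le> C * T ^ (j + k)" for j k
    using a[of k j] by (simp add: add.commute)
  show ?thesis
    by (rule LIMSEQ_unique[OF double_egf_LIMSEQ[OF a T, of t x]])
       (use double_egf_LIMSEQ[OF a' T, of x t] in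
        \<open>subst (asm) sum.swap, simp add: mult_ac\<close>)
qed

lemma double_egf_deriv_left:
  assumes a: "\<And>j k. cmod (a j k) \<le> C * T ^ (j + k)" and T: "T \<ge> 0"
  shows "((\<lambda>t. double_egf a t x) has_vector_derivative double_egf (\<lambda>j. a (Suc j)) t x) (at t)"
  unfolding double_egf_def by (rule egf_has_vector_derivative[OF double_row_egf[OF a T] T])

lemma double_egf_deriv_right:
  assumes a: "\<And>j k. cmod (a j k) \<le> C * T ^ (j + k)" and T: "T \<ge> 0"
  shows "((\<lambda>x. double_egf a t x) has_vector_derivative double_egf (\<lambda>j k. a j (Suc k)) t x) (at x)"
proof -
  have a': "cmod (a k j) \<le> C * T ^ (j + k)" "cmod (a j (Suc k)) \<le> C * T * T ^ (j + k)" for j k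
    using a[of k j] a[of j "Suc k"] by (simp_all add: add.commute mult_ac)
  show ?thesis
    using double_egf_deriv_left[of "\<lambda>k j. a j k" C T t x, OF a'(1) T]
    unfolding double_egf_swap[OF a'(2) T] by (subst double_egf_swap[OF a T])
qed

lemma mixed_deriv_double_egf:
  assumes a: "\<And>j k. cmod (a j k) \<le> C * T ^ (j + k)" and T: "T \<ge> 0"
  shows "mixed_deriv (double_egf a) t x = double_egf (\<lambda>j k. a (Suc j) (Suc k)) t x"
proof -
  have a': "cmod (a j (Suc k)) \<le> C * T * T ^ (j + k)" for j k
    using a[of j "Suc k"] by (simp add: mult_ac)
  show ?thesis
    unfolding mixed_deriv_def
    by (simp add: vector_derivative_at[OF double_egf_deriv_right[OF a T]]
        vector_derivative_at[OF double_egf_deriv_left[OF a' T]])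
qed

text \<open>Both sides are continuous in each variable separately, so agreement extends from the rationals first in
  \<open>x\<close> and then in \<open>t\<close>.\<close>

lemma double_egf_eqI:
  assumes a: "\<And>j k. cmod (a j k) \<le> C * T ^ (j + k)" and T: "T \<ge> 0"
    and b: "continuous_on UNIV (\<lambda>(t, x). b t x)"
    and eq: "\<And>t x. t \<in> \<rat> \<Longrightarrow> x \<in> \<rat> \<Longrightarrow> b t x = double_egf a t x"
  shows "b = double_egf a"
proof -
  have ext_Rats: "f = g" if "continuous_on UNIV f" "continuous_on UNIV g" "\<And>x. x \<in> \<rat> \<Longrightarrow> f x = g x"
    for f g :: "real \<Rightarrow> complex"
  proof
    fix x
    have "closed {x. f x = g x}" by (intro closed_Collect_eq that)
    then have "closure \<rat> \<subseteq> {x. f x = g x}" using that(3) by (intro closure_minimal) auto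
    then show "f x = g x" by (auto simp: Rats_closure_real)
  qed
  have cl: "continuous_on UNIV (\<lambda>t. double_egf a t x)" for x
    using double_egf_deriv_left[OF a T]
    by (meson continuous_at_imp_continuous_on has_vector_derivative_continuous)
  have cr: "continuous_on UNIV (\<lambda>x. double_egf a t x)" for t
    using double_egf_deriv_right[OF a T]
    by (meson continuous_at_imp_continuous_on has_vector_derivative_continuous)
  have bl: "continuous_on UNIV (\<lambda>t. b t x)" and br: "continuous_on UNIV (\<lambda>x. b t x)" for t x
    using continuous_on_compose2[OF b, of UNIV "\<lambda>t. (t, x)"] continuous_on_compose2[OF b, of UNIV "\<lambda>x. (t, x)"]
      continuous_on_Pair[OF continuous_on_id continuous_on_const, of UNIV x]
      continuous_on_Pair[OF continuous_on_const continuous_on_id, of UNIV t]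
    by (auto simp: id_def)
  have "b t = double_egf a t" if "t \<in> \<rat>" for t
    by (rule ext_Rats[OF br cr]) (rule eq[OF that])
  then have "(\<lambda>t. b t x) = (\<lambda>t. double_egf a t x)" for x
    by (intro ext_Rats bl cl) simp
  then show ?thesis by (intro ext) metis
qed

lemma double_egf_measurable[measurable (raw)]:
  assumes [measurable]: "\<And>j k. (\<lambda>\<omega>. a \<omega> j k) \<in> borel_measurable M"
    "t \<in> borel_measurable M" "x \<in> borel_measurable M"
  shows "(\<lambda>\<omega>. double_egf (a \<omega>) (t \<omega>) (x \<omega>)) \<in> borel_measurable M"
  unfolding double_egf_def egf_def by measurable

text \<open>Partial sums are generating functions themselves and inherit the growth bounds.\<close>

lemma egf_truncate: "egf (\<lambda>k. if k < N then a k else 0) x = (\<Sum>k<N. a k * of_real (x ^ k / fact k))"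
proof -
  have "egf (\<lambda>k. if k < N then a k else 0) x = (\<Sum>k<N. (if k < N then a k else 0) * of_real (x ^ k / fact k))"
    unfolding egf_def by (rule suminf_finite) auto
  then show ?thesis by simp
qed

lemma egf_partial_bound:
  assumes a: "\<And>k. cmod (a k) \<le> T ^ k" and T: "T \<ge> 0"
  shows "cmod (\<Sum>k<N. a k * of_real (x ^ k / fact k)) \<le> exp (T * \<bar>x\<bar>)"
    and "(\<lambda>N. \<Sum>k<N. a k * of_real (x ^ k / fact k)) \<longlonglongrightarrow> egf a x"
proof -
  have "cmod (if k < N then a k else 0) \<le> 1 * T ^ k" for k using a T by simp
  from egf_bounds(2)[OF this T, of x] show "cmod (\<Sum>k<N. a k * of_real (x ^ k / fact k)) \<le> exp (T * \<bar>x\<bar>)"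
    by (simp add: egf_truncate)
  have "summable (\<lambda>k. cmod (a k * of_real (x ^ k / fact k)))"
    using egf_bounds(1)[of a 1 T x] a T by simp
  then show "(\<lambda>N. \<Sum>k<N. a k * of_real (x ^ k / fact k)) \<longlonglongrightarrow> egf a x"
    unfolding egf_def by (rule summable_LIMSEQ[OF summable_norm_cancel])
qed

lemma exp_sums_egf: "(\<lambda>k. (\<i> * of_real \<xi>) ^ k * of_real (t ^ k / fact k)) sums iexp (\<xi> * t)"
proof -
  have "(\<i> * of_real (\<xi> * t)) ^ k /\<^sub>R fact k = (\<i> * of_real \<xi>) ^ k * of_real (t ^ k / fact k)" for k
    by (simp add: scaleR_conv_of_real power_mult_distrib divide_inverse mult_ac)
  then show ?thesis
    using exp_converges[of "\<i> * of_real (\<xi> * t)"] by (simp only:)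
qed

lemma egf_power: "egf (\<lambda>k. (\<i> * of_real \<xi>) ^ k) t = iexp (\<xi> * t)"
  unfolding egf_def by (rule sums_unique[OF exp_sums_egf, symmetric])

definition shift_seq :: "(nat \<Rightarrow> 'a::zero) \<Rightarrow> nat \<Rightarrow> 'a" where
  "shift_seq a k = (case k of 0 \<Rightarrow> 0 | Suc k' \<Rightarrow> a k')"

lemma shift_seq_simps [simp]: "shift_seq a 0 = 0" "shift_seq a (Suc k) = a k"
  by (simp_all add: shift_seq_def)

section \<open>Square integrable functions and their noise integrals\<close>

text \<open>The squared \<open>L\<^sup>2\<close> norm, possibly infinite. It is used for random variables and for frequency kernels alike.\<close>

definition L2_sq :: "'a measure \<Rightarrow> ('a \<Rightarrow> complex) \<Rightarrow> ennreal" where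
  "L2_sq M f = (\<integral>\<^sup>+x. ennreal ((cmod (f x))\<^sup>2) \<partial>M)"

lemma norm_add_sq_le: "(cmod (a + b))\<^sup>2 \<le> 2 * (cmod a)\<^sup>2 + 2 * (cmod b)\<^sup>2"
proof -
  have "(cmod (a + b))\<^sup>2 \<le> (cmod a + cmod b)\<^sup>2"
    by (intro power_mono norm_triangle_ineq) simp
  also have "\<dots> \<le> 2 * (cmod a)\<^sup>2 + 2 * (cmod b)\<^sup>2"
    using sum_squares_bound[of "cmod a" "cmod b"] by (simp add: power2_sum)
  finally show ?thesis .
qed

lemma L2_sq_add_le:
  assumes [measurable]: "f \<in> borel_measurable M" "g \<in> borel_measurable M"
  shows "L2_sq M (\<lambda>x. f x + g x) \<le> 2 * L2_sq M f + 2 * L2_sq M g"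
proof -
  have "L2_sq M (\<lambda>x. f x + g x) \<le> (\<integral>\<^sup>+x. 2 * ennreal ((cmod (f x))\<^sup>2) + 2 * ennreal ((cmod (g x))\<^sup>2) \<partial>M)"
    unfolding L2_sq_def
  proof (rule nn_integral_mono)
    fix x
    have "2 * ennreal ((cmod (f x))\<^sup>2) + 2 * ennreal ((cmod (g x))\<^sup>2) = ennreal (2 * (cmod (f x))\<^sup>2 + 2 * (cmod (g x))\<^sup>2)"
      by (simp add: ennreal_plus ennreal_mult)
    then show "ennreal ((cmod (f x + g x))\<^sup>2) \<le> 2 * ennreal ((cmod (f x))\<^sup>2) + 2 * ennreal ((cmod (g x))\<^sup>2)"
      using norm_add_sq_le by (simp only: ennreal_leI)
  qed
  also have "\<dots> = 2 * L2_sq M f + 2 * L2_sq M g"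
    unfolding L2_sq_def by (simp add: nn_integral_add nn_integral_cmult)
  finally show ?thesis .
qed

lemma L2_sq_cmult:
  assumes [measurable]: "f \<in> borel_measurable M"
  shows "L2_sq M (\<lambda>x. c * f x) = ennreal ((cmod c)\<^sup>2) * L2_sq M f"
  unfolding L2_sq_def
  by (simp add: norm_mult power_mult_distrib ennreal_mult nn_integral_cmult)

lemma L2_sq_minus_commute:
  "L2_sq M (\<lambda>x. f x - g x) = L2_sq M (\<lambda>x. g x - f x)"
  unfolding L2_sq_def by (simp add: norm_minus_commute)

lemma tendsto_0_comparison_ennreal:
  fixes f g :: "nat \<Rightarrow> ennreal"
  assumes "g \<longlonglongrightarrow> 0" "\<And>n. f n \<le> g n"
  shows "f \<longlonglongrightarrow> 0"
  by (rule tendsto_sandwich[OF _ _ tendsto_const assms(1)]) (use assms(2) in auto)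

text \<open>The Riesz--Fischer argument: the series of the squared increments, weighted by \<open>4\<^sup>k\<close>, is almost surely finite,
  so the sequence converges almost surely at rate \<open>2\<^sup>-\<^sup>k\<close>, and the same series dominates the squared distance
  to the limit.\<close>

lemma L2_sq_fast_Cauchy:
  fixes X :: "nat \<Rightarrow> 'a \<Rightarrow> complex"
  assumes [measurable]: "\<And>k. X k \<in> borel_measurable M"
    and C: "\<And>k. L2_sq M (\<lambda>\<omega>. X (Suc k) \<omega> - X k \<omega>) \<le> ennreal (C / 8 ^ k)"
  shows "\<exists>Z \<in> borel_measurable M. (\<lambda>k. L2_sq M (\<lambda>\<omega>. Z \<omega> - X k \<omega>)) \<longlonglongrightarrow> 0"
proof -
  define Y where "Y \<omega> = (\<Sum>k. ennreal (4 ^ k * (cmod (X (Suc k) \<omega> - X k \<omega>))\<^sup>2))" for \<omega>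
  have [measurable]: "Y \<in> borel_measurable M" unfolding Y_def by measurable
  define C' where "C' = max C 0"
  have p4: "(2 ^ k)\<^sup>2 = (4::real) ^ k" and p8: "(8::real) ^ k = 4 ^ k * 2 ^ k" for k :: nat
    by (simp_all add: power2_eq_square flip: power_mult_distrib)
  have "(\<integral>\<^sup>+\<omega>. Y \<omega> \<partial>M) = (\<Sum>k. ennreal (4 ^ k) * L2_sq M (\<lambda>\<omega>. X (Suc k) \<omega> - X k \<omega>))"
    unfolding Y_def L2_sq_def
    by (subst nn_integral_suminf) (auto simp: ennreal_mult nn_integral_cmult)
  also have "\<dots> \<le> (\<Sum>k. ennreal (C' * (1/2) ^ k))"
  proof (intro suminf_le summableI)
    fix k
    have "ennreal (4 ^ k) * L2_sq M (\<lambda>\<omega>. X (Suc k) \<omega> - X k \<omega>) \<le> ennreal (4 ^ k) * ennreal (C' / 8 ^ k)"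
      by (intro mult_left_mono order_trans[OF C] ennreal_leI) (auto simp: C'_def divide_right_mono)
    also have "\<dots> = ennreal (4 ^ k * (C' / 8 ^ k))"
      by (subst ennreal_mult) (auto simp: C'_def)
    also have "4 ^ k * (C' / 8 ^ k) = C' * (1/2) ^ k"
      by (simp add: power_divide p8)
    finally show "ennreal (4 ^ k) * L2_sq M (\<lambda>\<omega>. X (Suc k) \<omega> - X k \<omega>) \<le> ennreal (C' * (1/2) ^ k)" .
  qed
  also have "\<dots> = ennreal (\<Sum>k. C' * (1/2) ^ k)"
    by (rule suminf_ennreal2) (auto simp: C'_def)
  finally have Yfin: "(\<integral>\<^sup>+\<omega>. Y \<omega> \<partial>M) < \<infinity>"
    by (rule le_less_trans) simp
  then have "AE \<omega> in M. Y \<omega> \<noteq> \<infinity>"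
    by (intro nn_integral_noteq_infinite) auto
  then have AE_Y: "AE \<omega> in M. convergent (\<lambda>k. X k \<omega>) \<and>
      (\<forall>k. ennreal ((cmod (lim (\<lambda>k. X k \<omega>) - X k \<omega>))\<^sup>2) \<le> ennreal (4 / 4 ^ k) * Y \<omega>)"
  proof eventually_elim
    case (elim \<omega>)
    then obtain r where r: "Y \<omega> = ennreal r" "r \<ge> 0"
      by (cases "Y \<omega>") auto
    have step: "cmod (X (Suc k) \<omega> - X k \<omega>) \<le> sqrt r / 2 ^ k" for k
    proof -
      have "ennreal (4 ^ k * (cmod (X (Suc k) \<omega> - X k \<omega>))\<^sup>2) \<le> Y \<omega>"
      proof -
        have "sum f {k} \<le> suminf f" for f :: "nat \<Rightarrow> ennreal"
          by (rule sum_le_suminf) auto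
        then have "f k \<le> suminf f" for f :: "nat \<Rightarrow> ennreal"
          by simp
        then show ?thesis unfolding Y_def .
      qed
      then have "4 ^ k * (cmod (X (Suc k) \<omega> - X k \<omega>))\<^sup>2 \<le> r"
        using r by simp
      then have "(2 ^ k * cmod (X (Suc k) \<omega> - X k \<omega>))\<^sup>2 \<le> r"
        by (simp add: power_mult_distrib p4)
      then have "2 ^ k * cmod (X (Suc k) \<omega> - X k \<omega>) \<le> sqrt r"
        by (rule real_le_rsqrt)
      then show ?thesis by (simp add: field_simps)
    qed
    have tail: "cmod (X (k + m) \<omega> - X k \<omega>) \<le> sqrt r * (2 / 2 ^ k - 2 / 2 ^ (k + m))" for k m
    proof (induction m)
      case (Suc m)
      have "cmod (X (k + Suc m) \<omega> - X k \<omega>) \<le> cmod (X (Suc (k + m)) \<omega> - X (k + m) \<omega>) + cmod (X (k + m) \<omega> - X k \<omega>)"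
        using norm_triangle_ineq[of "X (Suc (k + m)) \<omega> - X (k + m) \<omega>" "X (k + m) \<omega> - X k \<omega>"] by simp
      also have "\<dots> \<le> sqrt r / 2 ^ (k + m) + sqrt r * (2 / 2 ^ k - 2 / 2 ^ (k + m))"
        by (intro add_mono step Suc.IH)
      also have "\<dots> = sqrt r * (2 / 2 ^ k - 2 / 2 ^ (k + Suc m))"
        by (simp add: algebra_simps)
      finally show ?case .
    qed simp
    have tail': "cmod (X (k + m) \<omega> - X k \<omega>) \<le> 2 * sqrt r / 2 ^ k" for k m
      by (rule order_trans[OF tail]) (use r in \<open>simp add: algebra_simps\<close>)
    have "Cauchy (\<lambda>k. X k \<omega>)"
    proof (rule CauchyI')
      fix e :: real assume "e > 0"
      have "(\<lambda>k. 2 * sqrt r / 2 ^ k) \<longlonglongrightarrow> 0"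
        by (rule LIMSEQ_divide_realpow_zero) simp
      from order_tendstoD(2)[OF this \<open>e > 0\<close>]
      obtain N where N: "\<And>k. k \<ge> N \<Longrightarrow> 2 * sqrt r / 2 ^ k < e"
        unfolding eventually_sequentially by blast
      have "cmod (X m \<omega> - X n \<omega>) < e" if "m \<ge> N" "n > m" for m n
        using le_less_trans[OF tail'[of m "n - m"] N[OF that(1)]] that(2) by (simp add: norm_minus_commute)
      then show "\<exists>N. \<forall>m\<ge>N. \<forall>n>m. dist (X m \<omega>) (X n \<omega>) < e" unfolding dist_norm by blast
    qed
    then have conv: "convergent (\<lambda>k. X k \<omega>)" by (rule Cauchy_convergent)
    then have lim: "(\<lambda>k. X k \<omega>) \<longlonglongrightarrow> lim (\<lambda>k. X k \<omega>)"
      by (simp add: convergent_LIMSEQ_iff)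
    have "ennreal ((cmod (lim (\<lambda>k. X k \<omega>) - X k \<omega>))\<^sup>2) \<le> ennreal (4 / 4 ^ k) * Y \<omega>" for k
    proof -
      have "(\<lambda>m. X (k + m) \<omega>) \<longlonglongrightarrow> lim (\<lambda>k. X k \<omega>)"
        using LIMSEQ_ignore_initial_segment[OF lim, of k] by (simp add: add.commute)
      then have "(\<lambda>m. cmod (X (k + m) \<omega> - X k \<omega>)) \<longlonglongrightarrow> cmod (lim (\<lambda>k. X k \<omega>) - X k \<omega>)"
        by (intro tendsto_intros)
      then have "cmod (lim (\<lambda>k. X k \<omega>) - X k \<omega>) \<le> 2 * sqrt r / 2 ^ k"
        by (rule LIMSEQ_le_const2) (use tail' in auto)
      then have "(cmod (lim (\<lambda>k. X k \<omega>) - X k \<omega>))\<^sup>2 \<le> (2 * sqrt r / 2 ^ k)\<^sup>2"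
        by (intro power_mono) auto
      also have "\<dots> = 4 / 4 ^ k * r"
        using r by (simp add: power_mult_distrib power_divide p4)
      finally show ?thesis
        using r by (simp add: ennreal_mult'[symmetric] ennreal_leI del: times_divide_eq_left)
    qed
    with conv show ?case by blast
  qed
  define Z where "Z \<omega> = lim (\<lambda>k. X k \<omega>)" for \<omega>
  have [measurable]: "Z \<in> borel_measurable M" unfolding Z_def by measurable
  have "L2_sq M (\<lambda>\<omega>. Z \<omega> - X k \<omega>) \<le> ennreal (4 / 4 ^ k) * (\<integral>\<^sup>+\<omega>. Y \<omega> \<partial>M)" for k
  proof -
    have "L2_sq M (\<lambda>\<omega>. Z \<omega> - X k \<omega>) \<le> (\<integral>\<^sup>+\<omega>. ennreal (4 / 4 ^ k) * Y \<omega> \<partial>M)"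
      unfolding L2_sq_def Z_def by (rule nn_integral_mono_AE) (use AE_Y in eventually_elim, auto)
    then show ?thesis by (simp add: nn_integral_cmult)
  qed
  moreover have "(\<lambda>k. ennreal (4 / 4 ^ k) * (\<integral>\<^sup>+\<omega>. Y \<omega> \<partial>M)) \<longlonglongrightarrow> 0"
  proof -
    obtain q where q: "(\<integral>\<^sup>+\<omega>. Y \<omega> \<partial>M) = ennreal q" "q \<ge> 0"
      using Yfin by (cases "\<integral>\<^sup>+\<omega>. Y \<omega> \<partial>M") auto
    have "(\<lambda>k. 4 / 4 ^ k * q) \<longlonglongrightarrow> 0"
      using LIMSEQ_divide_realpow_zero[of 4 "4 * q"] by simp
    from tendsto_ennrealI[OF this] show ?thesis
      unfolding q(1) using q(2) by (simp add: ennreal_mult'[symmetric])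
  qed
  ultimately have "(\<lambda>k. L2_sq M (\<lambda>\<omega>. Z \<omega> - X k \<omega>)) \<longlonglongrightarrow> 0"
    by (rule tendsto_0_comparison_ennreal[rotated])
  then show ?thesis by (intro bexI[of _ Z]) auto
qed

definition noise_step :: "('b set \<Rightarrow> complex) \<Rightarrow> 'b set set \<Rightarrow> 'b \<Rightarrow> complex" where
  "noise_step c S z = (\<Sum>A\<in>S. c A * indicator A z)"

lemma finite_sets_measurable[measurable_dest]: "A \<in> finite_sets \<Longrightarrow> A \<in> sets borel"
  by (simp add: finite_sets_def)

lemma noise_step_measurable:
  assumes "S \<subseteq> finite_sets"
  shows "noise_step c S \<in> borel_measurable borel"
  unfolding noise_step_def
  using assms by (intro borel_measurable_sum borel_measurable_times borel_measurable_const borel_measurable_indicator)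
     (auto simp: finite_sets_def)

lemma is_noise_integral_iff:
  "is_noise_integral M W f X \<longleftrightarrow>
     f \<in> borel_measurable borel \<and> X \<in> borel_measurable M \<and>
     (\<exists>S c. (\<forall>k::nat. finite (S k) \<and> S k \<subseteq> finite_sets) \<and>
        (\<lambda>k. L2_sq lborel (\<lambda>z. f z - noise_step (c k) (S k) z)) \<longlonglongrightarrow> 0 \<and>
        (\<lambda>k. L2_sq M (\<lambda>\<omega>. X \<omega> - (\<Sum>A\<in>S k. c k A * W A \<omega>))) \<longlonglongrightarrow> 0)"
  unfolding is_noise_integral_def L2_sq_def noise_step_def ..

lemma centered_gaussian_square_integrable:
  assumes "prob_space M" "centered_gaussian M X"
  shows "integrable M (\<lambda>\<omega>. (X \<omega>)\<^sup>2)"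
proof -
  have [measurable]: "X \<in> borel_measurable M"
    using assms by (simp add: centered_gaussian_def)
  from assms consider \<sigma> where "\<sigma> > 0" "distributed M lborel X (\<lambda>x. ennreal (normal_density 0 \<sigma> x))"
    | "AE \<omega> in M. X \<omega> = 0"
    by (auto simp: centered_gaussian_def)
  then show ?thesis
  proof cases
    case 1
    have "integrable lborel (\<lambda>x. normal_density 0 \<sigma> x * (x - 0)\<^sup>2)"
      using 1 by (intro integrable_normal_moment)
    then show ?thesis
      using distributed_integrable[OF 1(2), of "\<lambda>x. x\<^sup>2"] by simp
  next
    case 2
    have "integrable M (\<lambda>\<omega>. (X \<omega>)\<^sup>2) \<longleftrightarrow> integrable M (\<lambda>\<omega>. 0 :: real)"
      by (rule integrable_cong_AE) (use 2 in auto)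
    then show ?thesis by simp
  qed
qed

context
  fixes M :: "'w measure" and W :: "(real \<times> real) set \<Rightarrow> 'w \<Rightarrow> complex"
  assumes prob: "prob_space M" and noise: "fourier_white_noise M W"
begin

lemma noise_measurable: "A \<in> finite_sets \<Longrightarrow> W A \<in> borel_measurable M"
  using noise by (simp add: fourier_white_noise_def)

text \<open>The isometry of the white noise speaks about Bochner integrals, which are 0 for functions that are not integrable;
  that a square is integrable comes from the Gaussian law of the real and imaginary parts.\<close>

lemma noise_square_integrable:
  assumes A: "A \<in> finite_sets"
  shows "integrable M (\<lambda>\<omega>. (cmod (W A \<omega>))\<^sup>2)"
proof -
  have G: "centered_gaussian M (\<lambda>\<omega>. \<Sum>A\<in>S. a A * Re (W A \<omega>) + b A * Im (W A \<omega>))"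
    if "finite S" "S \<subseteq> finite_sets" for S a b
    using noise that unfolding fourier_white_noise_def by blast
  have "centered_gaussian M (\<lambda>\<omega>. Re (W A \<omega>))" "centered_gaussian M (\<lambda>\<omega>. Im (W A \<omega>))"
    using G[of "{A}" "\<lambda>_. 1" "\<lambda>_. 0"] G[of "{A}" "\<lambda>_. 0" "\<lambda>_. 1"] A by simp_all
  then show ?thesis
    unfolding cmod_power2 by (intro Bochner_Integration.integrable_add centered_gaussian_square_integrable[OF prob])
qed

lemma noise_product_integrable:
  assumes A: "A \<in> finite_sets" and B: "B \<in> finite_sets"
  shows "integrable M (\<lambda>\<omega>. W A \<omega> * cnj (W B \<omega>))"
proof (rule Bochner_Integration.integrable_bound)
  show "integrable M (\<lambda>\<omega>. (cmod (W A \<omega>))\<^sup>2 + (cmod (W B \<omega>))\<^sup>2)"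
    by (intro Bochner_Integration.integrable_add noise_square_integrable A B)
  have "a * b \<le> a\<^sup>2 + b\<^sup>2" if "a \<ge> 0" "b \<ge> 0" for a b :: real
  proof -
    have "2 * (a * b) \<le> a\<^sup>2 + b\<^sup>2" using sum_squares_bound[of a b] by (simp only: mult.assoc)
    moreover have "0 \<le> a * b" using that by simp
    ultimately show ?thesis by linarith
  qed
  then show "AE \<omega> in M. norm (W A \<omega> * cnj (W B \<omega>)) \<le> norm ((cmod (W A \<omega>))\<^sup>2 + (cmod (W B \<omega>))\<^sup>2)"
    by (intro AE_I2) (auto simp: norm_mult)
  have [measurable]: "W A \<in> borel_measurable M" "W B \<in> borel_measurable M"
    using A B by (simp_all add: noise_measurable)
  have [measurable]: "cnj \<in> borel_measurable borel"
    by (intro borel_measurable_continuous_onI continuous_intros)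
  show "(\<lambda>\<omega>. W A \<omega> * cnj (W B \<omega>)) \<in> borel_measurable M" by measurable
qed

text \<open>Both sides expand to the same double sum over measures of intersections.\<close>

lemma noise_step_isometry:
  assumes S: "finite S" "S \<subseteq> finite_sets"
  shows "L2_sq M (\<lambda>\<omega>. \<Sum>A\<in>S. c A * W A \<omega>) = L2_sq lborel (noise_step c S)"
proof -
  define r where "r = (\<Sum>A\<in>S. \<Sum>B\<in>S. c A * cnj (c B) * of_real (measure lborel (A \<inter> B)))"
  have sq: "complex_of_real ((cmod (\<Sum>A\<in>S. c A * w A))\<^sup>2) = (\<Sum>A\<in>S. \<Sum>B\<in>S. c A * cnj (c B) * (w A * cnj (w B)))"
    for w :: "(real \<times> real) set \<Rightarrow> complex"
    by (subst complex_norm_square) (simp add: sum_product mult_ac)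
  have 1: "has_bochner_integral M (\<lambda>\<omega>. complex_of_real ((cmod (\<Sum>A\<in>S. c A * W A \<omega>))\<^sup>2)) r"
    unfolding sq r_def
  proof (intro has_bochner_integral_sum has_bochner_integral_mult_right)
    fix A B assume "A \<in> S" "B \<in> S"
    then have AB: "A \<in> finite_sets" "B \<in> finite_sets" using S by auto
    then have "(\<integral>\<omega>. W A \<omega> * cnj (W B \<omega>) \<partial>M) = of_real (measure lborel (A \<inter> B))"
      using noise unfolding fourier_white_noise_def by blast
    then show "has_bochner_integral M (\<lambda>\<omega>. W A \<omega> * cnj (W B \<omega>)) (of_real (measure lborel (A \<inter> B)))"
      using noise_product_integrable[OF AB] by (simp add: has_bochner_integral_iff)
  qed
  have 2: "has_bochner_integral lborel (\<lambda>z. complex_of_real ((cmod (\<Sum>A\<in>S. c A * indicator A z))\<^sup>2)) r"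
    unfolding sq r_def
  proof (intro has_bochner_integral_sum has_bochner_integral_mult_right)
    fix A B assume "A \<in> S" "B \<in> S"
    then have AB: "A \<in> finite_sets" "B \<in> finite_sets" using S by auto
    then have "A \<inter> B \<in> sets lborel" "emeasure lborel (A \<inter> B) < \<infinity>"
      using le_less_trans[OF emeasure_mono[of "A \<inter> B" A lborel]] by (auto simp: finite_sets_def)
    then have "has_bochner_integral lborel (indicator (A \<inter> B)) (measure lborel (A \<inter> B))"
      by (rule has_bochner_integral_real_indicator)
    then have "has_bochner_integral lborel (\<lambda>z. complex_of_real (indicator (A \<inter> B) z)) (of_real (measure lborel (A \<inter> B)))"
      by (rule has_bochner_integral_of_real)
    then show "has_bochner_integral lborel (\<lambda>z. indicator A z * cnj (indicator B z)) (complex_of_real (measure lborel (A \<inter> B)))"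
      by (rule has_bochner_integral_cong[THEN iffD1, rotated -1]) (auto simp: indicator_def)
  qed
  have real: "(\<integral>\<^sup>+x. ennreal (g x) \<partial>N) = ennreal (Re r)"
    if "has_bochner_integral N (\<lambda>x. complex_of_real (g x)) r" "\<And>x. g x \<ge> 0" for N :: "'z measure" and g
  proof -
    have "has_bochner_integral N (\<lambda>x. Re (complex_of_real (g x))) (Re r)"
      by (rule has_bochner_integral_Re[OF that(1)])
    then show ?thesis
      using that(2) by (simp add: has_bochner_integral_iff nn_integral_eq_integral)
  qed
  show ?thesis
    unfolding L2_sq_def noise_step_def using real[OF 1] real[OF 2] by simp
qed


lemma noise_integral_step:
  assumes S: "finite S" "S \<subseteq> finite_sets"
  shows "is_noise_integral M W (noise_step c S) (\<lambda>\<omega>. \<Sum>A\<in>S. c A * W A \<omega>)"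
  unfolding is_noise_integral_iff
proof (intro conjI exI[of _ "\<lambda>_. S"] exI[of _ "\<lambda>_. c"] allI S)
  show "noise_step c S \<in> borel_measurable borel" by (rule noise_step_measurable[OF S(2)])
  show "(\<lambda>\<omega>. \<Sum>A\<in>S. c A * W A \<omega>) \<in> borel_measurable M"
    using S by (intro borel_measurable_sum borel_measurable_times borel_measurable_const noise_measurable) auto
qed (simp_all add: L2_sq_def)

lemma noise_integralE:
  assumes "is_noise_integral M W f X"
  obtains S :: "nat \<Rightarrow> (real \<times> real) set set" and c :: "nat \<Rightarrow> (real \<times> real) set \<Rightarrow> complex"
  where "f \<in> borel_measurable borel" "X \<in> borel_measurable M"
    "\<And>k. finite (S k)" "\<And>k. S k \<subseteq> finite_sets"
    "\<And>k. noise_step (c k) (S k) \<in> borel_measurable borel"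
    "\<And>k. (\<lambda>\<omega>. \<Sum>A\<in>S k. c k A * W A \<omega>) \<in> borel_measurable M"
    "(\<lambda>k. L2_sq lborel (\<lambda>z. f z - noise_step (c k) (S k) z)) \<longlonglongrightarrow> 0"
    "(\<lambda>k. L2_sq M (\<lambda>\<omega>. X \<omega> - (\<Sum>A\<in>S k. c k A * W A \<omega>))) \<longlonglongrightarrow> 0"
proof -
  from assms obtain S :: "nat \<Rightarrow> (real \<times> real) set set" and c :: "nat \<Rightarrow> (real \<times> real) set \<Rightarrow> complex"
    where *: "f \<in> borel_measurable borel" "X \<in> borel_measurable M"
      "\<And>k. finite (S k)" "\<And>k. S k \<subseteq> finite_sets"
      "(\<lambda>k. L2_sq lborel (\<lambda>z. f z - noise_step (c k) (S k) z)) \<longlonglongrightarrow> 0"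
      "(\<lambda>k. L2_sq M (\<lambda>\<omega>. X \<omega> - (\<Sum>A\<in>S k. c k A * W A \<omega>))) \<longlonglongrightarrow> 0"
    unfolding is_noise_integral_iff by blast
  have "(\<lambda>\<omega>. \<Sum>A\<in>S k. c k A * W A \<omega>) \<in> borel_measurable M" for k
    using *(4)[of k] by (intro borel_measurable_sum borel_measurable_times borel_measurable_const noise_measurable) auto
  with * show thesis
    by (intro that[of S c] noise_step_measurable)
qed

text \<open>The inequality half of the isometry. The factor 4 comes from applying \<open>|a + b|\<^sup>2 \<le> 2 |a|\<^sup>2 + 2 |b|\<^sup>2\<close> on the
  probability space and on the frequency side; constants do not affect the rate in the end.\<close>

lemma noise_integral_norm_le:
  assumes "is_noise_integral M W f X"
  shows "L2_sq M X \<le> 4 * L2_sq lborel f"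
proof -
  from assms obtain S c
    where [measurable]: "f \<in> borel_measurable borel" "X \<in> borel_measurable M"
      and S: "\<And>k. finite (S k)" "\<And>k. S k \<subseteq> finite_sets"
      and [measurable]: "\<And>k. noise_step (c k) (S k) \<in> borel_measurable borel"
        "\<And>k. (\<lambda>\<omega>. \<Sum>A\<in>S k. c k A * W A \<omega>) \<in> borel_measurable M"
      and lf: "(\<lambda>k. L2_sq lborel (\<lambda>z. f z - noise_step (c k) (S k) z)) \<longlonglongrightarrow> 0"
      and lX: "(\<lambda>k. L2_sq M (\<lambda>\<omega>. X \<omega> - (\<Sum>A\<in>S k. c k A * W A \<omega>))) \<longlonglongrightarrow> 0"
    by (rule noise_integralE) blast
  let ?e = "\<lambda>k. L2_sq lborel (\<lambda>z. f z - noise_step (c k) (S k) z)"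
  let ?d = "\<lambda>k. L2_sq M (\<lambda>\<omega>. X \<omega> - (\<Sum>A\<in>S k. c k A * W A \<omega>))"
  have "L2_sq M X \<le> 2 * ?d k + 2 * (2 * L2_sq lborel f + 2 * ?e k)" for k
  proof -
    have "L2_sq M X = L2_sq M (\<lambda>\<omega>. (X \<omega> - (\<Sum>A\<in>S k. c k A * W A \<omega>)) + (\<Sum>A\<in>S k. c k A * W A \<omega>))"
      by simp
    also have "\<dots> \<le> 2 * ?d k + 2 * L2_sq M (\<lambda>\<omega>. \<Sum>A\<in>S k. c k A * W A \<omega>)"
      by (rule L2_sq_add_le) measurable
    also have "L2_sq M (\<lambda>\<omega>. \<Sum>A\<in>S k. c k A * W A \<omega>)
       = L2_sq lborel (\<lambda>z. f z + (noise_step (c k) (S k) z - f z))"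
      by (simp add: noise_step_isometry S)
    also have "\<dots> \<le> 2 * L2_sq lborel f + 2 * L2_sq lborel (\<lambda>z. noise_step (c k) (S k) z - f z)"
      by (rule L2_sq_add_le) measurable
    also have "L2_sq lborel (\<lambda>z. noise_step (c k) (S k) z - f z) = ?e k"
      by (rule L2_sq_minus_commute)
    finally show ?thesis by (simp add: mult_left_mono add_left_mono)
  qed
  moreover have "(\<lambda>k. 2 * ?d k + 2 * (2 * L2_sq lborel f + 2 * ?e k)) \<longlonglongrightarrow>
      2 * 0 + 2 * (2 * L2_sq lborel f + 2 * 0)"
    by (intro tendsto_add ennreal_tendsto_cmult tendsto_const lX lf) auto
  ultimately have "L2_sq M X \<le> 2 * 0 + 2 * (2 * L2_sq lborel f + 2 * 0)"
    by (intro LIMSEQ_le_const) auto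
  then show ?thesis by (simp add: mult.assoc[symmetric])
qed

lemma noise_integral_cmult:
  assumes "is_noise_integral M W f X"
  shows "is_noise_integral M W (\<lambda>z. b * f z) (\<lambda>\<omega>. b * X \<omega>)"
proof -
  from assms obtain S c
    where [measurable]: "f \<in> borel_measurable borel" "X \<in> borel_measurable M"
      and S: "\<And>k. finite (S k)" "\<And>k. S k \<subseteq> finite_sets"
      and [measurable]: "\<And>k. noise_step (c k) (S k) \<in> borel_measurable borel"
        "\<And>k. (\<lambda>\<omega>. \<Sum>A\<in>S k. c k A * W A \<omega>) \<in> borel_measurable M"
      and lf: "(\<lambda>k. L2_sq lborel (\<lambda>z. f z - noise_step (c k) (S k) z)) \<longlonglongrightarrow> 0"
      and lX: "(\<lambda>k. L2_sq M (\<lambda>\<omega>. X \<omega> - (\<Sum>A\<in>S k. c k A * W A \<omega>))) \<longlonglongrightarrow> 0"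
    by (rule noise_integralE) blast
  have 1: "b * f z - noise_step (\<lambda>A. b * c k A) (S k) z = b * (f z - noise_step (c k) (S k) z)" for k z
    by (simp add: noise_step_def right_diff_distrib sum_distrib_left mult.assoc)
  have 2: "b * X \<omega> - (\<Sum>A\<in>S k. b * c k A * W A \<omega>) = b * (X \<omega> - (\<Sum>A\<in>S k. c k A * W A \<omega>))" for k \<omega>
    by (simp add: right_diff_distrib sum_distrib_left mult.assoc)
  show ?thesis
    unfolding is_noise_integral_iff
  proof (intro conjI exI[of _ S] exI[of _ "\<lambda>k A. b * c k A"] allI S)
    have "(\<lambda>k. ennreal ((cmod b)\<^sup>2) * L2_sq lborel (\<lambda>z. f z - noise_step (c k) (S k) z)) \<longlonglongrightarrow> ennreal ((cmod b)\<^sup>2) * 0"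
      by (intro ennreal_tendsto_cmult lf) simp
    then show "(\<lambda>k. L2_sq lborel (\<lambda>z. b * f z - noise_step (\<lambda>A. b * c k A) (S k) z)) \<longlonglongrightarrow> 0"
      unfolding 1 by (subst L2_sq_cmult) simp_all
    have "(\<lambda>k. ennreal ((cmod b)\<^sup>2) * L2_sq M (\<lambda>\<omega>. X \<omega> - (\<Sum>A\<in>S k. c k A * W A \<omega>))) \<longlonglongrightarrow> ennreal ((cmod b)\<^sup>2) * 0"
      by (intro ennreal_tendsto_cmult lX) simp
    then show "(\<lambda>k. L2_sq M (\<lambda>\<omega>. b * X \<omega> - (\<Sum>A\<in>S k. b * c k A * W A \<omega>))) \<longlonglongrightarrow> 0"
      unfolding 2 by (subst L2_sq_cmult) simp_all
  qed measurable
qed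

text \<open>The sets approximating the two integrands are united, with coefficients extended by 0.\<close>

lemma noise_integral_add:
  assumes "is_noise_integral M W f X" "is_noise_integral M W g Y"
  shows "is_noise_integral M W (\<lambda>z. f z + g z) (\<lambda>\<omega>. X \<omega> + Y \<omega>)"
proof -
  from assms(1) obtain S c
    where [measurable]: "f \<in> borel_measurable borel" "X \<in> borel_measurable M"
      and S: "\<And>k. finite (S k)" "\<And>k. S k \<subseteq> finite_sets"
      and [measurable]: "\<And>k. noise_step (c k) (S k) \<in> borel_measurable borel"
        "\<And>k. (\<lambda>\<omega>. \<Sum>A\<in>S k. c k A * W A \<omega>) \<in> borel_measurable M"
      and lf: "(\<lambda>k. L2_sq lborel (\<lambda>z. f z - noise_step (c k) (S k) z)) \<longlonglongrightarrow> 0"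
      and lX: "(\<lambda>k. L2_sq M (\<lambda>\<omega>. X \<omega> - (\<Sum>A\<in>S k. c k A * W A \<omega>))) \<longlonglongrightarrow> 0"
    by (rule noise_integralE) blast
  from assms(2) obtain S' c'
    where [measurable]: "g \<in> borel_measurable borel" "Y \<in> borel_measurable M"
      and S': "\<And>k. finite (S' k)" "\<And>k. S' k \<subseteq> finite_sets"
      and [measurable]: "\<And>k. noise_step (c' k) (S' k) \<in> borel_measurable borel"
        "\<And>k. (\<lambda>\<omega>. \<Sum>A\<in>S' k. c' k A * W A \<omega>) \<in> borel_measurable M"
      and lg: "(\<lambda>k. L2_sq lborel (\<lambda>z. g z - noise_step (c' k) (S' k) z)) \<longlonglongrightarrow> 0"
      and lY: "(\<lambda>k. L2_sq M (\<lambda>\<omega>. Y \<omega> - (\<Sum>A\<in>S' k. c' k A * W A \<omega>))) \<longlonglongrightarrow> 0"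
    by (rule noise_integralE) blast
  define d where "d k A = (if A \<in> S k then c k A else 0) + (if A \<in> S' k then c' k A else 0)" for k A
  have d: "(\<Sum>A\<in>S k \<union> S' k. d k A * w A) = (\<Sum>A\<in>S k. c k A * w A) + (\<Sum>A\<in>S' k. c' k A * w A)" for k w
  proof -
    have "(\<Sum>A\<in>S k \<union> S' k. d k A * w A) = (\<Sum>A\<in>S k \<union> S' k. (if A \<in> S k then c k A * w A else 0))
        + (\<Sum>A\<in>S k \<union> S' k. (if A \<in> S' k then c' k A * w A else 0))"
      unfolding sum.distrib[symmetric] by (intro sum.cong) (auto simp: d_def distrib_right)
    also have "(\<Sum>A\<in>S k \<union> S' k. (if A \<in> S k then c k A * w A else 0)) = (\<Sum>A\<in>S k. c k A * w A)"
      using S S' by (subst sum.inter_restrict[symmetric]) (auto intro!: sum.cong)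
    also have "(\<Sum>A\<in>S k \<union> S' k. (if A \<in> S' k then c' k A * w A else 0)) = (\<Sum>A\<in>S' k. c' k A * w A)"
      using S S' by (subst sum.inter_restrict[symmetric]) (auto intro!: sum.cong)
    finally show ?thesis .
  qed
  have lim0: "(\<lambda>k. 2 * u k + 2 * v k) \<longlonglongrightarrow> 0" if "u \<longlonglongrightarrow> 0" "v \<longlonglongrightarrow> 0" for u v :: "nat \<Rightarrow> ennreal"
    using tendsto_add[OF ennreal_tendsto_cmult[OF _ that(1), of 2] ennreal_tendsto_cmult[OF _ that(2), of 2]] by simp
  show ?thesis
    unfolding is_noise_integral_iff
  proof (intro conjI exI[of _ "\<lambda>k. S k \<union> S' k"] exI[of _ d] allI)
    show "(\<lambda>k. L2_sq lborel (\<lambda>z. f z + g z - noise_step (d k) (S k \<union> S' k) z)) \<longlonglongrightarrow> 0"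
    proof (rule tendsto_0_comparison_ennreal[OF lim0[OF lf lg]])
      fix k
      have "f z + g z - noise_step (d k) (S k \<union> S' k) z
         = (f z - noise_step (c k) (S k) z) + (g z - noise_step (c' k) (S' k) z)" for z
        by (simp add: noise_step_def d)
      then show "L2_sq lborel (\<lambda>z. f z + g z - noise_step (d k) (S k \<union> S' k) z) \<le>
         2 * L2_sq lborel (\<lambda>z. f z - noise_step (c k) (S k) z) +
         2 * L2_sq lborel (\<lambda>z. g z - noise_step (c' k) (S' k) z)"
        by (simp only:) (rule L2_sq_add_le, measurable)
    qed
    show "(\<lambda>k. L2_sq M (\<lambda>\<omega>. X \<omega> + Y \<omega> - (\<Sum>A\<in>S k \<union> S' k. d k A * W A \<omega>))) \<longlonglongrightarrow> 0"
    proof (rule tendsto_0_comparison_ennreal[OF lim0[OF lX lY]])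
      fix k
      have "X \<omega> + Y \<omega> - (\<Sum>A\<in>S k \<union> S' k. d k A * W A \<omega>)
         = (X \<omega> - (\<Sum>A\<in>S k. c k A * W A \<omega>)) + (Y \<omega> - (\<Sum>A\<in>S' k. c' k A * W A \<omega>))" for \<omega>
        by (simp add: d)
      then show "L2_sq M (\<lambda>\<omega>. X \<omega> + Y \<omega> - (\<Sum>A\<in>S k \<union> S' k. d k A * W A \<omega>)) \<le>
         2 * L2_sq M (\<lambda>\<omega>. X \<omega> - (\<Sum>A\<in>S k. c k A * W A \<omega>)) +
         2 * L2_sq M (\<lambda>\<omega>. Y \<omega> - (\<Sum>A\<in>S' k. c' k A * W A \<omega>))"
        by (simp only:) (rule L2_sq_add_le, measurable)
    qed
  qed (use S S' in auto)
qed

lemma noise_integral_diff: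
  assumes "is_noise_integral M W f X" "is_noise_integral M W g Y"
  shows "is_noise_integral M W (\<lambda>z. f z - g z) (\<lambda>\<omega>. X \<omega> - Y \<omega>)"
  using noise_integral_add[OF assms(1) noise_integral_cmult[OF assms(2), of "-1"]] by simp

lemma noise_integral_sum:
  assumes "finite I" "\<And>i. i \<in> I \<Longrightarrow> is_noise_integral M W (f i) (X i)"
  shows "is_noise_integral M W (\<lambda>z. \<Sum>i\<in>I. f i z) (\<lambda>\<omega>. \<Sum>i\<in>I. X i \<omega>)"
  using assms
proof (induction I rule: finite_induct)
  case empty
  show ?case using noise_integral_step[of "{}" "\<lambda>_. 0"] by (simp add: noise_step_def[abs_def])
next
  case (insert i I)
  then show ?case using noise_integral_add[of "f i" "X i"] by simp
qed

text \<open>Fatou's lemma. This bounds the variance of an almost sure limit of noise integrals by the norm of the limit of the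
  kernels.\<close>

lemma noise_integral_AE_limit_norm_le:
  assumes X: "\<And>N. is_noise_integral M W (f N) (X N)"
    and f [measurable]: "g \<in> borel_measurable borel"
    and lf: "(\<lambda>N. L2_sq lborel (\<lambda>z. f N z - g z)) \<longlonglongrightarrow> 0"
    and Y: "AE \<omega> in M. (\<lambda>N. X N \<omega>) \<longlonglongrightarrow> Y \<omega>"
  shows "L2_sq M Y \<le> 8 * L2_sq lborel g"
proof -
  have [measurable]: "f N \<in> borel_measurable borel" "X N \<in> borel_measurable M" for N
    using X[of N] unfolding is_noise_integral_def by auto
  have "L2_sq M Y = (\<integral>\<^sup>+\<omega>. liminf (\<lambda>N. ennreal ((cmod (X N \<omega>))\<^sup>2)) \<partial>M)"
    unfolding L2_sq_def
  proof (rule nn_integral_cong_AE)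
    show "AE \<omega> in M. ennreal ((cmod (Y \<omega>))\<^sup>2) = liminf (\<lambda>N. ennreal ((cmod (X N \<omega>))\<^sup>2))"
      using Y
    proof eventually_elim
      case (elim \<omega>)
      then have "(\<lambda>N. ennreal ((cmod (X N \<omega>))\<^sup>2)) \<longlonglongrightarrow> ennreal ((cmod (Y \<omega>))\<^sup>2)"
        by (intro tendsto_ennrealI tendsto_power tendsto_norm)
      from lim_imp_Liminf[OF trivial_limit_sequentially this] show ?case by (rule sym)
    qed
  qed
  also have "\<dots> \<le> liminf (\<lambda>N. L2_sq M (X N))"
    unfolding L2_sq_def by (rule nn_integral_liminf) measurable
  also have "\<dots> \<le> liminf (\<lambda>N. 4 * (2 * L2_sq lborel (\<lambda>z. f N z - g z) + 2 * L2_sq lborel g))"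
  proof (intro Liminf_mono eventuallyI)
    fix N
    have "L2_sq M (X N) \<le> 4 * L2_sq lborel (\<lambda>z. (f N z - g z) + g z)"
      using noise_integral_norm_le[OF X[of N]] by simp
    also have "\<dots> \<le> 4 * (2 * L2_sq lborel (\<lambda>z. f N z - g z) + 2 * L2_sq lborel g)"
      by (intro mult_left_mono L2_sq_add_le) auto
    finally show "L2_sq M (X N) \<le> 4 * (2 * L2_sq lborel (\<lambda>z. f N z - g z) + 2 * L2_sq lborel g)" .
  qed
  also have "\<dots> = 4 * (2 * 0 + 2 * L2_sq lborel g)"
    by (intro lim_imp_Liminf tendsto_add ennreal_tendsto_cmult tendsto_const lf) auto
  finally show ?thesis by (simp add: mult.assoc[symmetric])
qed

lemma simple_function_noise_step:
  assumes s: "simple_function borel s"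
    and fin: "\<And>v. v \<noteq> 0 \<Longrightarrow> emeasure lborel (s -` {v}) < \<infinity>"
  obtains S c where "finite S" "S \<subseteq> finite_sets" "noise_step c S = (s :: real \<times> real \<Rightarrow> complex)"
proof -
  define V where "V = range s - {0}"
  define S where "S = (\<lambda>v. s -` {v}) ` V"
  define c where "c A = s (SOME z. z \<in> A)" for A
  have finV: "finite V" using simple_functionD(1)[OF s] by (simp add: V_def)
  have meas: "s -` {v} \<in> finite_sets" if "v \<in> V" for v
    using simple_functionD(2)[OF s, of "{v}"] fin[of v] that by (auto simp: finite_sets_def V_def)
  have c: "c (s -` {v}) = v" if "v \<in> V" for v
  proof -
    have "\<exists>z. z \<in> s -` {v}" using that by (auto simp: V_def)
    from someI_ex[OF this] show ?thesis by (simp add: c_def)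
  qed
  have inj: "inj_on (\<lambda>v. s -` {v}) V"
    by (rule inj_onI) (metis c)
  have "noise_step c S z = s z" for z
  proof -
    have "noise_step c S z = (\<Sum>v\<in>V. v * indicator (s -` {v}) z)"
      unfolding noise_step_def S_def by (simp add: sum.reindex[OF inj] c)
    also have "\<dots> = (\<Sum>v\<in>V. if v = s z then v else 0)"
      by (intro sum.cong) (auto simp: indicator_def)
    also have "\<dots> = s z"
      using finV by (auto simp: V_def)
    finally show ?thesis .
  qed
  then have "noise_step c S = s" by (rule ext)
  then show ?thesis using that[of S c] finV meas by (auto simp: S_def)
qed

text \<open>Simple functions dominated by \<open>2 |f|\<close> approximate \<open>f\<close>; a subsequence converges so fast that, by the bound on noise
  integrals, the corresponding random variables satisfy the Riesz--Fischer criterion.\<close>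

lemma noise_integral_exists:
  fixes f :: "real \<times> real \<Rightarrow> complex"
  assumes f [measurable]: "f \<in> borel_measurable borel" and fin: "L2_sq lborel f < \<infinity>"
  shows "\<exists>X. is_noise_integral M W f X"
proof -
  obtain s where s: "\<And>i. simple_function borel (s i)" "\<And>x. (\<lambda>i. s i x) \<longlonglongrightarrow> f x"
      "\<And>i x. cmod (s i x) \<le> 2 * cmod (f x)"
    using borel_measurable_implies_sequence_metric[OF f, of 0] by auto
  have [measurable]: "s i \<in> borel_measurable borel" for i
    by (rule borel_measurable_simple_function[OF s(1)])
  have "emeasure lborel (s i -` {v}) < \<infinity>" if "v \<noteq> 0" for i v
  proof -
    have "ennreal ((cmod v)\<^sup>2) * emeasure lborel (s i -` {v}) = (\<integral>\<^sup>+z. ennreal ((cmod v)\<^sup>2) * indicator (s i -` {v}) z \<partial>lborel)"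
      using measurable_sets[of "s i" borel borel "{v}"] by (subst nn_integral_cmult_indicator) auto
    also have "\<dots> \<le> (\<integral>\<^sup>+z. ennreal 4 * ennreal ((cmod (f z))\<^sup>2) \<partial>lborel)"
    proof (rule nn_integral_mono)
      fix z
      show "ennreal ((cmod v)\<^sup>2) * indicator (s i -` {v}) z \<le> ennreal 4 * ennreal ((cmod (f z))\<^sup>2)"
      proof (cases "s i z = v")
        case True
        then have "(cmod v)\<^sup>2 \<le> (2 * cmod (f z))\<^sup>2"
          using s(3)[of i z] by (intro power_mono) auto
        then show ?thesis
          using True by (simp add: ennreal_mult'[symmetric] power_mult_distrib ennreal_leI del: ennreal_numeral)
      qed auto
    qed
    also have "\<dots> = 4 * L2_sq lborel f"
      unfolding L2_sq_def by (simp add: nn_integral_cmult)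
    also have "\<dots> < \<infinity>" using fin by (simp add: ennreal_mult_less_top)
    finally show ?thesis
      using that by (auto simp: ennreal_mult_less_top)
  qed
  then have "\<exists>S c. finite S \<and> S \<subseteq> finite_sets \<and> noise_step c S = s i" for i
    using simple_function_noise_step[OF s(1)[of i]] by metis
  then obtain S c where Sc: "\<And>i. finite (S i)" "\<And>i. S i \<subseteq> finite_sets" "\<And>i. noise_step (c i) (S i) = s i"
    by metis
  have lim: "(\<lambda>i. L2_sq lborel (\<lambda>z. f z - s i z)) \<longlonglongrightarrow> 0"
  proof -
    have "(\<lambda>i. \<integral>\<^sup>+z. ennreal ((cmod (f z - s i z))\<^sup>2) \<partial>lborel) \<longlonglongrightarrow> (\<integral>\<^sup>+(z::real \<times> real). 0 \<partial>lborel)"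
    proof (rule nn_integral_dominated_convergence)
      show "AE z in lborel. ennreal ((cmod (f z - s i z))\<^sup>2) \<le> ennreal 9 * ennreal ((cmod (f z))\<^sup>2)" for i
      proof (rule AE_I2)
        fix z
        have "cmod (f z - s i z) \<le> 3 * cmod (f z)"
          using norm_triangle_ineq4[of "f z" "s i z"] s(3)[of i z] by simp
        then have "(cmod (f z - s i z))\<^sup>2 \<le> (3 * cmod (f z))\<^sup>2"
          by (intro power_mono) auto
        then show "ennreal ((cmod (f z - s i z))\<^sup>2) \<le> ennreal 9 * ennreal ((cmod (f z))\<^sup>2)"
          by (simp add: ennreal_mult'[symmetric] power_mult_distrib ennreal_leI del: ennreal_numeral)
      qed
      have "(\<integral>\<^sup>+z. ennreal 9 * ennreal ((cmod (f z))\<^sup>2) \<partial>lborel) = 9 * L2_sq lborel f"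
        unfolding L2_sq_def by (simp add: nn_integral_cmult)
      then show "(\<integral>\<^sup>+z. ennreal 9 * ennreal ((cmod (f z))\<^sup>2) \<partial>lborel) < \<infinity>"
        using fin by (simp add: ennreal_mult_less_top)
      show "AE z in lborel. (\<lambda>i. ennreal ((cmod (f z - s i z))\<^sup>2)) \<longlonglongrightarrow> 0"
      proof (rule AE_I2)
        fix z
        have "(\<lambda>i. (cmod (f z - s i z))\<^sup>2) \<longlonglongrightarrow> (cmod (f z - f z))\<^sup>2"
          by (intro tendsto_intros s(2))
        from tendsto_ennrealI[OF this] show "(\<lambda>i. ennreal ((cmod (f z - s i z))\<^sup>2)) \<longlonglongrightarrow> 0" by simp
      qed
    qed measurable
    then show ?thesis by (simp add: L2_sq_def)
  qed
  have "\<exists>i. \<forall>j\<ge>i. L2_sq lborel (\<lambda>z. f z - s j z) < ennreal (1 / 8 ^ k)" for k :: nat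
    using order_tendstoD(2)[OF lim, of "ennreal (1 / 8 ^ k)"] by (simp add: eventually_sequentially)
  then obtain I where I: "\<And>k j. j \<ge> I k \<Longrightarrow> L2_sq lborel (\<lambda>z. f z - s j z) < ennreal (1 / 8 ^ k)"
    by metis
  \<comment> \<open>Indices past every \<open>I i\<close> with \<open>i \<le> k\<close>, and tending to infinity.\<close>
  define r where "r k = (\<Sum>i\<le>k. I i) + k" for k
  have rI: "r k \<ge> I k" and rk: "r k \<ge> k" for k
    using member_le_sum[of k "{..k}" I] by (auto simp: r_def intro: trans_le_add1)
  define X where "X k \<omega> = (\<Sum>A\<in>S (r k). c (r k) A * W A \<omega>)" for k \<omega>
  have NX: "is_noise_integral M W (s (r k)) (X k)" for k
    using noise_integral_step[OF Sc(1,2), of "c (r k)" "r k"] by (simp add: Sc(3) X_def[abs_def])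
  have [measurable]: "X k \<in> borel_measurable M" for k
    using NX[of k] by (simp add: is_noise_integral_def)
  have "L2_sq M (\<lambda>\<omega>. X (Suc k) \<omega> - X k \<omega>) \<le> ennreal (16 / 8 ^ k)" for k
  proof -
    have "L2_sq M (\<lambda>\<omega>. X (Suc k) \<omega> - X k \<omega>) \<le> 4 * L2_sq lborel (\<lambda>z. s (r (Suc k)) z - s (r k) z)"
      by (rule noise_integral_norm_le[OF noise_integral_diff[OF NX NX]])
    also have "(\<lambda>z. s (r (Suc k)) z - s (r k) z) = (\<lambda>z. (s (r (Suc k)) z - f z) + (f z - s (r k) z))"
      by simp
    also have "4 * L2_sq lborel \<dots> \<le> 4 * (2 * L2_sq lborel (\<lambda>z. s (r (Suc k)) z - f z) + 2 * L2_sq lborel (\<lambda>z. f z - s (r k) z))"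
      by (intro mult_left_mono L2_sq_add_le) auto
    also have "\<dots> \<le> 4 * (2 * ennreal (1 / 8 ^ k) + 2 * ennreal (1 / 8 ^ k))"
    proof (intro mult_left_mono add_mono)
      have "L2_sq lborel (\<lambda>z. s (r (Suc k)) z - f z) \<le> ennreal (1 / 8 ^ Suc k)"
        unfolding L2_sq_minus_commute[of lborel "s (r (Suc k))"] by (rule less_imp_le[OF I[OF rI]])
      also have "\<dots> \<le> ennreal (1 / 8 ^ k)" by (intro ennreal_leI) (simp add: divide_simps)
      finally show "L2_sq lborel (\<lambda>z. s (r (Suc k)) z - f z) \<le> ennreal (1 / 8 ^ k)" .
      show "L2_sq lborel (\<lambda>z. f z - s (r k) z) \<le> ennreal (1 / 8 ^ k)"
        by (rule less_imp_le[OF I[OF rI]])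
    qed auto
    also have "\<dots> = ennreal 16 * ennreal (1 / 8 ^ k)"
      by (simp add: distrib_left mult.assoc[symmetric] flip: distrib_right)
    also have "\<dots> = ennreal (16 / 8 ^ k)" by (simp add: ennreal_mult'[symmetric] del: ennreal_numeral)
    finally show ?thesis .
  qed
  from L2_sq_fast_Cauchy[OF _ this] obtain Z where
    Z: "Z \<in> borel_measurable M" "(\<lambda>k. L2_sq M (\<lambda>\<omega>. Z \<omega> - X k \<omega>)) \<longlonglongrightarrow> 0"
    by auto
  have "filterlim r sequentially sequentially"
    by (rule filterlim_at_top_mono[OF filterlim_ident]) (simp add: rk)
  from filterlim_compose[OF lim this]
  have "(\<lambda>k. L2_sq lborel (\<lambda>z. f z - s (r k) z)) \<longlonglongrightarrow> 0" .
  then have "is_noise_integral M W f Z"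
    unfolding is_noise_integral_iff
    using Z Sc by (intro conjI exI[of _ "\<lambda>k. S (r k)"] exI[of _ "\<lambda>k. c (r k)"]) (auto simp: X_def)
  then show ?thesis by blast
qed

end

section \<open>The kernel of the field in frequency space\<close>

text \<open>The primitive of \<open>s \<mapsto> e\<^sup>i\<^sup>\<xi>\<^sup>s\<close> that vanishes at 0, so that its increments over \<open>h\<close>, divided by \<open>h\<close>, are averages of
  the character.\<close>

definition exp_primitive :: "real \<Rightarrow> real \<Rightarrow> complex" where
  "exp_primitive t \<xi> = (iexp (\<xi> * t) - 1) / (\<i> * of_real \<xi>)"

lemma egf_shift_power:
  assumes "\<xi> \<noteq> 0"
  shows "egf (shift_seq (\<lambda>k. (\<i> * of_real \<xi>) ^ k)) t = exp_primitive t \<xi>"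
proof -
  have "(\<lambda>k. ((\<i> * of_real \<xi>) ^ k * of_real (t ^ k / fact k) - (if k = 0 then 1 else 0)) / (\<i> * of_real \<xi>))
      sums ((iexp (\<xi> * t) - 1) / (\<i> * of_real \<xi>))"
    by (intro sums_divide sums_diff exp_sums_egf) (rule sums_single[of 0 "\<lambda>_. 1"])
  moreover have "((\<i> * of_real \<xi>) ^ k * of_real (t ^ k / fact k) - (if k = 0 then 1 else 0)) / (\<i> * of_real \<xi>)
     = shift_seq (\<lambda>k. (\<i> * of_real \<xi>) ^ k) k * of_real (t ^ k / fact k)" for k
    using assms by (cases k) auto
  ultimately show ?thesis
    unfolding egf_def exp_primitive_def by (auto dest: sums_unique)
qed

text \<open>The fractional kernel is this amplitude times the primitive of the character; the amplitude is square
  integrable near 0 because \<open>H < 1\<close>.\<close>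

definition fractional_amp :: "real \<Rightarrow> real \<Rightarrow> complex" where
  "fractional_amp H \<xi> = of_real (\<bar>\<xi>\<bar> powr (1 / 2 - H)) * (\<i> * of_real (sgn \<xi>))"

lemma fractional_kernel_eq: "fractional_kernel H t \<xi> = fractional_amp H \<xi> * exp_primitive t \<xi>"
proof (cases "\<xi> = 0")
  case False
  have "\<bar>\<xi>\<bar> = \<bar>\<xi>\<bar> powr (1 / 2 - H) * \<bar>\<xi>\<bar> powr (H + 1 / 2)"
    using False by (simp flip: powr_add)
  then have "\<bar>\<xi>\<bar> powr (1 / 2 - H) / \<bar>\<xi>\<bar> = 1 / \<bar>\<xi>\<bar> powr (H + 1 / 2)"
    using False by (simp add: field_simps)
  moreover have "sgn \<xi> / \<xi> = 1 / \<bar>\<xi>\<bar>"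
    using False by (simp add: sgn_real_def)
  ultimately have "\<bar>\<xi>\<bar> powr (1 / 2 - H) * (sgn \<xi> / \<xi>) = 1 / \<bar>\<xi>\<bar> powr (H + 1 / 2)"
    by simp
  then have "complex_of_real (\<bar>\<xi>\<bar> powr (1 / 2 - H)) * (of_real (sgn \<xi>) / of_real \<xi>) = 1 / of_real (\<bar>\<xi>\<bar> powr (H + 1 / 2))"
    by (metis of_real_1 of_real_divide of_real_mult)
  then have "(iexp (\<xi> * t) - 1) * (complex_of_real (\<bar>\<xi>\<bar> powr (1 / 2 - H)) * (of_real (sgn \<xi>) / of_real \<xi>))
     = (iexp (\<xi> * t) - 1) * (1 / of_real (\<bar>\<xi>\<bar> powr (H + 1 / 2)))"
    by simp
  then show ?thesis
    unfolding fractional_kernel_def fractional_amp_def exp_primitive_def by (simp add: mult_ac)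
qed (simp add: fractional_kernel_def fractional_amp_def)

text \<open>For \<open>c\<close> the product of the two normalizing constants, the kernel of \<open>\<partial>\<^sub>t\<partial>\<^sub>xB\<close> at the origin. All kernels below are this function times a factor that is bounded on its
  support.\<close>

definition noise_symbol :: "real \<Rightarrow> real \<Rightarrow> real \<Rightarrow> real \<Rightarrow> real \<Rightarrow> real \<times> real \<Rightarrow> complex" where
  "noise_symbol c H0 H1 R S = (\<lambda>(\<xi>, \<eta>).
     if \<bar>\<xi>\<bar> \<le> R \<and> \<bar>\<eta>\<bar> \<le> S then of_real c * (fractional_amp H0 \<xi> * fractional_amp H1 \<eta>) else 0)"

lemma noise_symbol_measurable [measurable]: "noise_symbol c H0 H1 R S \<in> borel_measurable borel"
proof -
  have "noise_symbol c H0 H1 R S \<in> borel_measurable (borel \<Otimes>\<^sub>M borel)"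
    unfolding noise_symbol_def fractional_amp_def by measurable
  then show ?thesis by (simp add: borel_prod)
qed

lemma noise_symbol_nonzero:
  "noise_symbol c H0 H1 R S z \<noteq> 0 \<Longrightarrow> \<bar>fst z\<bar> \<le> R \<and> \<bar>snd z\<bar> \<le> S \<and> fst z \<noteq> 0 \<and> snd z \<noteq> 0"
  by (cases z) (auto simp: noise_symbol_def fractional_amp_def split: if_splits)

lemma field_kernel_eq:
  "field_kernel H0 H1 \<kappa> n t x z =
     noise_symbol (hconst H0 * hconst H1) H0 H1 (2 powr (2 * \<kappa> * n)) (2 powr (\<kappa> * n)) z
       * (exp_primitive t (fst z) * exp_primitive x (snd z))"
  by (simp add: field_kernel_def noise_symbol_def fractional_kernel_eq mult_ac split: prod.split)

lemma nn_integral_abs_powr: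
  assumes p: "p > -1" and R: "R \<ge> 0"
  shows "(\<integral>\<^sup>+\<xi>. ennreal (indicator {-R..R} \<xi> * \<bar>\<xi>\<bar> powr p) \<partial>lborel) \<le> ennreal (2 * (R powr (p + 1) / (p + 1)))"
proof -
  define f where "f \<xi> = indicator {0..R} \<xi> * \<xi> powr p" for \<xi> :: real
  have [measurable]: "f \<in> borel_measurable borel" unfolding f_def by measurable
  have f0: "f \<xi> \<ge> 0" for \<xi> by (simp add: f_def)
  have "(f has_integral (R powr (p + 1) / (p + 1))) UNIV"
  proof -
    have "f = (\<lambda>x. if x \<in> {0..R} then x powr p else 0)"
      by (auto simp: f_def indicator_def)
    then show ?thesis
      using has_integral_powr_from_0[OF p R] by (simp only: has_integral_restrict_UNIV)
  qed
  then have I: "(\<integral>\<^sup>+\<xi>. ennreal (f \<xi>) \<partial>lborel) = ennreal (R powr (p + 1) / (p + 1))"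
    by (intro nn_integral_has_integral_lborel f0) auto
  have "(\<integral>\<^sup>+\<xi>. ennreal (indicator {-R..R} \<xi> * \<bar>\<xi>\<bar> powr p) \<partial>lborel) \<le> (\<integral>\<^sup>+\<xi>. ennreal (f \<xi>) + ennreal (f (- \<xi>)) \<partial>lborel)"
  proof (rule nn_integral_mono)
    fix \<xi> :: real
    show "ennreal (indicator {-R..R} \<xi> * \<bar>\<xi>\<bar> powr p) \<le> ennreal (f \<xi>) + ennreal (f (- \<xi>))"
      unfolding ennreal_plus[OF f0 f0, symmetric]
      by (intro ennreal_leI) (auto simp: f_def indicator_def)
  qed
  also have "\<dots> = (\<integral>\<^sup>+\<xi>. ennreal (f \<xi>) \<partial>lborel) + (\<integral>\<^sup>+\<xi>. ennreal (f (- \<xi>)) \<partial>lborel)"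
    by (rule nn_integral_add) auto
  also have "(\<integral>\<^sup>+\<xi>. ennreal (f (- \<xi>)) \<partial>lborel) = (\<integral>\<^sup>+\<xi>. ennreal (f \<xi>) \<partial>lborel)"
    using nn_integral_real_affine[of "\<lambda>\<xi>. ennreal (f \<xi>)" "-1" 0] by simp
  also have "(\<integral>\<^sup>+\<xi>. ennreal (f \<xi>) \<partial>lborel) + (\<integral>\<^sup>+\<xi>. ennreal (f \<xi>) \<partial>lborel) = ennreal (2 * (R powr (p + 1) / (p + 1)))"
    unfolding I using p by (subst ennreal_plus[symmetric]) (auto simp del: ennreal_plus)
  finally show ?thesis .
qed

definition symbol_energy :: "real \<Rightarrow> real \<Rightarrow> real \<Rightarrow> real \<Rightarrow> real \<Rightarrow> real" where
  "symbol_energy c H0 H1 R S =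
     c\<^sup>2 * (2 * (R powr (2 - 2 * H0) / (2 - 2 * H0))) * (2 * (S powr (2 - 2 * H1) / (2 - 2 * H1)))"

lemma symbol_energy_nonneg: "H0 < 1 \<Longrightarrow> H1 < 1 \<Longrightarrow> 0 \<le> symbol_energy c H0 H1 R S"
  by (simp add: symbol_energy_def)

lemma noise_symbol_energy:
  assumes H: "H0 < 1" "H1 < 1" and R: "R \<ge> 0" "S \<ge> 0"
  shows "L2_sq lborel (noise_symbol c H0 H1 R S) \<le> ennreal (symbol_energy c H0 H1 R S)"
proof -
  define f where "f H R \<xi> = indicator {-R..R} \<xi> * \<bar>\<xi>\<bar> powr (1 - 2 * H)" for H R \<xi> :: real
  have [measurable]: "f H R \<in> borel_measurable borel" for H R unfolding f_def by measurable
  have f0: "f H R \<xi> \<ge> 0" for H R \<xi> by (simp add: f_def)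
  have amp: "(cmod (fractional_amp H \<xi>))\<^sup>2 \<le> \<bar>\<xi>\<bar> powr (1 - 2 * H)" for H \<xi>
  proof (cases "\<xi> = 0")
    case False
    then have "cmod (fractional_amp H \<xi>) = \<bar>\<xi>\<bar> powr (1 / 2 - H)"
      by (simp add: fractional_amp_def norm_mult sgn_real_def)
    moreover have "(\<bar>\<xi>\<bar> powr (1 / 2 - H))\<^sup>2 = \<bar>\<xi>\<bar> powr (1 - 2 * H)"
      unfolding power2_eq_square powr_add[symmetric] by (rule arg_cong[where f = "(powr) \<bar>\<xi>\<bar>"]) simp
    ultimately show ?thesis by simp
  qed (simp add: fractional_amp_def)
  have le: "(cmod (noise_symbol c H0 H1 R S z))\<^sup>2 \<le> c\<^sup>2 * (f H0 R (fst z) * f H1 S (snd z))" for z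
  proof (cases "\<bar>fst z\<bar> \<le> R \<and> \<bar>snd z\<bar> \<le> S")
    case True
    have "(cmod (fractional_amp H0 (fst z)))\<^sup>2 * (cmod (fractional_amp H1 (snd z)))\<^sup>2
        \<le> \<bar>fst z\<bar> powr (1 - 2 * H0) * \<bar>snd z\<bar> powr (1 - 2 * H1)"
      by (intro mult_mono amp) auto
    then have "c\<^sup>2 * ((cmod (fractional_amp H0 (fst z)))\<^sup>2 * (cmod (fractional_amp H1 (snd z)))\<^sup>2)
        \<le> c\<^sup>2 * (\<bar>fst z\<bar> powr (1 - 2 * H0) * \<bar>snd z\<bar> powr (1 - 2 * H1))"
      by (rule mult_left_mono) simp
    moreover have "fst z \<in> {-R..R}" "snd z \<in> {-S..S}" using True by (auto simp: abs_le_iff)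
    ultimately show ?thesis
      using True by (simp add: noise_symbol_def f_def case_prod_unfold norm_mult power_mult_distrib)
  next
    case False
    then have "noise_symbol c H0 H1 R S z = 0" by (auto simp: noise_symbol_def case_prod_unfold)
    then show ?thesis by (simp add: f0)
  qed
  have "L2_sq lborel (noise_symbol c H0 H1 R S) \<le> (\<integral>\<^sup>+z. ennreal (c\<^sup>2) * (ennreal (f H0 R (fst z)) * ennreal (f H1 S (snd z))) \<partial>plane)"
    unfolding L2_sq_def lborel_prod
    using le by (intro nn_integral_mono) (simp add: f0 ennreal_mult[symmetric] ennreal_leI)
  also have "\<dots> = ennreal (c\<^sup>2) * (\<integral>\<^sup>+z. ennreal (f H0 R (fst z)) * ennreal (f H1 S (snd z)) \<partial>plane)"
    by (rule nn_integral_cmult) measurable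
  also have "(\<integral>\<^sup>+z. ennreal (f H0 R (fst z)) * ennreal (f H1 S (snd z)) \<partial>plane)
      = (\<integral>\<^sup>+\<xi>. ennreal (f H0 R \<xi>) * (\<integral>\<^sup>+\<eta>. ennreal (f H1 S \<eta>) \<partial>lborel) \<partial>lborel)"
    by (subst lborel.nn_integral_fst[symmetric]) (auto simp: nn_integral_cmult)
  also have "\<dots> = (\<integral>\<^sup>+\<xi>. ennreal (f H0 R \<xi>) \<partial>lborel) * (\<integral>\<^sup>+\<eta>. ennreal (f H1 S \<eta>) \<partial>lborel)"
    by (rule nn_integral_multc) measurable
  also have "ennreal (c\<^sup>2) * \<dots> \<le> ennreal (c\<^sup>2) * (ennreal (2 * (R powr (2 - 2 * H0) / (2 - 2 * H0))) * ennreal (2 * (S powr (2 - 2 * H1) / (2 - 2 * H1))))"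
    using nn_integral_abs_powr[of "1 - 2 * H0" R] nn_integral_abs_powr[of "1 - 2 * H1" S] H R
    by (intro mult_left_mono mult_mono) (auto simp: f_def)
  also have "\<dots> = ennreal (symbol_energy c H0 H1 R S)"
  proof -
    have "ennreal (c\<^sup>2) * (ennreal A * ennreal B) = ennreal (c\<^sup>2 * A * B)" if "A \<ge> 0" "B \<ge> 0" for A B
      using that by (simp add: ennreal_mult mult.assoc)
    then show ?thesis
      unfolding symbol_energy_def using H by (simp only: powr_ge_zero divide_nonneg_nonneg mult_nonneg_nonneg zero_le_numeral diff_ge_0_iff_ge) 
  qed
  finally show ?thesis .
qed

lemma L2_sq_mult_le:
  assumes q [measurable]: "q \<in> borel_measurable M" and K: "K \<ge> 0"
    and w: "\<And>z. q z \<noteq> 0 \<Longrightarrow> cmod (w z) \<le> K"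
  shows "L2_sq M (\<lambda>z. q z * w z) \<le> ennreal (K\<^sup>2) * L2_sq M q"
proof -
  have "L2_sq M (\<lambda>z. q z * w z) \<le> (\<integral>\<^sup>+z. ennreal (K\<^sup>2) * ennreal ((cmod (q z))\<^sup>2) \<partial>M)"
    unfolding L2_sq_def
  proof (rule nn_integral_mono)
    fix z
    have "(cmod (w z))\<^sup>2 \<le> K\<^sup>2" if "q z \<noteq> 0"
      using w[OF that] by (intro power_mono) auto
    then have "(cmod (q z * w z))\<^sup>2 \<le> K\<^sup>2 * (cmod (q z))\<^sup>2"
      by (cases "q z = 0") (auto simp: norm_mult power_mult_distrib mult.commute[of "K\<^sup>2"] intro: mult_left_mono)
    then show "ennreal ((cmod (q z * w z))\<^sup>2) \<le> ennreal (K\<^sup>2) * ennreal ((cmod (q z))\<^sup>2)"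
      by (simp add: ennreal_mult[symmetric] ennreal_leI)
  qed
  then show ?thesis by (simp add: nn_integral_cmult L2_sq_def)
qed

lemma L2_sq_dominated:
  fixes q :: "'a \<Rightarrow> complex"
  assumes [measurable]: "q \<in> borel_measurable M" "\<And>N. w N \<in> borel_measurable M" "w' \<in> borel_measurable M"
    and fin: "L2_sq M q < \<infinity>"
    and bound: "\<And>N z. q z \<noteq> 0 \<Longrightarrow> cmod (w N z) \<le> K"
    and lim: "\<And>z. q z \<noteq> 0 \<Longrightarrow> (\<lambda>N. w N z) \<longlonglongrightarrow> w' z"
  shows "(\<lambda>N. L2_sq M (\<lambda>z. q z * w N z - q z * w' z)) \<longlonglongrightarrow> 0"
proof -
  have "(\<lambda>N. \<integral>\<^sup>+z. ennreal ((cmod (q z * w N z - q z * w' z))\<^sup>2) \<partial>M) \<longlonglongrightarrow> (\<integral>\<^sup>+z. 0 \<partial>M)"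
  proof (rule nn_integral_dominated_convergence)
    show "AE z in M. ennreal ((cmod (q z * w N z - q z * w' z))\<^sup>2) \<le> ennreal ((2 * K)\<^sup>2) * ennreal ((cmod (q z))\<^sup>2)" for N
    proof (rule AE_I2)
      fix z
      have "(cmod (q z * w N z - q z * w' z))\<^sup>2 \<le> (2 * K)\<^sup>2 * (cmod (q z))\<^sup>2"
      proof (cases "q z = 0")
        case False
        have "cmod (w' z) \<le> K"
          by (rule LIMSEQ_le_const2[OF tendsto_norm[OF lim[OF False]]]) (use bound[OF False] in auto)
        then have "cmod (w N z - w' z) \<le> 2 * K"
          using norm_triangle_ineq4[of "w N z" "w' z"] bound[OF False, of N] by simp
        then have "(cmod (w N z - w' z))\<^sup>2 \<le> (2 * K)\<^sup>2"
          by (intro power_mono) auto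
        moreover have "q z * w N z - q z * w' z = q z * (w N z - w' z)"
          by (simp add: right_diff_distrib)
        ultimately show ?thesis
          by (simp only: norm_mult power_mult_distrib[of "cmod (q z)"] mult.commute[of "(2 * K)\<^sup>2"] mult_left_mono zero_le_power2)
      qed simp
      then show "ennreal ((cmod (q z * w N z - q z * w' z))\<^sup>2) \<le> ennreal ((2 * K)\<^sup>2) * ennreal ((cmod (q z))\<^sup>2)"
        by (simp only: ennreal_mult[symmetric] ennreal_leI zero_le_power2)
    qed
    show "(\<integral>\<^sup>+z. ennreal ((2 * K)\<^sup>2) * ennreal ((cmod (q z))\<^sup>2) \<partial>M) < \<infinity>"
    proof -
      have "(\<integral>\<^sup>+z. ennreal ((2 * K)\<^sup>2) * ennreal ((cmod (q z))\<^sup>2) \<partial>M) = ennreal ((2 * K)\<^sup>2) * L2_sq M q"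
        unfolding L2_sq_def by (rule nn_integral_cmult) measurable
      also have "\<dots> < \<infinity>"
        using ennreal_mult_less_top[of "ennreal ((2 * K)\<^sup>2)" "L2_sq M q"] fin by (simp add: ennreal_less_top)
      finally show ?thesis .
    qed
    show "AE z in M. (\<lambda>N. ennreal ((cmod (q z * w N z - q z * w' z))\<^sup>2)) \<longlonglongrightarrow> 0"
    proof (rule AE_I2)
      fix z
      have "(\<lambda>N. (cmod (q z * w N z - q z * w' z))\<^sup>2) \<longlonglongrightarrow> 0"
      proof (cases "q z = 0")
        case False
        have "(\<lambda>N. (cmod (q z * w N z - q z * w' z))\<^sup>2) \<longlonglongrightarrow> (cmod (q z * w' z - q z * w' z))\<^sup>2"
          by (intro tendsto_intros lim[OF False])
        then show ?thesis by simp
      qed simp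
      from tendsto_ennrealI[OF this] show "(\<lambda>N. ennreal ((cmod (q z * w N z - q z * w' z))\<^sup>2)) \<longlonglongrightarrow> 0" by simp
    qed
  qed measurable
  then show ?thesis by (simp add: L2_sq_def)
qed

lemma norm_iexp_diff_le: "cmod (iexp x - iexp y) \<le> \<bar>x - y\<bar>"
proof -
  have "iexp x - iexp y = iexp y * (iexp (x - y) - 1)"
    unfolding right_diff_distrib exp_add[symmetric] by (simp add: algebra_simps)
  moreover have "cmod (iexp (x - y) - 1) \<le> \<bar>x - y\<bar>"
    using iexp_approx1[of "x - y" 0] by simp
  ultimately show ?thesis by (simp add: norm_mult)
qed

text \<open>The quotient is the average of the character over \<open>[t, t + h]\<close>. The second estimate is a second order Taylor
  expansion of the character around \<open>s\<close>.\<close>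

lemma exp_primitive_increment:
  assumes "\<xi> \<noteq> 0" "h > 0"
  shows "cmod ((exp_primitive (t + h) \<xi> - exp_primitive t \<xi>) / of_real h) \<le> 1"
    and "t \<le> s \<Longrightarrow> s \<le> t + h \<Longrightarrow>
      cmod (iexp (\<xi> * s) - (exp_primitive (t + h) \<xi> - exp_primitive t \<xi>) / of_real h) \<le> \<bar>\<xi>\<bar> * h"
proof -
  have diff: "exp_primitive (t + h) \<xi> - exp_primitive t \<xi>
      = (iexp (\<xi> * (t + h)) - iexp (\<xi> * t)) / (\<i> * of_real \<xi>)"
    by (simp add: exp_primitive_def diff_divide_distrib)
  have "cmod (iexp (\<xi> * (t + h)) - iexp (\<xi> * t)) \<le> \<bar>\<xi>\<bar> * h"
    using norm_iexp_diff_le[of "\<xi> * (t + h)" "\<xi> * t"] assms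
    by (simp add: distrib_left abs_mult del: of_real_mult of_real_add)
  then show "cmod ((exp_primitive (t + h) \<xi> - exp_primitive t \<xi>) / of_real h) \<le> 1"
    unfolding diff using assms by (simp add: norm_divide norm_mult divide_simps mult_ac)
  assume s: "t \<le> s" "s \<le> t + h"
  define a b where "a = t + h - s" and "b = s - t"
  have ab: "a \<ge> 0" "b \<ge> 0" "a + b = h" using s by (auto simp: a_def b_def)
  have r: "cmod (iexp y - (1 + \<i> * of_real y)) \<le> y\<^sup>2 / 2" for y
    using iexp_approx1[of y 1] by (simp add: power2_eq_square numeral_2_eq_2 algebra_simps)
  define e where "e = \<i> * of_real (\<xi> * h) - (iexp (\<xi> * a) - iexp (- (\<xi> * b)))"
  have "e = (iexp (- (\<xi> * b)) - (1 + \<i> * of_real (- (\<xi> * b)))) - (iexp (\<xi> * a) - (1 + \<i> * of_real (\<xi> * a)))"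
    unfolding e_def ab(3)[symmetric] by (simp add: algebra_simps)
  also have "cmod \<dots> \<le> (- (\<xi> * b))\<^sup>2 / 2 + (\<xi> * a)\<^sup>2 / 2"
    by (intro order_trans[OF norm_triangle_ineq4] add_mono r)
  also have "\<dots> \<le> (\<xi> * h)\<^sup>2"
  proof -
    have "a\<^sup>2 + b\<^sup>2 \<le> (a + b)\<^sup>2" using ab(1,2) by (simp add: power2_sum)
    then have "\<xi>\<^sup>2 * (a\<^sup>2 + b\<^sup>2) \<le> \<xi>\<^sup>2 * h\<^sup>2" unfolding ab(3) by (rule mult_left_mono) simp
    moreover have "0 \<le> \<xi>\<^sup>2 * h\<^sup>2" by simp
    ultimately show ?thesis unfolding power2_minus power_mult_distrib distrib_left by linarith
  qed
  finally have e: "cmod e \<le> (\<xi> * h)\<^sup>2" .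
  have "iexp (\<xi> * s) - (exp_primitive (t + h) \<xi> - exp_primitive t \<xi>) / of_real h
     = iexp (\<xi> * s) * e / (\<i> * of_real (\<xi> * h))"
  proof -
    have 1: "iexp (\<xi> * (t + h)) = iexp (\<xi> * s) * iexp (\<xi> * a)"
      unfolding exp_add[symmetric] by (simp add: a_def algebra_simps)
    have 2: "iexp (\<xi> * t) = iexp (\<xi> * s) * iexp (- (\<xi> * b))"
      unfolding exp_add[symmetric] by (simp add: b_def algebra_simps)
    have alg: "E - (E * P - E * Q) / c / k = E * (c * k - (P - Q)) / (c * k)"
      if "c \<noteq> 0" "k \<noteq> 0" for E P Q c k :: complex
      using that by (simp add: field_simps)
    have ih: "\<i> * complex_of_real (\<xi> * h) = \<i> * of_real \<xi> * of_real h" by simp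
    show ?thesis
      unfolding diff e_def 1 2 ih by (rule alg) (use assms in auto)
  qed
  also have "cmod \<dots> = cmod e / (\<bar>\<xi>\<bar> * h)"
    using assms by (simp add: norm_mult norm_divide abs_mult)
  also have "\<dots> \<le> (\<xi> * h)\<^sup>2 / (\<bar>\<xi>\<bar> * h)"
    using assms by (intro divide_right_mono e) auto
  also have "\<dots> = \<bar>\<xi>\<bar> * h"
    using assms by (simp add: power2_eq_square divide_simps)
  finally show "cmod (iexp (\<xi> * s) - (exp_primitive (t + h) \<xi> - exp_primitive t \<xi>) / of_real h) \<le> \<bar>\<xi>\<bar> * h" .
qed

section \<open>Evaluating the discretized noise\<close>

lemma floor_cell: "h > 0 \<Longrightarrow> y \<in> {of_int j / h ..< (of_int j + 1) / h} \<longleftrightarrow> j = \<lfloor>y * h\<rfloor>" for y h :: real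
  unfolding eq_commute[of j] floor_eq_iff by (simp add: field_simps)

lemma discrete_noise_eq:
  assumes s: "0 \<le> s" "s < 1"
  shows "discrete_noise n b s y =
    (if - (2 ^ n) \<le> y \<and> y < 2 ^ n
     then 2 ^ (2 * n) * rect_increment n (nat \<lfloor>s * 2 ^ n\<rfloor>) \<lfloor>y * 2 ^ n\<rfloor> b else 0)"
proof -
  define I where "I = nat \<lfloor>s * 2 ^ n\<rfloor>"
  define J where "J = \<lfloor>y * 2 ^ n\<rfloor>"
  have fl0: "0 \<le> \<lfloor>s * 2 ^ n\<rfloor>" using s by simp
  have I: "s \<in> {real i / 2 ^ n ..< (real i + 1) / 2 ^ n} \<longleftrightarrow> i = I" for i :: nat
    using floor_cell[of "2 ^ n" s "int i"] fl0 by (auto simp: I_def)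
  have J: "y \<in> {of_int j / 2 ^ n ..< (of_int j + 1) / 2 ^ n} \<longleftrightarrow> j = J" for j :: int
    using floor_cell[of "2 ^ n" y j] by (simp add: J_def)
  have I_in: "I < 2 ^ n"
  proof -
    have "s * 2 ^ n < 1 * 2 ^ n" by (rule mult_strict_right_mono) (use s in auto)
    then have "\<lfloor>s * 2 ^ n\<rfloor> < 2 ^ n" by (simp add: floor_less_iff)
    then show ?thesis unfolding I_def using fl0 by (simp add: nat_less_iff)
  qed
  have J_in: "J \<in> {- (2 ^ (2 * n)) ..< 2 ^ (2 * n)} \<longleftrightarrow> - (2 ^ n) \<le> y \<and> y < 2 ^ n"
  proof -
    have p: "(2::real) ^ (2 * n) = 2 ^ n * 2 ^ n" by (simp add: mult_2 power_add)
    have "- (2 ^ (2 * n)) \<le> J \<longleftrightarrow> - (2 ^ n) * 2 ^ n \<le> y * 2 ^ n"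
      unfolding J_def le_floor_iff by (simp add: p)
    moreover have "J < 2 ^ (2 * n) \<longleftrightarrow> y * 2 ^ n < 2 ^ n * 2 ^ n"
      unfolding J_def floor_less_iff by (simp add: p)
    ultimately show ?thesis
      unfolding atLeastLessThan_iff by (simp only: mult_le_cancel_right mult_less_cancel_right) auto
  qed
  have "discrete_noise n b s y = (\<Sum>i<2 ^ n. \<Sum>j\<in>{- (2 ^ (2 * n)) ..< (2 ^ (2 * n) :: int)}.
      if i = I then (if j = J then 2 ^ (2 * n) * rect_increment n i j b else 0) else 0)"
    unfolding discrete_noise_def I J by (intro sum.cong) auto
  also have "\<dots> = (\<Sum>i<2 ^ n. if i = I then (\<Sum>j\<in>{- (2 ^ (2 * n)) ..< (2 ^ (2 * n) :: int)}.
      (if j = J then 2 ^ (2 * n) * rect_increment n i j b else 0)) else 0)"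
    by (intro sum.cong) auto
  also have "\<dots> = (\<Sum>j\<in>{- (2 ^ (2 * n)) ..< (2 ^ (2 * n) :: int)}.
      if j = J then 2 ^ (2 * n) * rect_increment n I j b else 0)"
    using I_in by simp
  also have "\<dots> = (if J \<in> {- (2 ^ (2 * n)) ..< (2 ^ (2 * n) :: int)} then 2 ^ (2 * n) * rect_increment n I J b else 0)"
    by (rule sum.delta) simp
  finally show ?thesis unfolding J_in by (simp add: I_def J_def)
qed

section \<open>Taylor expansion of the field and the variance of the noise error\<close>

lemma noise_integral_measurable:
  "is_noise_integral M W f X \<Longrightarrow> f \<in> borel_measurable borel"
  "is_noise_integral M W f X \<Longrightarrow> X \<in> borel_measurable M"
  by (simp_all add: is_noise_integral_def)

text \<open>The sum of \<open>(|Z j k| / (2R) ^ (j + k))\<^sup>2\<close> has finite expectation, so it is almost surely finite and bounds each of its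
  terms.\<close>

lemma AE_exponential_bound:
  fixes Z :: "nat \<Rightarrow> nat \<Rightarrow> 'a \<Rightarrow> complex"
  assumes [measurable]: "\<And>j k. Z j k \<in> borel_measurable M"
    and R: "R > 0" and K: "K \<ge> 0"
    and le: "\<And>j k. L2_sq M (Z j k) \<le> ennreal (K * (R ^ (j + k))\<^sup>2)"
  shows "AE \<omega> in M. \<exists>C. \<forall>j k. cmod (Z j k \<omega>) \<le> C * (2 * R) ^ (j + k)"
proof -
  define w where "w j k = 1 / ((2 * R) ^ (j + k))\<^sup>2" for j k
  have w: "w j k > 0" for j k using R by (simp add: w_def)
  define Y where "Y \<omega> = (\<Sum>j. \<Sum>k. ennreal (w j k * (cmod (Z j k \<omega>))\<^sup>2))" for \<omega>
  have [measurable]: "Y \<in> borel_measurable M" unfolding Y_def by measurable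
  have geo: "(\<Sum>k. ennreal (c * (1/4) ^ k)) = ennreal (c * (4/3))" if "c \<ge> 0" for c :: real
  proof -
    have s: "(\<lambda>k. c * (1/4) ^ k) sums (c * (1 / (1 - 1/4)))"
      by (intro sums_mult geometric_sums) simp
    have "(\<Sum>k. ennreal (c * (1/4) ^ k)) = ennreal (\<Sum>k. c * (1/4) ^ k)"
      using that by (intro suminf_ennreal2 sums_summable[OF s]) simp
    also have "(\<Sum>k. c * (1/4) ^ k) = c * (4/3)"
      using sums_unique[OF s] by simp
    finally show ?thesis .
  qed
  have mode: "(\<integral>\<^sup>+\<omega>. ennreal (w j k * (cmod (Z j k \<omega>))\<^sup>2) \<partial>M) \<le> ennreal (K * (1/4) ^ j * (1/4) ^ k)" for j k
  proof -
    have "(\<integral>\<^sup>+\<omega>. ennreal (w j k * (cmod (Z j k \<omega>))\<^sup>2) \<partial>M) = ennreal (w j k) * L2_sq M (Z j k)"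
      unfolding L2_sq_def using w[of j k] by (simp add: ennreal_mult nn_integral_cmult)
    also have "\<dots> \<le> ennreal (w j k) * ennreal (K * (R ^ (j + k))\<^sup>2)"
      by (intro mult_left_mono le) simp
    also have "\<dots> = ennreal (w j k * (K * (R ^ (j + k))\<^sup>2))"
      using w[of j k] K by (simp add: ennreal_mult)
    also have "w j k * (K * (R ^ (j + k))\<^sup>2) = K * (1/4) ^ j * (1/4) ^ k"
    proof -
      have p4: "(2 ^ m)\<^sup>2 = (4::real) ^ m" for m :: nat
        by (simp add: power2_eq_square flip: power_mult_distrib)
      have "((2 * R) ^ (j + k))\<^sup>2 = 4 ^ (j + k) * (R ^ (j + k))\<^sup>2"
        by (simp only: power_mult_distrib p4)
      then show ?thesis
        unfolding w_def using R by (simp add: power_add power_divide)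
    qed
    finally show ?thesis .
  qed
  have "(\<integral>\<^sup>+\<omega>. Y \<omega> \<partial>M) = (\<Sum>j. \<Sum>k. \<integral>\<^sup>+\<omega>. ennreal (w j k * (cmod (Z j k \<omega>))\<^sup>2) \<partial>M)"
    unfolding Y_def by (simp add: nn_integral_suminf)
  also have "\<dots> \<le> (\<Sum>j. \<Sum>k. ennreal (K * (1/4) ^ j * (1/4) ^ k))"
    by (intro suminf_le summableI mode)
  also have "\<dots> = ennreal (K * (4/3) * (4/3))"
  proof -
    have "(\<Sum>k. ennreal (K * (1/4) ^ j * (1/4) ^ k)) = ennreal (K * (4/3) * (1/4) ^ j)" for j
    proof -
      have "(\<Sum>k. ennreal (K * (1/4) ^ j * (1/4) ^ k)) = ennreal (K * (1/4) ^ j * (4/3))"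
        by (rule geo) (use K in simp)
      also have "K * (1/4) ^ j * (4/3) = K * (4/3) * (1/4) ^ j"
        by (simp only: mult_ac)
      finally show ?thesis .
    qed
    then show ?thesis
      using geo[of "K * (4/3)"] K by (simp only:)
  qed
  finally have "(\<integral>\<^sup>+\<omega>. Y \<omega> \<partial>M) < \<infinity>"
    by (rule le_less_trans) simp
  then have "AE \<omega> in M. Y \<omega> \<noteq> \<infinity>"
    by (intro nn_integral_noteq_infinite) auto
  then show ?thesis
  proof eventually_elim
    case (elim \<omega>)
    then obtain r where r: "Y \<omega> = ennreal r" "r \<ge> 0"
      by (cases "Y \<omega>") auto
    have "cmod (Z j k \<omega>) \<le> sqrt r * (2 * R) ^ (j + k)" for j k
    proof -
      have single: "f k \<le> suminf f" for f :: "nat \<Rightarrow> ennreal" and k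
        using sum_le_suminf[of f "{k}"] by simp
      have "ennreal (w j k * (cmod (Z j k \<omega>))\<^sup>2) \<le> (\<Sum>k. ennreal (w j k * (cmod (Z j k \<omega>))\<^sup>2))"
        by (rule single)
      also have "\<dots> \<le> Y \<omega>" unfolding Y_def by (rule single)
      finally have "w j k * (cmod (Z j k \<omega>))\<^sup>2 \<le> r"
        using r by simp
      then have "(cmod (Z j k \<omega>))\<^sup>2 \<le> r * ((2 * R) ^ (j + k))\<^sup>2"
        using R by (simp add: w_def field_simps)
      then have "cmod (Z j k \<omega>) \<le> sqrt (r * ((2 * R) ^ (j + k))\<^sup>2)"
        by (rule real_le_rsqrt)
      then show ?thesis using R r by (simp add: real_sqrt_mult)
    qed
    then show ?case by blast
  qed
qed

context
  fixes M :: "'w measure" and W :: "(real \<times> real) set \<Rightarrow> 'w \<Rightarrow> complex"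
  assumes prob: "prob_space M" and noise: "fourier_white_noise M W"
begin

lemma noise_integral_zero: "is_noise_integral M W (\<lambda>_. 0) (\<lambda>_. 0)"
  using noise_integral_sum[OF prob noise, of "{}"] by simp

text \<open>A generating function whose coefficients are noise integrals of \<open>q \<alpha>\<^sub>j \<beta>\<^sub>k\<close> behaves like the noise integral of \<open>q\<close>
  times the product of the generating functions of \<open>\<alpha>\<close> and \<open>\<beta>\<close>. It is used with difference 0 on the right, to
  identify the field with its Taylor series, and to estimate the noise error.\<close>

lemma double_egf_noise_norm_le:
  assumes q [measurable]: "q \<in> borel_measurable borel" and fin: "L2_sq lborel q < \<infinity>"
    and [measurable]: "\<And>j. \<alpha> j \<in> borel_measurable borel" "\<And>k. \<beta> k \<in> borel_measurable borel"
    and R: "R \<ge> 0"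
    and \<alpha>: "\<And>j z. q z \<noteq> 0 \<Longrightarrow> cmod (\<alpha> j (fst z)) \<le> R ^ j"
    and \<beta>: "\<And>k z. q z \<noteq> 0 \<Longrightarrow> cmod (\<beta> k (snd z)) \<le> R ^ k"
    and a: "\<And>j k. is_noise_integral M W (\<lambda>z. q z * (\<alpha> j (fst z) * \<beta> k (snd z))) (\<lambda>\<omega>. a \<omega> j k)"
    and bd: "AE \<omega> in M. \<exists>C. \<forall>j k. cmod (a \<omega> j k) \<le> C * T ^ (j + k)" and T: "T \<ge> 0"
    and X: "is_noise_integral M W g X"
  shows "L2_sq M (\<lambda>\<omega>. X \<omega> - double_egf (a \<omega>) t x)
     \<le> 8 * L2_sq lborel (\<lambda>z. g z - q z * (egf (\<lambda>j. \<alpha> j (fst z)) t * egf (\<lambda>k. \<beta> k (snd z)) x))"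
proof -
  have [measurable]: "(\<lambda>z::real \<times> real. fst z) \<in> borel_measurable borel" "(\<lambda>z::real \<times> real. snd z) \<in> borel_measurable borel"
    by (simp_all add: borel_measurable_continuous_onI continuous_on_fst continuous_on_snd)
  have [measurable]: "g \<in> borel_measurable borel" using noise_integral_measurable[OF X] by simp
  define P where "P N z = (\<Sum>j<N. \<alpha> j (fst z) * of_real (t ^ j / fact j))" for N and z :: "real \<times> real"
  define Q where "Q N z = (\<Sum>k<N. \<beta> k (snd z) * of_real (x ^ k / fact k))" for N and z :: "real \<times> real"
  define w' where "w' z = egf (\<lambda>j. \<alpha> j (fst z)) t * egf (\<lambda>k. \<beta> k (snd z)) x" for z :: "real \<times> real"
  have [measurable]: "P N \<in> borel_measurable borel" "Q N \<in> borel_measurable borel" for N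
    unfolding P_def Q_def by measurable
  have [measurable]: "w' \<in> borel_measurable borel"
    unfolding w'_def egf_def by measurable
  define f where "f N z = g z - q z * (P N z * Q N z)" for N z
  define Y where "Y N \<omega> = X \<omega> - (\<Sum>j<N. \<Sum>k<N. a \<omega> j k * of_real (t ^ j / fact j * (x ^ k / fact k)))" for N \<omega>
  have "is_noise_integral M W (f N) (Y N)" for N
  proof -
    have "is_noise_integral M W
      (\<lambda>z. \<Sum>j<N. \<Sum>k<N. of_real (t ^ j / fact j * (x ^ k / fact k)) * (q z * (\<alpha> j (fst z) * \<beta> k (snd z))))
      (\<lambda>\<omega>. \<Sum>j<N. \<Sum>k<N. of_real (t ^ j / fact j * (x ^ k / fact k)) * a \<omega> j k)"
      by (intro noise_integral_sum[OF prob noise] noise_integral_cmult[OF prob noise] a) auto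
    from noise_integral_diff[OF prob noise X this]
    have "is_noise_integral M W
      (\<lambda>z. g z - (\<Sum>j<N. \<Sum>k<N. of_real (t ^ j / fact j * (x ^ k / fact k)) * (q z * (\<alpha> j (fst z) * \<beta> k (snd z)))))
      (Y N)"
      by (simp add: Y_def[abs_def] mult_ac)
    moreover have "(\<Sum>j<N. \<Sum>k<N. of_real (t ^ j / fact j * (x ^ k / fact k)) * (q z * (\<alpha> j (fst z) * \<beta> k (snd z))))
       = q z * (P N z * Q N z)" for z
    proof -
      have "P N z * Q N z = (\<Sum>j<N. \<Sum>k<N. \<alpha> j (fst z) * of_real (t ^ j / fact j) * (\<beta> k (snd z) * of_real (x ^ k / fact k)))"
        unfolding P_def Q_def by (rule sum_product)
      then show ?thesis
        unfolding sum_distrib_left by (simp only: sum_distrib_left) (simp add: mult_ac)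
    qed
    ultimately show ?thesis by (simp add: f_def[abs_def])
  qed
  moreover have "(\<lambda>z. g z - q z * w' z) \<in> borel_measurable borel" by measurable
  moreover have "(\<lambda>N. L2_sq lborel (\<lambda>z. f N z - (g z - q z * w' z))) \<longlonglongrightarrow> 0"
  proof -
    have "(\<lambda>N. L2_sq lborel (\<lambda>z. q z * (P N z * Q N z) - q z * w' z)) \<longlonglongrightarrow> 0"
    proof (rule L2_sq_dominated[where K = "exp (R * \<bar>t\<bar>) * exp (R * \<bar>x\<bar>)"])
      fix N :: nat and z :: "real \<times> real" assume z: "q z \<noteq> 0"
      show "cmod (P N z * Q N z) \<le> exp (R * \<bar>t\<bar>) * exp (R * \<bar>x\<bar>)"
        unfolding norm_mult P_def Q_def
        by (intro mult_mono egf_partial_bound(1) \<alpha> \<beta> z R) auto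
    next
      fix z :: "real \<times> real" assume z: "q z \<noteq> 0"
      show "(\<lambda>N. P N z * Q N z) \<longlonglongrightarrow> w' z"
        unfolding P_def Q_def w'_def
        by (intro tendsto_mult egf_partial_bound(2)[OF _ R] \<alpha> \<beta> z)
    qed (use fin in measurable)
    then show ?thesis
      by (subst L2_sq_minus_commute) (simp add: f_def)
  qed
  moreover have "AE \<omega> in M. (\<lambda>N. Y N \<omega>) \<longlonglongrightarrow> X \<omega> - double_egf (a \<omega>) t x"
    using bd
  proof eventually_elim
    case (elim \<omega>)
    then obtain C where "\<And>j k. cmod (a \<omega> j k) \<le> C * T ^ (j + k)" by blast
    then show ?case
      unfolding Y_def by (intro tendsto_diff tendsto_const double_egf_LIMSEQ[OF _ T])
  qed
  ultimately show ?thesis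
    unfolding w'_def by (rule noise_integral_AE_limit_norm_le[OF prob noise])
qed

lemma noise_integral_rect_increment:
  assumes "\<And>t x. is_noise_integral M W (F t x) (B t x)"
  shows "is_noise_integral M W (\<lambda>z. rect_increment n i j (\<lambda>t x. F t x z)) (\<lambda>\<omega>. rect_increment n i j (\<lambda>t x. B t x \<omega>))"
  unfolding rect_increment_def
  by (intro noise_integral_add[OF prob noise] noise_integral_diff[OF prob noise] assms)

text \<open>The coefficients \<open>a j k\<close> are noise integrals of the symbol times \<open>(i\<xi>)\<^sup>j (i\<eta>)\<^sup>k\<close>. Shifted by one in both
  indices they are the Taylor coefficients of the field, so unshifted those of its mixed derivative. In the last
  estimate the factor \<open>2R/2\<^sup>n\<close> is the deviation of the character from its average over a cell.\<close>

theorem approx_field_noise_error: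
  fixes H0 H1 \<kappa> :: real and n :: nat and B :: "real \<Rightarrow> real \<Rightarrow> 'w \<Rightarrow> complex"
  defines "R \<equiv> 2 powr (2 * \<kappa> * n)" and "S \<equiv> 2 powr (\<kappa> * n)"
  defines "E \<equiv> symbol_energy (hconst H0 * hconst H1) H0 H1 R S"
  assumes H: "H0 < 1" "H1 < 1" and \<kappa>: "\<kappa> > 0" and B: "approx_field M W H0 H1 \<kappa> n B"
  obtains a where "\<And>j k. (\<lambda>\<omega>. a \<omega> j k) \<in> borel_measurable M"
    and "AE \<omega> in M. mixed_deriv (\<lambda>t x. B t x \<omega>) = double_egf (a \<omega>)"
    and "\<And>s y. L2_sq M (\<lambda>\<omega>. double_egf (a \<omega>) s y) \<le> ennreal (8 * E)"
    and "\<And>s y. 0 \<le> s \<Longrightarrow> s < 1 \<Longrightarrow>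
       L2_sq M (\<lambda>\<omega>. double_egf (a \<omega>) s y - discrete_noise n (\<lambda>t x. B t x \<omega>) s y)
         \<le> ennreal (8 * ((2 * R / 2 ^ n)\<^sup>2 * (1 + y\<^sup>2) * E))"
proof -
  interpret prob_space M by (rule prob)
  have R1: "1 \<le> R" and SR: "S \<le> R" and R0: "0 \<le> R" and S0: "0 \<le> S"
    using \<kappa> by (auto simp: R_def S_def ge_one_powr_ge_zero)
  have E0: "0 \<le> E" unfolding E_def by (rule symbol_energy_nonneg[OF H])
  define q where "q = noise_symbol (hconst H0 * hconst H1) H0 H1 R S"
  have q [measurable]: "q \<in> borel_measurable borel" by (simp add: q_def)
  have qE: "L2_sq lborel q \<le> ennreal E"
    unfolding q_def E_def by (rule noise_symbol_energy[OF H R0 S0])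
  then have fin: "L2_sq lborel q < \<infinity>" by (rule le_less_trans) simp
  have box: "\<bar>fst z\<bar> \<le> R" "\<bar>snd z\<bar> \<le> R" "fst z \<noteq> 0" "snd z \<noteq> 0" if "q z \<noteq> 0" for z
    using noise_symbol_nonzero[OF that[unfolded q_def]] SR by auto
  define p where "p j \<xi> = (\<i> * complex_of_real \<xi>) ^ j" for j :: nat and \<xi> :: real
  have p: "cmod (p j \<xi>) \<le> R ^ j" if "\<bar>\<xi>\<bar> \<le> R" for j \<xi>
    using that by (simp add: p_def norm_power norm_mult power_mono)
  have [measurable]: "p j \<in> borel_measurable borel" for j unfolding p_def by measurable
  \<comment> \<open>The Taylor coefficients of the primitive of the character, as opposed to those of the character itself.\<close>
  define p' where "p' j \<xi> = shift_seq (\<lambda>j. p j \<xi>) j" for j :: nat and \<xi> :: real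
  have p': "cmod (p' j \<xi>) \<le> R ^ j" if "\<bar>\<xi>\<bar> \<le> R" for j \<xi>
  proof (cases j)
    case (Suc i)
    have "R ^ i \<le> R ^ Suc i" using R1 by (intro power_increasing) auto
    then show ?thesis using p[OF that, of i] by (simp add: p'_def Suc)
  qed (simp add: p'_def)
  have [measurable]: "p' j \<in> borel_measurable borel" for j
    by (cases j) (simp_all add: p'_def[abs_def])
  have [measurable]: "(\<lambda>z::real \<times> real. fst z) \<in> borel_measurable borel" "(\<lambda>z::real \<times> real. snd z) \<in> borel_measurable borel"
    by (simp_all add: borel_measurable_continuous_onI continuous_on_fst continuous_on_snd)
  have mode_le: "L2_sq lborel (\<lambda>z. q z * (p j (fst z) * p k (snd z))) \<le> ennreal (E * (R ^ (j + k))\<^sup>2)" for j k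
  proof -
    have "L2_sq lborel (\<lambda>z. q z * (p j (fst z) * p k (snd z))) \<le> ennreal ((R ^ (j + k))\<^sup>2) * L2_sq lborel q"
      by (rule L2_sq_mult_le) (auto simp: norm_mult power_add R0 intro!: mult_mono p box)
    also have "\<dots> \<le> ennreal ((R ^ (j + k))\<^sup>2) * ennreal E"
      by (intro mult_left_mono qE) simp
    also have "\<dots> = ennreal (E * (R ^ (j + k))\<^sup>2)"
      by (simp add: ennreal_mult[symmetric] E0 mult.commute)
    finally show ?thesis .
  qed
  have "\<exists>Z. is_noise_integral M W (\<lambda>z. q z * (p j (fst z) * p k (snd z))) Z" for j k
    by (rule noise_integral_exists[OF prob noise], measurable) (rule le_less_trans[OF mode_le], simp)
  then obtain Z where Z: "\<And>j k. is_noise_integral M W (\<lambda>z. q z * (p j (fst z) * p k (snd z))) (Z j k)"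
    by metis
  have Zm [measurable]: "Z j k \<in> borel_measurable M" for j k
    by (rule noise_integral_measurable(2)[OF Z])
  have Z_le: "L2_sq M (Z j k) \<le> ennreal ((4 * E) * (R ^ (j + k))\<^sup>2)" for j k
  proof -
    have "L2_sq M (Z j k) \<le> 4 * ennreal (E * (R ^ (j + k))\<^sup>2)"
      by (rule order_trans[OF noise_integral_norm_le[OF prob noise Z]]) (intro mult_left_mono mode_le, simp)
    also have "\<dots> = ennreal ((4 * E) * (R ^ (j + k))\<^sup>2)"
      using ennreal_mult'[of 4 "E * (R ^ (j + k))\<^sup>2"] by (simp add: mult.assoc)
    finally show ?thesis .
  qed
  define a where "a \<omega> j k = Z j k \<omega>" for \<omega> j k
  define b where "b \<omega> j k = shift_seq (\<lambda>j. shift_seq (a \<omega> j) k) j" for \<omega> j k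
  have a_bd: "AE \<omega> in M. \<exists>C. \<forall>j k. cmod (a \<omega> j k) \<le> C * (2 * R) ^ (j + k)"
    unfolding a_def using AE_exponential_bound[OF Zm _ _ Z_le] R1 E0 by simp
  have b_bd: "\<exists>C. \<forall>j k. cmod (b \<omega> j k) \<le> C * (2 * R) ^ (j + k)"
    if ex: "\<exists>C. \<forall>j k. cmod (a \<omega> j k) \<le> C * (2 * R) ^ (j + k)" for \<omega>
  proof -
    obtain C where C: "\<And>j k. cmod (a \<omega> j k) \<le> C * (2 * R) ^ (j + k)" using ex by blast
    have C0: "0 \<le> C" using order_trans[OF norm_ge_zero C[of 0 0]] by simp
    have "cmod (b \<omega> j k) \<le> C * (2 * R) ^ (j + k)" for j k
    proof (cases "j = 0 \<or> k = 0")
      case True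
      then show ?thesis using C0 R0 by (cases j) (auto simp: b_def)
    next
      case False
      then obtain j' k' where jk: "j = Suc j'" "k = Suc k'" by (metis not0_implies_Suc)
      have "(2 * R) ^ (j' + k') \<le> (2 * R) ^ (j + k)"
        using R1 by (intro power_increasing) (auto simp: jk)
      then show ?thesis
        using C[of j' k'] C0 by (simp add: b_def jk order_trans[OF _ mult_left_mono])
    qed
    then show ?thesis by blast
  qed
  have b_noise: "is_noise_integral M W (\<lambda>z. q z * (p' j (fst z) * p' k (snd z))) (\<lambda>\<omega>. b \<omega> j k)" for j k
  proof (cases "j = 0 \<or> k = 0")
    case True
    then show ?thesis using noise_integral_zero by (cases j) (auto simp: b_def p'_def)
  next
    case False
    then obtain j' k' where jk: "j = Suc j'" "k = Suc k'" by (metis not0_implies_Suc)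
    show ?thesis using Z[of j' k'] by (simp add: jk b_def p'_def a_def)
  qed
  have field: "is_noise_integral M W (field_kernel H0 H1 \<kappa> n t x) (B t x)" for t x
    using B by (simp add: approx_field_def)
  have kernel: "field_kernel H0 H1 \<kappa> n t x z = q z * (exp_primitive t (fst z) * exp_primitive x (snd z))" for t x z
    by (simp add: field_kernel_eq q_def R_def S_def)

  \<comment> \<open>The field is the sum of its Taylor series.\<close>
  have "AE \<omega> in M. B t x \<omega> = double_egf (b \<omega>) t x" for t x
  proof -
    have b_bd': "AE \<omega> in M. \<exists>C. \<forall>j k. cmod (b \<omega> j k) \<le> C * (2 * R) ^ (j + k)"
      using a_bd by eventually_elim (rule b_bd)
    have "L2_sq M (\<lambda>\<omega>. B t x \<omega> - double_egf (b \<omega>) t x)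
       \<le> 8 * L2_sq lborel (\<lambda>z. field_kernel H0 H1 \<kappa> n t x z -
             q z * (egf (\<lambda>j. p' j (fst z)) t * egf (\<lambda>k. p' k (snd z)) x))"
      by (rule double_egf_noise_norm_le[where R = R and T = "2 * R"])
         (use fin R0 p' box b_noise b_bd' field in auto)
    also have "L2_sq lborel (\<lambda>z. field_kernel H0 H1 \<kappa> n t x z -
             q z * (egf (\<lambda>j. p' j (fst z)) t * egf (\<lambda>k. p' k (snd z)) x)) = 0"
    proof -
      have "field_kernel H0 H1 \<kappa> n t x z - q z * (egf (\<lambda>j. p' j (fst z)) t * egf (\<lambda>k. p' k (snd z)) x) = 0" for z
        using box[of z] egf_shift_power[of "fst z" t] egf_shift_power[of "snd z" x]
        by (cases "q z = 0") (auto simp: kernel p'_def p_def)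
      then show ?thesis by (simp add: L2_sq_def)
    qed
    finally have "(\<integral>\<^sup>+\<omega>. ennreal ((cmod (B t x \<omega> - double_egf (b \<omega>) t x))\<^sup>2) \<partial>M) = 0"
      by (simp add: L2_sq_def)
    moreover have [measurable]: "B t x \<in> borel_measurable M" "(\<lambda>\<omega>. b \<omega> j k) \<in> borel_measurable M" for j k
      using noise_integral_measurable(2)[OF field] noise_integral_measurable(2)[OF b_noise] by auto
    ultimately have "AE \<omega> in M. ennreal ((cmod (B t x \<omega> - double_egf (b \<omega>) t x))\<^sup>2) = 0"
      by (subst (asm) nn_integral_0_iff_AE) auto
    then show ?thesis by eventually_elim simp
  qed
  then have "AE \<omega> in M. \<forall>t\<in>\<rat>. \<forall>x\<in>\<rat>. B t x \<omega> = double_egf (b \<omega>) t x"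
    by (intro AE_ball_countable' countable_rat) 
  moreover have "AE \<omega> in M. continuous_on UNIV (\<lambda>(t, x). B t x \<omega>)"
    using B by (simp add: approx_field_def)
  ultimately have deriv: "AE \<omega> in M. mixed_deriv (\<lambda>t x. B t x \<omega>) = double_egf (a \<omega>)"
    using a_bd
  proof eventually_elim
    case (elim \<omega>)
    then obtain C where C: "\<And>j k. cmod (b \<omega> j k) \<le> C * (2 * R) ^ (j + k)" using b_bd by blast
    have R2: "0 \<le> 2 * R" using R0 by simp
    have B_eq: "(\<lambda>t x. B t x \<omega>) = double_egf (b \<omega>)"
      by (rule double_egf_eqI[OF C R2]) (use elim in auto)
    have shift: "(\<lambda>j k. b \<omega> (Suc j) (Suc k)) = a \<omega>"
      by (simp add: b_def)
    show ?case
      by (intro ext) (simp only: B_eq mixed_deriv_double_egf[OF C R2] shift)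
  qed

  have a_noise: "is_noise_integral M W (\<lambda>z. q z * (p j (fst z) * p k (snd z))) (\<lambda>\<omega>. a \<omega> j k)" for j k
    using Z[of j k] by (simp add: a_def)
  have le: "L2_sq M (\<lambda>\<omega>. X \<omega> - double_egf (a \<omega>) s y) \<le> ennreal (8 * (K\<^sup>2 * E))"
    if X: "is_noise_integral M W (\<lambda>z. q z * w z) X" and K: "K \<ge> 0"
      and w: "\<And>z. q z \<noteq> 0 \<Longrightarrow> cmod (w z - iexp (fst z * s) * iexp (snd z * y)) \<le> K"
    for X w s y K
  proof -
    have "L2_sq M (\<lambda>\<omega>. X \<omega> - double_egf (a \<omega>) s y)
       \<le> 8 * L2_sq lborel (\<lambda>z. q z * w z - q z * (egf (\<lambda>j. p j (fst z)) s * egf (\<lambda>k. p k (snd z)) y))"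
      by (rule double_egf_noise_norm_le[where R = R and T = "2 * R"])
         (use fin R0 p box a_noise a_bd X in auto)
    also have "(\<lambda>z. q z * w z - q z * (egf (\<lambda>j. p j (fst z)) s * egf (\<lambda>k. p k (snd z)) y)) =
       (\<lambda>z. q z * (w z - iexp (fst z * s) * iexp (snd z * y)))"
      by (simp only: p_def egf_power right_diff_distrib)
    also have "8 * L2_sq lborel \<dots> \<le> 8 * (ennreal (K\<^sup>2) * ennreal E)"
      by (intro mult_left_mono order_trans[OF L2_sq_mult_le[OF _ K w] mult_left_mono[OF qE]]) auto
    also have "\<dots> = ennreal (8 * (K\<^sup>2 * E))"
      using ennreal_mult'[of 8 "K\<^sup>2 * E"] E0 by (simp add: ennreal_mult)
    finally show ?thesis .
  qed
  have V_le: "L2_sq M (\<lambda>\<omega>. double_egf (a \<omega>) s y) \<le> ennreal (8 * E)" for s y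
    using le[of "\<lambda>_. 0" "\<lambda>_. 0" 1 s y] noise_integral_zero
    by (simp add: norm_mult) (simp add: L2_sq_def)
  have D_le: "L2_sq M (\<lambda>\<omega>. double_egf (a \<omega>) s y - discrete_noise n (\<lambda>t x. B t x \<omega>) s y)
         \<le> ennreal (8 * ((2 * R / 2 ^ n)\<^sup>2 * (1 + y\<^sup>2) * E))"
    if s: "0 \<le> s" "s < 1" for s y
  proof (cases "- (2 ^ n) \<le> y \<and> y < 2 ^ n")
    case True
    define i where "i = nat \<lfloor>s * 2 ^ n\<rfloor>"
    define j where "j = \<lfloor>y * 2 ^ n\<rfloor>"
    define h :: real where "h = 1 / 2 ^ n"
    define t where "t = real i / 2 ^ n"
    define x where "x = of_int j / (2 ^ n :: real)"
    have h: "h > 0" by (simp add: h_def)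
    have th: "(real i + 1) / 2 ^ n = t + h" "(of_int j + 1) / 2 ^ n = x + h"
      by (simp_all add: t_def x_def h_def add_divide_distrib)
    have "s \<in> {of_int (int i) / 2 ^ n ..< (of_int (int i) + 1) / 2 ^ n}"
      by (subst floor_cell) (use s in \<open>simp_all add: i_def\<close>)
    then have s_in: "t \<le> s" "s \<le> t + h" using th by (auto simp: t_def)
    have "y \<in> {of_int j / 2 ^ n ..< (of_int j + 1) / 2 ^ n}"
      by (subst floor_cell) (simp_all add: j_def)
    then have y_in: "x \<le> y" "y \<le> x + h" using th by (auto simp: x_def)
    define \<delta> where "\<delta> t \<xi> = (exp_primitive (t + h) \<xi> - exp_primitive t \<xi>) / of_real h" for t \<xi>
    have h2: "(2::complex) ^ (2 * n) = 1 / (of_real h * of_real h)"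
      by (simp add: h_def mult_2 power_add)
    have "is_noise_integral M W (\<lambda>z. 2 ^ (2 * n) * rect_increment n i j (\<lambda>t x. field_kernel H0 H1 \<kappa> n t x z))
       (\<lambda>\<omega>. 2 ^ (2 * n) * rect_increment n i j (\<lambda>t x. B t x \<omega>))"
      by (intro noise_integral_cmult[OF prob noise] noise_integral_rect_increment field)
    also have "(\<lambda>z. 2 ^ (2 * n) * rect_increment n i j (\<lambda>t x. field_kernel H0 H1 \<kappa> n t x z))
       = (\<lambda>z. q z * (\<delta> t (fst z) * \<delta> x (snd z)))"
    proof
      fix z
      have alg: "(1 / (c * c)) * (Q * (A' * B') - Q * (A' * B) - Q * (A * B') + Q * (A * B)) = Q * ((A' - A) / c * ((B' - B) / c))"
        for c Q A A' B B' :: complex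
        by (simp add: divide_inverse algebra_simps)
      show "2 ^ (2 * n) * rect_increment n i j (\<lambda>t x. field_kernel H0 H1 \<kappa> n t x z) = q z * (\<delta> t (fst z) * \<delta> x (snd z))"
        unfolding rect_increment_def kernel th t_def[symmetric] x_def[symmetric] \<delta>_def h2 by (rule alg)
    qed
    finally have X: "is_noise_integral M W (\<lambda>z. q z * (\<delta> t (fst z) * \<delta> x (snd z)))
       (\<lambda>\<omega>. 2 ^ (2 * n) * rect_increment n i j (\<lambda>t x. B t x \<omega>))" .
    have "cmod (\<delta> t (fst z) * \<delta> x (snd z) - iexp (fst z * s) * iexp (snd z * y)) \<le> 2 * R * h"
      if z: "q z \<noteq> 0" for z
    proof -
      let ?e = "iexp (fst z * s)" and ?e' = "iexp (snd z * y)"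
      have 1: "cmod (?e - \<delta> t (fst z)) \<le> R * h"
        unfolding \<delta>_def by (rule order_trans[OF exp_primitive_increment(2)[OF box(3)[OF z] h s_in]])
          (use box(1)[OF z] h in \<open>simp add: mult_right_mono\<close>)
      have 2: "cmod (?e' - \<delta> x (snd z)) \<le> R * h"
        unfolding \<delta>_def by (rule order_trans[OF exp_primitive_increment(2)[OF box(4)[OF z] h y_in]])
          (use box(2)[OF z] h in \<open>simp add: mult_right_mono\<close>)
      have 3: "cmod (\<delta> t (fst z)) \<le> 1"
        unfolding \<delta>_def by (rule exp_primitive_increment(1)[OF box(3)[OF z] h])
      have "\<delta> t (fst z) * \<delta> x (snd z) - ?e * ?e' = - (\<delta> t (fst z) * (?e' - \<delta> x (snd z)) + (?e - \<delta> t (fst z)) * ?e')"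
        by (simp add: algebra_simps)
      then have "cmod (\<delta> t (fst z) * \<delta> x (snd z) - ?e * ?e') \<le> cmod (\<delta> t (fst z)) * cmod (?e' - \<delta> x (snd z)) + cmod (?e - \<delta> t (fst z)) * cmod ?e'"
        by (simp only: norm_minus_cancel norm_mult[symmetric] norm_triangle_ineq)
      also have "\<dots> \<le> 1 * (R * h) + (R * h) * 1"
        by (intro add_mono mult_mono 1 2 3) (use R0 h in auto)
      finally show ?thesis by simp
    qed
    from le[OF X _ this] have "L2_sq M (\<lambda>\<omega>. 2 ^ (2 * n) * rect_increment n i j (\<lambda>t x. B t x \<omega>) - double_egf (a \<omega>) s y)
       \<le> ennreal (8 * ((2 * R * h)\<^sup>2 * E))"
      using R0 h by simp
    also have "\<dots> \<le> ennreal (8 * ((2 * R / 2 ^ n)\<^sup>2 * (1 + y\<^sup>2) * E))"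
    proof (intro ennreal_leI mult_left_mono mult_right_mono E0)
      have "(2 * R / 2 ^ n)\<^sup>2 * 1 \<le> (2 * R / 2 ^ n)\<^sup>2 * (1 + y\<^sup>2)"
        by (rule mult_left_mono) auto
      then show "(2 * R * h)\<^sup>2 \<le> (2 * R / 2 ^ n)\<^sup>2 * (1 + y\<^sup>2)" by (simp add: h_def)
    qed simp
    finally show ?thesis
      unfolding discrete_noise_eq[OF s] i_def[symmetric] j_def[symmetric] if_P[OF True]
      by (subst L2_sq_minus_commute)
  next
    case False
    then have "2 ^ n \<le> \<bar>y\<bar>" by linarith
    then have "(2 ^ n)\<^sup>2 \<le> \<bar>y\<bar>\<^sup>2" by (intro power_mono) auto
    then have y: "1 \<le> y\<^sup>2 / (2 ^ n)\<^sup>2" by (simp add: field_simps)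
    have "1 \<le> (2 * R / 2 ^ n)\<^sup>2 * (1 + y\<^sup>2)"
    proof -
      have "1 * 1 \<le> (2 * R)\<^sup>2 * (y\<^sup>2 / (2 ^ n)\<^sup>2)"
        by (intro mult_mono y one_le_power) (use R1 in auto)
      also have "\<dots> \<le> (2 * R)\<^sup>2 * ((1 + y\<^sup>2) / (2 ^ n)\<^sup>2)"
        by (intro mult_left_mono divide_right_mono) auto
      finally show ?thesis by (simp add: power_divide)
    qed
    then have "1 * E \<le> (2 * R / 2 ^ n)\<^sup>2 * (1 + y\<^sup>2) * E"
      by (rule mult_right_mono[OF _ E0])
    then have "ennreal (8 * E) \<le> ennreal (8 * ((2 * R / 2 ^ n)\<^sup>2 * (1 + y\<^sup>2) * E))"
      by (intro ennreal_leI) simp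
    with V_le[of s y] show ?thesis
      unfolding discrete_noise_eq[OF s] if_not_P[OF False] by simp
  qed
  show thesis
    by (rule that[of a]) (use deriv V_le D_le in \<open>auto simp: a_def\<close>)
qed

end

section \<open>Weighted energy estimate for the heat convolution\<close>

text \<open>The weight decays fast enough to absorb the growth \<open>1 + y\<^sup>2\<close> of the variance bound, and its inverse is absorbed by one
  Gaussian factor of the squared heat kernel at times up to 1.\<close>

definition weighted_energy :: "(real \<times> real \<Rightarrow> complex) \<Rightarrow> ennreal" where
  "weighted_energy D = (\<integral>\<^sup>+p. ennreal (indicator {0..<1} (fst p) * (exp (- ((snd p)\<^sup>2 / 8)) * (cmod (D p))\<^sup>2)) \<partial>plane)"

text \<open>One of the two Gaussian factors of the square absorbs the weight, since \<open>y\<^sup>2 \<le> 2 x\<^sup>2 + 2 (x - y)\<^sup>2\<close> and \<open>u \<le> 1\<close>; the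
  other one stays as a heat kernel.\<close>

lemma heat_kernel_sq_weight:
  assumes u: "0 < u" "u \<le> 1"
  shows "(heat_kernel u (x - y))\<^sup>2 * exp (y\<^sup>2 / 8) \<le> exp (x\<^sup>2 / 4) * (u powr (- 1 / 2) * heat_kernel u (x - y))"
proof -
  define z where "z = x - y"
  define k where "k = 1 / sqrt (4 * pi * u)"
  have k0: "k \<ge> 0" using u by (simp add: k_def)
  have k: "k \<le> u powr (- 1 / 2)"
  proof -
    have "u \<le> 4 * pi * u" using u pi_gt3 by (simp add: mult_le_cancel_right2)
    then have "1 / sqrt (4 * pi * u) \<le> 1 / sqrt u"
      using u by (intro divide_left_mono) (auto intro!: mult_pos_pos)
    also have "1 / sqrt u = u powr (- 1 / 2)"
    proof -
      have "u powr (- (1 / 2)) = inverse (sqrt u)"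
        using u by (simp only: powr_minus powr_half_sqrt less_imp_le)
      then show ?thesis by (simp only: inverse_eq_divide minus_divide_left)
    qed
    finally show ?thesis by (simp add: k_def)
  qed
  have h: "heat_kernel u z = k * exp (- z\<^sup>2 / (4 * u))"
    using u by (simp add: heat_kernel_def k_def)
  have e: "exp (- z\<^sup>2 / (4 * u)) * exp (y\<^sup>2 / 8) \<le> exp (x\<^sup>2 / 4)"
  proof -
    have "y\<^sup>2 \<le> 2 * x\<^sup>2 + 2 * z\<^sup>2"
      using zero_le_power2[of "x + z"] by (simp add: z_def power2_eq_square algebra_simps)
    moreover have "z\<^sup>2 / 4 \<le> z\<^sup>2 / (4 * u)"
      using u by (intro divide_left_mono) auto
    ultimately have "- z\<^sup>2 / (4 * u) + y\<^sup>2 / 8 \<le> x\<^sup>2 / 4" by simp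
    then show ?thesis by (simp flip: exp_add)
  qed
  have "(heat_kernel u z)\<^sup>2 * exp (y\<^sup>2 / 8) = (exp (- z\<^sup>2 / (4 * u)) * exp (y\<^sup>2 / 8)) * (k * heat_kernel u z)"
    by (simp add: h power2_eq_square mult_ac)
  also have "\<dots> \<le> exp (x\<^sup>2 / 4) * (u powr (- 1 / 2) * heat_kernel u z)"
    by (intro mult_mono e k) (auto simp: k0 heat_kernel_nonneg)
  finally show ?thesis by (simp add: z_def)
qed

lemma heat_kernel_weighted_energy:
  assumes t: "0 \<le> t" "t \<le> 1"
  shows "(\<integral>\<^sup>+p. ennreal (indicator {0..<t} (fst p) * ((heat_kernel (t - fst p) (x - snd p))\<^sup>2 * exp ((snd p)\<^sup>2 / 8))) \<partial>plane)
     \<le> ennreal (4 * exp (x\<^sup>2 / 4))"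
proof -
  have "(\<integral>\<^sup>+p. ennreal (indicator {0..<t} (fst p) * ((heat_kernel (t - fst p) (x - snd p))\<^sup>2 * exp ((snd p)\<^sup>2 / 8))) \<partial>plane)
     = (\<integral>\<^sup>+s. \<integral>\<^sup>+y. ennreal (indicator {0..<t} s * ((heat_kernel (t - s) (x - y))\<^sup>2 * exp (y\<^sup>2 / 8))) \<partial>lborel \<partial>lborel)"
    by (subst lborel.nn_integral_fst[symmetric]) auto
  also have "\<dots> \<le> (\<integral>\<^sup>+s. ennreal (exp (x\<^sup>2 / 4)) * ennreal (indicator {-1..1} (t - s) * \<bar>t - s\<bar> powr (- 1 / 2)) \<partial>lborel)"
  proof (rule nn_integral_mono)
    fix s
    show "(\<integral>\<^sup>+y. ennreal (indicator {0..<t} s * ((heat_kernel (t - s) (x - y))\<^sup>2 * exp (y\<^sup>2 / 8))) \<partial>lborel)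
      \<le> ennreal (exp (x\<^sup>2 / 4)) * ennreal (indicator {-1..1} (t - s) * \<bar>t - s\<bar> powr (- 1 / 2))"
    proof (cases "s \<in> {0..<t}")
      case True
      then have u: "0 < t - s" "t - s \<le> 1" using t by auto
      have "(\<integral>\<^sup>+y. ennreal (indicator {0..<t} s * ((heat_kernel (t - s) (x - y))\<^sup>2 * exp (y\<^sup>2 / 8))) \<partial>lborel)
        \<le> (\<integral>\<^sup>+y. ennreal (exp (x\<^sup>2 / 4) * (t - s) powr (- 1 / 2)) * ennreal (heat_kernel (t - s) (x - y)) \<partial>lborel)"
        using True heat_kernel_sq_weight[OF u, of x]
        by (intro nn_integral_mono) (simp add: ennreal_mult[symmetric] heat_kernel_nonneg ennreal_leI mult.assoc)
      also have "\<dots> = ennreal (exp (x\<^sup>2 / 4) * (t - s) powr (- 1 / 2)) * (\<integral>\<^sup>+y. ennreal (heat_kernel (t - s) (x - y)) \<partial>lborel)"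
        by (rule nn_integral_cmult) measurable
      also have "(\<integral>\<^sup>+y. ennreal (heat_kernel (t - s) (x - y)) \<partial>lborel) = 1"
        using heat_kernel_integral[OF u(1), of x] by (subst nn_integral_eq_integral) (auto simp: heat_kernel_nonneg)
      finally show ?thesis
        using u by (simp add: ennreal_mult[symmetric])
    qed simp
  qed
  also have "\<dots> = ennreal (exp (x\<^sup>2 / 4)) * (\<integral>\<^sup>+s. ennreal (indicator {-1..1} (t - s) * \<bar>t - s\<bar> powr (- 1 / 2)) \<partial>lborel)"
    by (rule nn_integral_cmult) measurable
  also have "\<dots> \<le> ennreal (exp (x\<^sup>2 / 4)) * ennreal 4"
  proof (rule mult_left_mono)
    have "(\<integral>\<^sup>+s. ennreal (indicator {-1..1} (t - s) * \<bar>t - s\<bar> powr (- 1 / 2)) \<partial>lborel)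
     = (\<integral>\<^sup>+u. ennreal (indicator {-1..1} u * \<bar>u\<bar> powr (- 1 / 2)) \<partial>lborel)"
    using nn_integral_real_affine[of "\<lambda>u. ennreal (indicator {-1..1} u * \<bar>u\<bar> powr (- 1 / 2))" "-1" t] by simp
    also have "\<dots> \<le> ennreal 4"
      using nn_integral_abs_powr[of "- 1 / 2" 1] by simp
    finally show "(\<integral>\<^sup>+s. ennreal (indicator {-1..1} (t - s) * \<bar>t - s\<bar> powr (- 1 / 2)) \<partial>lborel) \<le> ennreal 4" .
  qed simp
  also have "\<dots> = ennreal (4 * exp (x\<^sup>2 / 4))"
    by (subst mult.commute) (simp add: ennreal_mult)
  finally show ?thesis .
qed

text \<open>The integrand of the heat convolution as a function on the plane. Through it the iterated integrals of the
  definition become one absolutely convergent integral, which is linear in \<open>D\<close>.\<close>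

definition heat_integrand :: "(real \<times> real \<Rightarrow> complex) \<Rightarrow> real \<Rightarrow> real \<Rightarrow> real \<times> real \<Rightarrow> complex" where
  "heat_integrand D t x p = (indicator {0..t} (fst p) * heat_kernel (t - fst p) (x - snd p)) *\<^sub>R D p"

lemma heat_integrand_measurable:
  assumes D [measurable]: "D \<in> borel_measurable plane"
  shows "(\<lambda>xp. heat_integrand D t (fst xp) (snd xp)) \<in> borel_measurable (borel \<Otimes>\<^sub>M plane)"
    and "heat_integrand D t x \<in> borel_measurable plane"
  unfolding heat_integrand_def by measurable

text \<open>Cauchy--Schwarz, with the weight distributed over the two factors.\<close>

lemma heat_integrand_bound:
  assumes [measurable]: "D \<in> borel_measurable plane"
    and t: "0 \<le> t" "t \<le> 1"
  shows "(\<integral>\<^sup>+p. ennreal (cmod (heat_integrand D t x p)) \<partial>plane)\<^sup>2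
     \<le> ennreal (4 * exp (x\<^sup>2 / 4)) * weighted_energy D"
proof -
  let ?L = "plane"
  let ?f = "\<lambda>p. ennreal (indicator {0..<t} (fst p) * (heat_kernel (t - fst p) (x - snd p) * exp ((snd p)\<^sup>2 / 16)))"
  let ?g = "\<lambda>p. ennreal (indicator {0..<1} (fst p) * (exp (- ((snd p)\<^sup>2 / 16)) * cmod (D p)))"
  have split: "(\<integral>\<^sup>+p. ennreal (cmod (heat_integrand D t x p)) \<partial>?L) = (\<integral>\<^sup>+p. ?f p * ?g p \<partial>?L)"
  proof (rule nn_integral_cong)
    fix p :: "real \<times> real"
    have e: "exp ((snd p)\<^sup>2 / 16) * (exp (- ((snd p)\<^sup>2 / 16)) * c) = c" for c :: real
      by (simp only: mult.assoc[symmetric] exp_add[symmetric]) simp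
    show "ennreal (cmod (heat_integrand D t x p)) = ?f p * ?g p"
    proof (cases "fst p \<in> {0..<t}")
      case True
      then have "fst p \<in> {0..t}" "fst p \<in> {0..<1}" using t by auto
      then show ?thesis
        using True by (simp add: heat_integrand_def heat_kernel_nonneg ennreal_mult[symmetric] mult.assoc e)
    next
      case False
      \<comment> \<open>The endpoint \<open>fst p = t\<close> contributes nothing because the heat kernel is 0 at time 0.\<close>
      then have "indicator {0..t} (fst p) * heat_kernel (t - fst p) (x - snd p) = 0"
        by (auto simp: indicator_def heat_kernel_def)
      then show ?thesis using False by (simp add: heat_integrand_def)
    qed
  qed
  have CS: "(\<integral>\<^sup>+p. ?f p * ?g p \<partial>?L)\<^sup>2 \<le> (\<integral>\<^sup>+p. (?f p)\<^sup>2 \<partial>?L) * (\<integral>\<^sup>+p. (?g p)\<^sup>2 \<partial>?L)"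
    by (rule Cauchy_Schwarz_nn_integral) measurable
  have f2: "(\<integral>\<^sup>+p. (?f p)\<^sup>2 \<partial>?L) = (\<integral>\<^sup>+p. ennreal (indicator {0..<t} (fst p) * ((heat_kernel (t - fst p) (x - snd p))\<^sup>2 * exp ((snd p)\<^sup>2 / 8))) \<partial>?L)"
  proof (rule nn_integral_cong)
    fix p :: "real \<times> real"
    have "(exp ((snd p)\<^sup>2 / 16))\<^sup>2 = exp ((snd p)\<^sup>2 / 8)"
      unfolding exp_double[symmetric] by simp
    moreover have "(indicator {0..<t} (fst p) :: real)\<^sup>2 = indicator {0..<t} (fst p)"
      by (cases "fst p \<in> {0..<t}") simp_all
    ultimately show "(?f p)\<^sup>2 = ennreal (indicator {0..<t} (fst p) * ((heat_kernel (t - fst p) (x - snd p))\<^sup>2 * exp ((snd p)\<^sup>2 / 8)))"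
      by (subst ennreal_power) (simp_all only: power_mult_distrib mult_nonneg_nonneg heat_kernel_nonneg indicator_pos_le exp_ge_zero)
  qed
  have g2: "(\<integral>\<^sup>+p. (?g p)\<^sup>2 \<partial>?L) = weighted_energy D"
    unfolding weighted_energy_def
  proof (rule nn_integral_cong)
    fix p :: "real \<times> real"
    have "(exp (- ((snd p)\<^sup>2 / 16)))\<^sup>2 = exp (- ((snd p)\<^sup>2 / 8))"
      unfolding exp_double[symmetric] by simp
    moreover have "(indicator {0..<1::real} (fst p) :: real)\<^sup>2 = indicator {0..<1} (fst p)"
      by (cases "fst p \<in> {0..<1}") simp_all
    ultimately show "(?g p)\<^sup>2 = ennreal (indicator {0..<1} (fst p) * (exp (- ((snd p)\<^sup>2 / 8)) * (cmod (D p))\<^sup>2))"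
      by (subst ennreal_power) (simp_all only: power_mult_distrib mult_nonneg_nonneg indicator_pos_le exp_ge_zero norm_ge_zero)
  qed
  show ?thesis
    unfolding split
    by (rule order_trans[OF CS[unfolded f2 g2] mult_right_mono[OF heat_kernel_weighted_energy[OF t]]]) simp
qed

lemma heat_conv_eq_integral:
  assumes D [measurable]: "D \<in> borel_measurable plane"
    and t: "0 \<le> t" "t \<le> 1" and fin: "weighted_energy D < \<infinity>"
  shows "integrable plane (heat_integrand D t x)"
    and "heat_conv (\<lambda>s y. D (s, y)) t x = (\<integral>p. heat_integrand D t x p \<partial>plane)"
proof -
  have "(\<integral>\<^sup>+p. ennreal (cmod (heat_integrand D t x p)) \<partial>plane)\<^sup>2 < \<infinity>"
    by (rule le_less_trans[OF heat_integrand_bound[OF D t, of x]]) (use fin in \<open>simp add: ennreal_mult_less_top\<close>)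
  then have "(\<integral>\<^sup>+p. ennreal (cmod (heat_integrand D t x p)) \<partial>plane) < \<infinity>"
    by (simp add: power_less_top_ennreal)
  then show int: "integrable plane (heat_integrand D t x)"
    unfolding integrable_iff_bounded using heat_integrand_measurable(2)[OF D] by simp
  have "(\<integral>p. heat_integrand D t x p \<partial>plane) = (\<integral>s. \<integral>y. heat_integrand D t x (s, y) \<partial>lborel \<partial>lborel)"
    using lborel_pair.integral_fst'[OF int] by simp
  also have "\<dots> = (\<integral>s. indicator {0..t} s *\<^sub>R (LBINT y. heat_kernel (t - s) (x - y) *\<^sub>R D (s, y)) \<partial>lborel)"
    unfolding heat_integrand_def fst_conv snd_conv scaleR_scaleR[symmetric] integral_scaleR_right ..
  finally show "heat_conv (\<lambda>s y. D (s, y)) t x = (\<integral>p. heat_integrand D t x p \<partial>plane)"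
    by (simp add: heat_conv_def set_lebesgue_integral_def)
qed

lemma heat_integral_norm_le:
  assumes D [measurable]: "D \<in> borel_measurable plane"
    and t: "0 \<le> t" "t \<le> 1" and e: "weighted_energy D \<le> ennreal e" "0 \<le> e"
  shows "cmod (\<integral>p. heat_integrand D t x p \<partial>plane) \<le> 2 * exp (x\<^sup>2 / 8) * sqrt e"
proof -
  have fin: "weighted_energy D < \<infinity>" using e by (auto intro: le_less_trans)
  have int: "integrable plane (heat_integrand D t x)"
    by (rule heat_conv_eq_integral(1)[OF D t fin])
  define I where "I = (\<integral>p. cmod (heat_integrand D t x p) \<partial>plane)"
  have I0: "0 \<le> I" by (simp add: I_def)
  have "ennreal I = (\<integral>\<^sup>+p. ennreal (cmod (heat_integrand D t x p)) \<partial>plane)"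
    unfolding I_def by (rule nn_integral_eq_integral[symmetric]) (use int in auto)
  then have "(ennreal I)\<^sup>2 \<le> ennreal (4 * exp (x\<^sup>2 / 4)) * weighted_energy D"
    using heat_integrand_bound[OF D t, of x] by simp
  also have "\<dots> \<le> ennreal (4 * exp (x\<^sup>2 / 4)) * ennreal e"
    by (intro mult_left_mono e) simp
  also have "\<dots> = ennreal (4 * exp (x\<^sup>2 / 4) * e)"
    using e by (simp add: ennreal_mult)
  finally have "I\<^sup>2 \<le> 4 * exp (x\<^sup>2 / 4) * e"
    using I0 e by (simp add: ennreal_power)
  also have "\<dots> = (2 * exp (x\<^sup>2 / 8) * sqrt e)\<^sup>2"
  proof -
    have "(exp (x\<^sup>2 / 8))\<^sup>2 = exp (x\<^sup>2 / 4)"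
      unfolding exp_double[symmetric] by simp
    then show ?thesis using e by (simp add: power_mult_distrib)
  qed
  finally have "I \<le> 2 * exp (x\<^sup>2 / 8) * sqrt e"
    by (rule power2_le_imp_le) (use e in simp)
  moreover have "cmod (\<integral>p. heat_integrand D t x p \<partial>plane) \<le> I"
    unfolding I_def by (rule integral_norm_bound)
  ultimately show ?thesis by (rule order_trans[rotated])
qed

lemma weighted_energy_diff:
  assumes [measurable]: "V \<in> borel_measurable plane"
    "D \<in> borel_measurable plane"
  shows "weighted_energy (\<lambda>p. V p - D p) \<le> 2 * weighted_energy V + 2 * weighted_energy D"
proof -
  let ?w = "\<lambda>p :: real \<times> real. indicator {0..<1} (fst p) * exp (- ((snd p)\<^sup>2 / 8)) :: real"
  have "weighted_energy (\<lambda>p. V p - D p)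
    \<le> (\<integral>\<^sup>+p. 2 * ennreal (?w p * (cmod (V p))\<^sup>2) + 2 * ennreal (?w p * (cmod (D p))\<^sup>2) \<partial>plane)"
    unfolding weighted_energy_def
  proof (rule nn_integral_mono)
    fix p :: "real \<times> real"
    have "?w p * (cmod (V p - D p))\<^sup>2
        \<le> ?w p * (2 * (cmod (V p))\<^sup>2 + 2 * (cmod (D p))\<^sup>2)"
      using norm_add_sq_le[of "V p" "- D p"] by (intro mult_left_mono) auto
    then have "ennreal (?w p * (cmod (V p - D p))\<^sup>2)
        \<le> ennreal (2 * (?w p * (cmod (V p))\<^sup>2) + 2 * (?w p * (cmod (D p))\<^sup>2))"
      by (intro ennreal_leI) (simp add: algebra_simps)
    also have "\<dots> = 2 * ennreal (?w p * (cmod (V p))\<^sup>2) + 2 * ennreal (?w p * (cmod (D p))\<^sup>2)"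
      by (subst ennreal_plus) (auto simp: ennreal_mult'[of 2])
    finally show "ennreal (indicator {0..<1} (fst p) * (exp (- ((snd p)\<^sup>2 / 8)) * (cmod (V p - D p))\<^sup>2))
       \<le> 2 * ennreal (?w p * (cmod (V p))\<^sup>2) + 2 * ennreal (?w p * (cmod (D p))\<^sup>2)"
      by (simp only: mult.assoc)
  qed
  also have "\<dots> = 2 * weighted_energy V + 2 * weighted_energy D"
    unfolding weighted_energy_def by (subst nn_integral_add) (auto simp: nn_integral_cmult mult.assoc)
  finally show ?thesis .
qed

text \<open>On \<open>[-r, r]\<close> the product is bounded by a constant times \<open>sqrt e\<close>, and it vanishes elsewhere; hence its
  \<open>L\<^sup>1\<close> and \<open>L\<^sup>\<infinity>\<close> norms are both of this order.\<close>

lemma sobolev_heat_conv_diff: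
  assumes V [measurable]: "V \<in> borel_measurable plane"
    and D [measurable]: "D \<in> borel_measurable plane"
    and fin: "weighted_energy V < \<infinity>"
    and e: "weighted_energy (\<lambda>p. V p - D p) \<le> ennreal e" "0 \<le> e"
    and t: "0 \<le> t" "t \<le> 1" and \<alpha>: "\<alpha> > 0"
    and \<rho> [measurable]: "\<rho> \<in> borel_measurable borel"
    and A: "\<And>x. \<bar>\<rho> x\<bar> \<le> A" and r: "\<And>x. \<bar>x\<bar> > r \<Longrightarrow> \<rho> x = 0" "0 \<le> r"
  shows "sobolev_norm_fun (- \<alpha>) (\<lambda>x. of_real (\<rho> x) * (heat_conv (\<lambda>s y. V (s, y)) t x - heat_conv (\<lambda>s y. D (s, y)) t x))
     \<le> ennreal (A * (2 * exp (r\<^sup>2 / 8)) * sqrt (2 * r) * sqrt e)"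
proof -
  let ?L = "plane"
  let ?E = "\<lambda>p. V p - D p"
  have E [measurable]: "?E \<in> borel_measurable ?L" by measurable
  have A0: "0 \<le> A" using A[of 0] by (rule order_trans[OF abs_ge_zero])
  have finE: "weighted_energy ?E < \<infinity>" using e by (auto intro: le_less_trans)
  have finD: "weighted_energy D < \<infinity>"
  proof -
    have "weighted_energy (\<lambda>p. V p - ?E p) \<le> 2 * weighted_energy V + 2 * weighted_energy ?E"
      by (rule weighted_energy_diff) measurable
    also have "\<dots> < \<infinity>" using fin finE by (simp add: ennreal_mult_less_top)
    finally show ?thesis by simp
  qed
  have diff: "heat_conv (\<lambda>s y. V (s, y)) t x - heat_conv (\<lambda>s y. D (s, y)) t x = (\<integral>p. heat_integrand ?E t x p \<partial>?L)" for x
  proof -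
    note iV = heat_conv_eq_integral[OF V t fin, of x] and iD = heat_conv_eq_integral[OF D t finD, of x]
    have "heat_conv (\<lambda>s y. V (s, y)) t x - heat_conv (\<lambda>s y. D (s, y)) t x = (\<integral>p. heat_integrand V t x p - heat_integrand D t x p \<partial>?L)"
      unfolding iV(2) iD(2) by (rule Bochner_Integration.integral_diff[symmetric, OF iV(1) iD(1)])
    then show ?thesis
      by (simp add: heat_integrand_def scaleR_diff_right)
  qed
  define f where "f x = of_real (\<rho> x) * (\<integral>p. heat_integrand ?E t x p \<partial>?L)" for x
  have [measurable]: "f \<in> borel_measurable borel"
  proof -
    have "(\<lambda>x. \<integral>p. heat_integrand ?E t x p \<partial>?L) \<in> borel_measurable borel"
      using lborel_prod by (intro sigma_finite_measure.borel_measurable_lebesgue_integral)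
        (use heat_integrand_measurable(1)[OF E, of t] lborel.sigma_finite_measure_axioms in \<open>auto simp: case_prod_unfold lborel_prod\<close>)
    then show ?thesis unfolding f_def by measurable
  qed
  define B where "B = A * (2 * exp (r\<^sup>2 / 8) * sqrt e)"
  have B0: "0 \<le> B" using A0 e by (simp add: B_def)
  have fB: "cmod (f x) \<le> B * indicator {-r..r} x" for x
  proof (cases "\<bar>x\<bar> \<le> r")
    case True
    have "x\<^sup>2 \<le> r\<^sup>2" using True r(2) by (simp add: abs_le_square_iff[symmetric])
    have "cmod (f x) \<le> A * (2 * exp (x\<^sup>2 / 8) * sqrt e)"
      unfolding f_def norm_mult using A[of x] A0
      by (intro mult_mono heat_integral_norm_le[OF E t e]) auto
    also have "\<dots> \<le> B"
      unfolding B_def using \<open>x\<^sup>2 \<le> r\<^sup>2\<close> A0 e by (intro mult_left_mono mult_right_mono) auto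
    finally show ?thesis using True by (simp add: indicator_def abs_le_iff)
  next
    case False
    then show ?thesis using r(1)[of x] B0 by (simp add: f_def)
  qed
  have ind: "integrable lborel (\<lambda>x. B * indicator {-r..r} x)" "(LBINT x. B * indicator {-r..r} x) = B * (2 * r)"
    using r(2) by auto
  have f_int: "integrable lborel f"
    by (rule Bochner_Integration.integrable_bound[OF ind(1)]) (use fB B0 in \<open>auto simp: abs_mult\<close>)
  have fB': "cmod (f x) \<le> B" for x
    by (rule order_trans[OF fB]) (use B0 in \<open>auto simp: indicator_def\<close>)
  have "sobolev_norm_fun (- \<alpha>) f \<le> ennreal (sqrt (B * (LBINT x. cmod (f x))))"
    by (rule sobolev_norm_fun_neg_le[OF \<alpha> f_int fB'])
  also have "\<dots> \<le> ennreal (sqrt (B * (B * (2 * r))))"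
  proof (intro ennreal_leI real_sqrt_le_mono mult_left_mono B0)
    show "(LBINT x. cmod (f x)) \<le> B * (2 * r)"
      unfolding ind(2)[symmetric] by (intro integral_mono integrable_norm f_int ind(1) fB)
  qed
  also have "sqrt (B * (B * (2 * r))) = A * (2 * exp (r\<^sup>2 / 8)) * sqrt (2 * r) * sqrt e"
  proof -
    have "sqrt (B * (B * (2 * r))) = B * sqrt (2 * r)"
    proof -
      have "B * (B * (2 * r)) = B\<^sup>2 * (2 * r)" by (simp add: power2_eq_square)
      then show ?thesis by (simp only: real_sqrt_mult[of "B\<^sup>2"] real_sqrt_abs abs_of_nonneg[OF B0])
    qed
    then show ?thesis by (simp only: B_def mult_ac)
  qed
  finally show ?thesis
    unfolding diff f_def .
qed

text \<open>Tonelli's theorem; the constant comes from \<open>1 + y\<^sup>2 \<le> 16 exp (y\<^sup>2 / 16)\<close> and a Gaussian integral.\<close>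

lemma weighted_energy_expectation:
  assumes M: "sigma_finite_measure M"
    and F [measurable]: "F \<in> borel_measurable (M \<Otimes>\<^sub>M plane)"
    and le: "\<And>s y. 0 \<le> s \<Longrightarrow> s < 1 \<Longrightarrow> L2_sq M (\<lambda>\<omega>. F (\<omega>, s, y)) \<le> ennreal (G * (1 + y\<^sup>2))"
    and G: "G \<ge> 0"
  shows "(\<integral>\<^sup>+\<omega>. weighted_energy (\<lambda>p. F (\<omega>, p)) \<partial>M) \<le> ennreal (64 * sqrt pi * G)"
    and "(\<lambda>\<omega>. weighted_energy (\<lambda>p. F (\<omega>, p))) \<in> borel_measurable M"
proof -
  let ?L = "plane"
  have L: "sigma_finite_measure ?L"
    unfolding lborel_prod by (rule lborel.sigma_finite_measure_axioms)
  interpret L: sigma_finite_measure ?L by (rule L)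
  interpret P: pair_sigma_finite M ?L by (intro pair_sigma_finite.intro M L)
  let ?h = "\<lambda>q. ennreal (indicator {0..<1} (fst (snd q)) * (exp (- ((snd (snd q))\<^sup>2 / 8)) * (cmod (F q))\<^sup>2))"
  have h [measurable]: "?h \<in> borel_measurable (M \<Otimes>\<^sub>M ?L)"
    by measurable
  show "(\<lambda>\<omega>. weighted_energy (\<lambda>p. F (\<omega>, p))) \<in> borel_measurable M"
    unfolding weighted_energy_def by measurable
  have "(\<integral>\<^sup>+\<omega>. weighted_energy (\<lambda>p. F (\<omega>, p)) \<partial>M) = (\<integral>\<^sup>+\<omega>. \<integral>\<^sup>+p. ?h (\<omega>, p) \<partial>?L \<partial>M)"
    by (simp add: weighted_energy_def)
  also have "\<dots> = (\<integral>\<^sup>+p. \<integral>\<^sup>+\<omega>. ?h (\<omega>, p) \<partial>M \<partial>?L)"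
    by (rule P.Fubini[OF h, symmetric])
  also have "\<dots> \<le> (\<integral>\<^sup>+p. ennreal (indicator {0..<1} (fst p)) * ennreal (16 * G * exp (- (1 / 16 * (snd p)\<^sup>2))) \<partial>?L)"
  proof (rule nn_integral_mono)
    fix p :: "real \<times> real"
    show "(\<integral>\<^sup>+\<omega>. ?h (\<omega>, p) \<partial>M) \<le> ennreal (indicator {0..<1} (fst p)) * ennreal (16 * G * exp (- (1 / 16 * (snd p)\<^sup>2)))"
    proof (cases "fst p \<in> {0..<1}")
      case True
      define y where "y = snd p"
      have p: "(fst p, y) = p" by (simp add: y_def)
      have [measurable]: "(\<lambda>\<omega>. F (\<omega>, p)) \<in> borel_measurable M"
        by (rule measurable_compose[OF measurable_Pair2' F]) (simp add: space_pair_measure)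
      have "(\<integral>\<^sup>+\<omega>. ?h (\<omega>, p) \<partial>M) = ennreal (exp (- (y\<^sup>2 / 8))) * L2_sq M (\<lambda>\<omega>. F (\<omega>, p))"
        using True unfolding L2_sq_def y_def by (simp add: ennreal_mult nn_integral_cmult)
      also have "\<dots> \<le> ennreal (exp (- (y\<^sup>2 / 8))) * ennreal (G * (1 + y\<^sup>2))"
        using True le[of "fst p" y] unfolding p by (intro mult_left_mono) auto
      also have "\<dots> = ennreal (exp (- (y\<^sup>2 / 8)) * (G * (1 + y\<^sup>2)))"
        using G by (simp add: ennreal_mult)
      also have "\<dots> \<le> ennreal (16 * G * exp (- (1 / 16 * y\<^sup>2)))"
      proof (rule ennreal_leI)
        have "1 + y\<^sup>2 \<le> 16 * (1 + y\<^sup>2 / 16)" by simp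
        also have "\<dots> \<le> 16 * exp (y\<^sup>2 / 16)"
          by (rule mult_left_mono[OF exp_ge_add_one_self]) simp
        finally have "exp (- (y\<^sup>2 / 8)) * (G * (1 + y\<^sup>2)) \<le> exp (- (y\<^sup>2 / 8)) * (G * (16 * exp (y\<^sup>2 / 16)))"
          using G by (intro mult_left_mono) auto
        also have "\<dots> = 16 * G * (exp (- (y\<^sup>2 / 8)) * exp (y\<^sup>2 / 16))" by simp
        also have "exp (- (y\<^sup>2 / 8)) * exp (y\<^sup>2 / 16) = exp (- (1 / 16 * y\<^sup>2))"
          by (simp flip: exp_add)
        finally show "exp (- (y\<^sup>2 / 8)) * (G * (1 + y\<^sup>2)) \<le> 16 * G * exp (- (1 / 16 * y\<^sup>2))" .
      qed
      finally show ?thesis using True by (simp add: y_def)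
    qed simp
  qed
  also have "\<dots> = (\<integral>\<^sup>+s. \<integral>\<^sup>+y. ennreal (indicator {0..<1::real} s) * ennreal (16 * G * exp (- (1 / 16 * y\<^sup>2))) \<partial>lborel \<partial>lborel)"
    by (subst lborel.nn_integral_fst[symmetric]) auto
  also have "\<dots> = (\<integral>\<^sup>+s. ennreal (indicator {0..<1::real} s) \<partial>lborel) * (\<integral>\<^sup>+y. ennreal (16 * G * exp (- (1 / 16 * y\<^sup>2))) \<partial>lborel)"
    by (simp add: nn_integral_cmult nn_integral_multc)
  also have "(\<integral>\<^sup>+s. ennreal (indicator {0..<1::real} s) \<partial>lborel) = 1"
    by (simp add: ennreal_indicator)
  also have "(\<integral>\<^sup>+y. ennreal (16 * G * exp (- (1 / 16 * y\<^sup>2))) \<partial>lborel) = ennreal (16 * G * (2 * pi * heat_kernel (1 / 16) 0))"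
  proof -
    have "integrable lborel (\<lambda>y::real. exp (- (1 / 16 * y\<^sup>2)))" by (rule gaussian_fourier(1)) simp
    moreover have "(LBINT y. exp (- (1 / 16 * (y::real)\<^sup>2))) = 2 * pi * heat_kernel (1 / 16) 0"
    proof -
      have "complex_of_real (LBINT y. exp (- (1 / 16 * (y::real)\<^sup>2))) = of_real (2 * pi * heat_kernel (1 / 16) 0)"
        using gaussian_fourier(2)[of "1 / 16" 0] by (simp only: integral_complex_of_real mult_zero_right of_real_0 exp_zero mult_1)
      then show ?thesis by (simp only: of_real_eq_iff)
    qed
    ultimately show ?thesis
      using G by (subst nn_integral_eq_integral) auto
  qed
  also have "2 * pi * heat_kernel (1 / 16) 0 = 4 * sqrt pi"
    using real_sqrt_mult_self[of pi] by (simp add: heat_kernel_def real_sqrt_divide field_simps)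
  finally show "(\<integral>\<^sup>+\<omega>. weighted_energy (\<lambda>p. F (\<omega>, p)) \<partial>M) \<le> ennreal (64 * sqrt pi * G)"
    by (simp add: mult_ac)
qed

section \<open>Summing over the approximation levels\<close>

lemma discrete_noise_measurable:
  assumes [measurable]: "\<And>t x. (\<lambda>q. b q t x) \<in> borel_measurable M"
    "s \<in> borel_measurable M" "y \<in> borel_measurable M"
  shows "(\<lambda>q. discrete_noise n (b q) (s q) (y q)) \<in> borel_measurable M"
  unfolding discrete_noise_def rect_increment_def by measurable

lemma AE_bounded_if_summable_expectation:
  fixes X :: "nat \<Rightarrow> 'a \<Rightarrow> ennreal"
  assumes [measurable]: "\<And>n. X n \<in> borel_measurable M"
    and le: "\<And>n. (\<integral>\<^sup>+\<omega>. X n \<omega> \<partial>M) \<le> ennreal (K * q ^ n)" and q: "0 \<le> q" "q < 1" and K: "0 \<le> K"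
  shows "AE \<omega> in M. \<exists>r\<ge>0. \<forall>n. X n \<omega> \<le> ennreal r"
proof -
  have "(\<integral>\<^sup>+\<omega>. (\<Sum>n. X n \<omega>) \<partial>M) = (\<Sum>n. \<integral>\<^sup>+\<omega>. X n \<omega> \<partial>M)"
    by (rule nn_integral_suminf) measurable
  also have "\<dots> \<le> (\<Sum>n. ennreal (K * q ^ n))"
    by (intro suminf_le le summableI)
  also have "\<dots> = ennreal (\<Sum>n. K * q ^ n)"
    using q K by (intro suminf_ennreal2 summable_mult summable_geometric) auto
  also have "\<dots> < \<infinity>" by simp
  finally have "AE \<omega> in M. (\<Sum>n. X n \<omega>) \<noteq> \<infinity>"
    by (intro nn_integral_noteq_infinite) auto
  then show ?thesis
  proof eventually_elim
    case (elim \<omega>)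
    then obtain r where r: "(\<Sum>n. X n \<omega>) = ennreal r" "r \<ge> 0"
      by (cases "\<Sum>n. X n \<omega>") auto
    have "X n \<omega> \<le> ennreal r" for n
      using sum_le_suminf[of "\<lambda>n. X n \<omega>" "{n}"] unfolding r(1) by simp
    with r(2) show ?case by blast
  qed
qed

lemma cutoff_bounds:
  fixes \<rho> :: "real \<Rightarrow> real"
  assumes "smooth \<rho>" "compact (closure {x. \<rho> x \<noteq> 0})"
  obtains A r where "\<rho> \<in> borel_measurable borel" "\<And>x. \<bar>\<rho> x\<bar> \<le> A" "r \<ge> 0" "\<And>x. \<bar>x\<bar> > r \<Longrightarrow> \<rho> x = 0"
proof -
  have "iter_deriv 0 \<rho> differentiable (at x)" for x
    using assms(1) unfolding smooth_def by blast
  then have "isCont \<rho> x" for x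
    unfolding iter_deriv_0 by (rule differentiable_imp_continuous_within)
  then have cont: "continuous_on UNIV \<rho>"
    by (rule continuous_at_imp_continuous_on[OF ballI])
  have "bounded (closure {x. \<rho> x \<noteq> 0})"
    by (rule compact_imp_bounded[OF assms(2)])
  then obtain r0 where r0: "\<forall>x\<in>closure {x. \<rho> x \<noteq> 0}. norm x \<le> r0"
    unfolding bounded_iff by (rule exE)
  define r where "r = max r0 0"
  have zero: "\<rho> x = 0" if "\<bar>x\<bar> > r" for x
  proof (rule ccontr)
    assume "\<rho> x \<noteq> 0"
    then have "x \<in> {x. \<rho> x \<noteq> 0}" by simp
    then have "x \<in> closure {x. \<rho> x \<noteq> 0}" by (rule subsetD[OF closure_subset])
    from bspec[OF r0 this] that show False by (simp add: r_def)
  qed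
  have "compact (\<rho> ` {-r..r})"
    by (intro compact_continuous_image continuous_on_subset[OF cont]) auto
  from compact_imp_bounded[OF this] obtain A where "\<forall>y\<in>\<rho> ` {-r..r}. norm y \<le> A"
    unfolding bounded_iff by (rule exE)
  then have A: "\<bar>\<rho> x\<bar> \<le> A" if "x \<in> {-r..r}" for x
    using that by simp
  have "0 \<le> A" using A[of 0] by (simp add: r_def)
  then have "\<bar>\<rho> x\<bar> \<le> A" for x
    using A[of x] zero[of x] by (cases "\<bar>x\<bar> \<le> r") (auto simp: abs_le_iff)
  then show thesis
    using that[of A r] zero cont by (auto simp: r_def borel_measurable_continuous_onI)
qed

text \<open>Collecting powers of 2. The exponent \<open>\<kappa> (10 - 4 H0 - 2 H1)\<close> is \<open>2\<kappa> (4 + \<alpha>0)\<close> for \<open>\<alpha>0 = 1 - (2 H0 + H1)\<close>.\<close>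

lemma noise_error_rate:
  fixes n :: nat and c \<kappa> \<sigma> H0 H1 :: real
  assumes H: "H0 < 1" "H1 < 1"
  shows "2 powr (2 * \<sigma> * n) * ((2 * 2 powr (2 * \<kappa> * n) / 2 ^ n)\<^sup>2 * symbol_energy c H0 H1 (2 powr (2 * \<kappa> * n)) (2 powr (\<kappa> * n)))
     = (16 * c\<^sup>2 / ((2 - 2 * H0) * (2 - 2 * H1))) * (2 powr (- (2 - \<kappa> * (10 - 4 * H0 - 2 * H1) - 2 * \<sigma>))) ^ n"
proof -
  have two: "(2::real) ^ n = 2 powr n" by (simp add: powr_realpow)
  have sq: "(2 * 2 powr (2 * \<kappa> * n) / 2 ^ n)\<^sup>2 = 4 * 2 powr (4 * \<kappa> * n - 2 * n)"
  proof -
    have "(2 * 2 powr (2 * \<kappa> * n) / 2 ^ n)\<^sup>2 = 4 * (2 powr (2 * \<kappa> * n - n))\<^sup>2"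
      unfolding two by (simp add: powr_diff power_mult_distrib power_divide)
    also have "(2 powr (2 * \<kappa> * n - n))\<^sup>2 = 2 powr (4 * \<kappa> * n - 2 * n)"
      unfolding power2_eq_square powr_add[symmetric] by (rule arg_cong[where f = "(powr) 2"]) simp
    finally show ?thesis .
  qed
  have e: "symbol_energy c H0 H1 (2 powr (2 * \<kappa> * n)) (2 powr (\<kappa> * n))
    = (4 * c\<^sup>2 / ((2 - 2 * H0) * (2 - 2 * H1))) * 2 powr (2 * \<kappa> * n * (2 - 2 * H0) + \<kappa> * n * (2 - 2 * H1))"
    by (simp add: symbol_energy_def powr_powr powr_add)
  have "2 powr (2 * \<sigma> * n) * (4 * 2 powr (4 * \<kappa> * n - 2 * n) * ((4 * c\<^sup>2 / ((2 - 2 * H0) * (2 - 2 * H1))) * 2 powr (2 * \<kappa> * n * (2 - 2 * H0) + \<kappa> * n * (2 - 2 * H1))))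
    = (16 * c\<^sup>2 / ((2 - 2 * H0) * (2 - 2 * H1))) * (2 powr (2 * \<sigma> * n) * 2 powr (4 * \<kappa> * n - 2 * n) * 2 powr (2 * \<kappa> * n * (2 - 2 * H0) + \<kappa> * n * (2 - 2 * H1)))"
    by simp
  also have "2 powr (2 * \<sigma> * n) * 2 powr (4 * \<kappa> * n - 2 * n) * 2 powr (2 * \<kappa> * n * (2 - 2 * H0) + \<kappa> * n * (2 - 2 * H1))
    = 2 powr (- (2 - \<kappa> * (10 - 4 * H0 - 2 * H1) - 2 * \<sigma>) * n)"
    unfolding powr_add[symmetric] by (rule arg_cong[where f = "(powr) 2"]) (simp add: algebra_simps)
  also have "\<dots> = (2 powr (- (2 - \<kappa> * (10 - 4 * H0 - 2 * H1) - 2 * \<sigma>))) ^ n"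
    unfolding powr_powr[symmetric] by (rule powr_realpow) simp
  finally show ?thesis
    unfolding sq e .
qed

theorem proposition3p1:
  fixes M :: "'w measure"
    and W :: "(real \<times> real) set \<Rightarrow> 'w \<Rightarrow> complex"
    and B :: "nat \<Rightarrow> real \<Rightarrow> real \<Rightarrow> 'w \<Rightarrow> complex"
    and H0 H1 \<alpha>0 \<alpha> \<kappa> \<sigma> :: real
    and \<rho> :: "real \<Rightarrow> real"
  assumes "prob_space M"
    and "fourier_white_noise M W"
    and "0 < H0" "H0 < 1" "0 < H1" "H1 < 1"
    and "2 * H0 + H1 < 1"
    and "\<alpha>0 = 1 - (2 * H0 + H1)"
    and "\<alpha> > \<alpha>0"
    and "0 < \<kappa>" "\<kappa> \<le> \<alpha>0 / 5"
    and "0 < \<sigma>" "\<sigma> \<le> min (1 - 5 * \<kappa>) (\<alpha>0 - 4 * \<kappa>)"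
    and "smooth \<rho>" "compact (closure {x. \<rho> x \<noteq> 0})"
    and "\<And>n. n \<ge> 1 \<Longrightarrow> approx_field M W H0 H1 \<kappa> n (B n)"
  shows "AE \<omega> in M. \<exists>C::real. \<forall>n\<ge>1.
           (SUP t\<in>{0..1}. sobolev_norm_fun (- \<alpha>)
              (\<lambda>x. of_real (\<rho> x) *
                 (lin_sol (\<lambda>t x. B n t x \<omega>) t x - lin_sol_discrete n (\<lambda>t x. B n t x \<omega>) t x)))
           \<le> ennreal (C * 2 powr (- \<sigma> * n))"
proof -
  interpret prob_space M by fact
  note prob = \<open>prob_space M\<close> and noise = \<open>fourier_white_noise M W\<close>
  note B = \<open>\<And>n. n \<ge> 1 \<Longrightarrow> approx_field M W H0 H1 \<kappa> n (B n)\<close>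
  have \<alpha>: "\<alpha> > 0" using assms(7-9) by simp
  obtain A r where \<rho>: "\<rho> \<in> borel_measurable borel" "\<And>x. \<bar>\<rho> x\<bar> \<le> A" "r \<ge> 0" "\<And>x. \<bar>x\<bar> > r \<Longrightarrow> \<rho> x = 0"
    using cutoff_bounds[OF assms(14,15)] by blast
  let ?L = "plane"
  define E where "E n = symbol_energy (hconst H0 * hconst H1) H0 H1 (2 powr (2 * \<kappa> * n)) (2 powr (\<kappa> * n))" for n :: nat
  define G where "G n = 8 * ((2 * 2 powr (2 * \<kappa> * n) / 2 ^ n)\<^sup>2 * E n)" for n :: nat
  have E0: "0 \<le> E n" for n unfolding E_def by (rule symbol_energy_nonneg) fact+
  then have G0: "0 \<le> G n" for n by (simp add: G_def)
  define Good where "Good n a \<longleftrightarrow> (\<forall>j k. (\<lambda>\<omega>. a \<omega> j k) \<in> borel_measurable M) \<and>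
      (AE \<omega> in M. mixed_deriv (\<lambda>t x. B n t x \<omega>) = double_egf (a \<omega>)) \<and>
      (\<forall>s y. L2_sq M (\<lambda>\<omega>. double_egf (a \<omega>) s y) \<le> ennreal (8 * E n)) \<and>
      (\<forall>s y. 0 \<le> s \<longrightarrow> s < 1 \<longrightarrow>
         L2_sq M (\<lambda>\<omega>. double_egf (a \<omega>) s y - discrete_noise n (\<lambda>t x. B n t x \<omega>) s y) \<le> ennreal (G n * (1 + y\<^sup>2)))"
    for n a
  have "\<exists>a. Good (Suc n) a" for n
  proof -
    have Bn: "approx_field M W H0 H1 \<kappa> (Suc n) (B (Suc n))" by (rule B) simp
    have cm: "8 * (x * (1 + z) * e) = 8 * (x * e) * (1 + z)" for x z e :: real by simp
    show ?thesis
    proof (rule approx_field_noise_error[OF prob noise \<open>H0 < 1\<close> \<open>H1 < 1\<close> \<open>0 < \<kappa>\<close> Bn, folded E_def, unfolded cm, folded G_def])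
      fix a
      assume "\<And>j k. (\<lambda>\<omega>. a \<omega> j k) \<in> borel_measurable M"
        "AE \<omega> in M. mixed_deriv (\<lambda>t x. B (Suc n) t x \<omega>) = double_egf (a \<omega>)"
        "\<And>s y. L2_sq M (\<lambda>\<omega>. double_egf (a \<omega>) s y) \<le> ennreal (8 * E (Suc n))"
        "\<And>s y. 0 \<le> s \<Longrightarrow> s < 1 \<Longrightarrow>
           L2_sq M (\<lambda>\<omega>. double_egf (a \<omega>) s y - discrete_noise (Suc n) (\<lambda>t x. B (Suc n) t x \<omega>) s y)
             \<le> ennreal (G (Suc n) * (1 + y\<^sup>2))"
      then have G: "Good (Suc n) a" unfolding Good_def by (intro conjI allI impI)
      show "\<exists>a. Good (Suc n) a" by (rule exI[where x = a], rule G)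
    qed
  qed
  then have ex: "\<exists>a. Good n a" if "n \<ge> 1" for n
    using that by (cases n) auto
  define a where "a n = (SOME a. Good n a)" for n
  have Good: "Good n (a n)" if "n \<ge> 1" for n
    unfolding a_def by (rule someI_ex[OF ex[OF that]])
  define V where "V n \<omega> p = double_egf (a n \<omega>) (fst p) (snd p)" for n \<omega> p
  define N where "N n \<omega> p = discrete_noise n (\<lambda>t x. B n t x \<omega>) (fst p) (snd p)" for n \<omega> p
  have a_meas: "(\<lambda>\<omega>. a n \<omega> j k) \<in> borel_measurable M" if "n \<ge> 1" for n j k
    using Good[OF that] by (simp add: Good_def)
  have B_meas: "B n t x \<in> borel_measurable M" if "n \<ge> 1" for n t x
    using B[OF that] noise_integral_measurable(2) unfolding approx_field_def by blast
  have V_joint: "(\<lambda>q. V n (fst q) (snd q)) \<in> borel_measurable (M \<Otimes>\<^sub>M ?L)" if n: "n \<ge> 1" for n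
    unfolding V_def
  proof (rule double_egf_measurable)
    show "(\<lambda>q. a n (fst q) j k) \<in> borel_measurable (M \<Otimes>\<^sub>M ?L)" for j k
      by (rule measurable_compose[OF measurable_fst a_meas[OF n]])
  qed measurable
  have N_joint: "(\<lambda>q. N n (fst q) (snd q)) \<in> borel_measurable (M \<Otimes>\<^sub>M ?L)" if n: "n \<ge> 1" for n
    unfolding N_def
  proof (rule discrete_noise_measurable)
    show "(\<lambda>q. B n t x (fst q)) \<in> borel_measurable (M \<Otimes>\<^sub>M ?L)" for t x
      by (rule measurable_compose[OF measurable_fst B_meas[OF n]])
  qed measurable
  have V_sec: "V n \<omega> \<in> borel_measurable ?L" for n \<omega>
    unfolding V_def by (rule double_egf_measurable) measurable
  have N_sec: "N n \<omega> \<in> borel_measurable ?L" for n \<omega>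
    unfolding N_def by (rule discrete_noise_measurable) measurable
  have sf: "sigma_finite_measure M" by unfold_locales

  define I where "I n \<omega> = weighted_energy (\<lambda>p. V n \<omega> p - N n \<omega> p)" for n \<omega>
  have I: "(\<integral>\<^sup>+\<omega>. I n \<omega> \<partial>M) \<le> ennreal (64 * sqrt pi * G n)" "I n \<in> borel_measurable M" if n: "n \<ge> 1" for n
  proof -
    have m: "(\<lambda>q. V n (fst q) (snd q) - N n (fst q) (snd q)) \<in> borel_measurable (M \<Otimes>\<^sub>M ?L)"
      by (intro borel_measurable_diff V_joint N_joint n)
    have "L2_sq M (\<lambda>\<omega>. V n \<omega> (s, y) - N n \<omega> (s, y)) \<le> ennreal (G n * (1 + y\<^sup>2))" if "0 \<le> s" "s < 1" for s y
      using Good[OF n] that by (simp add: Good_def V_def N_def)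
    with weighted_energy_expectation[OF sf m _ G0]
    show "(\<integral>\<^sup>+\<omega>. I n \<omega> \<partial>M) \<le> ennreal (64 * sqrt pi * G n)" "I n \<in> borel_measurable M"
      unfolding I_def by simp_all
  qed
  have V_fin: "AE \<omega> in M. weighted_energy (V n \<omega>) < \<infinity>" if n: "n \<ge> 1" for n
  proof -
    have "L2_sq M (\<lambda>\<omega>. V n \<omega> (s, y)) \<le> ennreal (8 * E n * (1 + y\<^sup>2))" for s y
    proof -
      have "L2_sq M (\<lambda>\<omega>. V n \<omega> (s, y)) \<le> ennreal (8 * E n)"
        using Good[OF n] by (simp add: Good_def V_def)
      also have "\<dots> \<le> ennreal (8 * E n * (1 + y\<^sup>2))"
        using mult_left_mono[of 1 "1 + y\<^sup>2" "8 * E n"] E0[of n] by (intro ennreal_leI) simp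
      finally show ?thesis .
    qed
    with weighted_energy_expectation[OF sf V_joint[OF n], of "8 * E n"] E0[of n]
    have "(\<integral>\<^sup>+\<omega>. weighted_energy (V n \<omega>) \<partial>M) \<le> ennreal (64 * sqrt pi * (8 * E n))"
      and m: "(\<lambda>\<omega>. weighted_energy (V n \<omega>)) \<in> borel_measurable M"
      by simp_all
    then have "(\<integral>\<^sup>+\<omega>. weighted_energy (V n \<omega>) \<partial>M) \<noteq> \<infinity>"
      by (auto simp: top_unique)
    from nn_integral_PInf_AE[OF m this] show ?thesis
      by eventually_elim (simp add: less_top)
  qed

  \<comment> \<open>The remaining decay after multiplication by \<open>2 powr (2\<sigma>n)\<close>.\<close>
  define \<theta> where "\<theta> = 2 - \<kappa> * (10 - 4 * H0 - 2 * H1) - 2 * \<sigma>"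
  have \<theta>: "\<theta> > 0"
  proof -
    have "\<sigma> \<le> 1 - 5 * \<kappa>" using assms(13) by simp
    moreover have "0 < \<kappa> * (4 * H0 + 2 * H1)" using assms(3,5,10) by (intro mult_pos_pos) auto
    ultimately show ?thesis by (simp add: \<theta>_def algebra_simps)
  qed
  define K where "K = 64 * sqrt pi * 8 * (16 * (hconst H0 * hconst H1)\<^sup>2 / ((2 - 2 * H0) * (2 - 2 * H1)))"
  have K0: "0 \<le> K" unfolding K_def using assms(4,6) by (intro mult_nonneg_nonneg divide_nonneg_nonneg) auto
  have rate: "2 powr (2 * \<sigma> * n) * (64 * sqrt pi * G n) = K * (2 powr (- \<theta>)) ^ n" for n :: nat
    using noise_error_rate[OF assms(4,6), of \<sigma> n \<kappa> "hconst H0 * hconst H1"]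
    unfolding G_def E_def K_def \<theta>_def by (simp only: mult_ac)
  have bounded: "AE \<omega> in M. \<exists>e\<ge>0. \<forall>n. ennreal (2 powr (2 * \<sigma> * Suc n)) * I (Suc n) \<omega> \<le> ennreal e"
  proof (rule AE_bounded_if_summable_expectation)
    show m: "(\<lambda>\<omega>. ennreal (2 powr (2 * \<sigma> * Suc n)) * I (Suc n) \<omega>) \<in> borel_measurable M" for n
      using I(2)[of "Suc n"] by simp
    show "(\<integral>\<^sup>+\<omega>. ennreal (2 powr (2 * \<sigma> * Suc n)) * I (Suc n) \<omega> \<partial>M) \<le> ennreal (K * 2 powr (- \<theta>) * (2 powr (- \<theta>)) ^ n)" for n
    proof -
      have "(\<integral>\<^sup>+\<omega>. ennreal (2 powr (2 * \<sigma> * Suc n)) * I (Suc n) \<omega> \<partial>M)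
         = ennreal (2 powr (2 * \<sigma> * Suc n)) * (\<integral>\<^sup>+\<omega>. I (Suc n) \<omega> \<partial>M)"
        using I(2)[of "Suc n"] by (intro nn_integral_cmult) simp
      also have "\<dots> \<le> ennreal (2 powr (2 * \<sigma> * Suc n)) * ennreal (64 * sqrt pi * G (Suc n))"
        by (intro mult_left_mono I(1)) auto
      also have "\<dots> = ennreal (2 powr (2 * \<sigma> * Suc n) * (64 * sqrt pi * G (Suc n)))"
        by (rule ennreal_mult'[symmetric]) simp
      also have "\<dots> = ennreal (K * 2 powr (- \<theta>) * (2 powr (- \<theta>)) ^ n)"
        unfolding rate by (simp only: power_Suc mult.assoc)
      finally show ?thesis .
    qed
    show "0 \<le> 2 powr (- \<theta>)" by simp
    show "2 powr (- \<theta>) < 1" using \<theta> by (simp add: powr_less_one)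
    show "0 \<le> K * 2 powr (- \<theta>)" using K0 by simp
  qed
  have "AE \<omega> in M. \<forall>n. mixed_deriv (\<lambda>t x. B (Suc n) t x \<omega>) = double_egf (a (Suc n) \<omega>)"
    using Good by (subst AE_all_countable) (auto simp: Good_def)
  moreover have "AE \<omega> in M. \<forall>n. weighted_energy (V (Suc n) \<omega>) < \<infinity>"
    using V_fin by (subst AE_all_countable) auto
  ultimately show ?thesis
    using bounded
  proof eventually_elim
    case (elim \<omega>)
    then obtain e where e: "0 \<le> e" "\<And>n. ennreal (2 powr (2 * \<sigma> * Suc n)) * I (Suc n) \<omega> \<le> ennreal e"
      by blast
    define C where "C = A * (2 * exp (r\<^sup>2 / 8)) * sqrt (2 * r) * sqrt e"
    show ?case
    proof (intro exI[of _ C] allI impI SUP_least)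
      fix n :: nat and t :: real assume n: "n \<ge> 1" and t: "t \<in> {0..1}"
      then obtain m where m: "n = Suc m" by (cases n) auto
      have deriv: "mixed_deriv (\<lambda>t x. B n t x \<omega>) = double_egf (a n \<omega>)" and fin: "weighted_energy (V n \<omega>) < \<infinity>"
        using elim(1,2) by (simp_all add: m)
      have In: "I n \<omega> \<le> ennreal (e * 2 powr (- (2 * \<sigma> * n)))"
      proof -
        have "I n \<omega> = ennreal (2 powr (- (2 * \<sigma> * n))) * (ennreal (2 powr (2 * \<sigma> * n)) * I n \<omega>)"
          by (simp add: mult.assoc[symmetric] ennreal_mult'[symmetric] powr_add[symmetric])
        also have "\<dots> \<le> ennreal (2 powr (- (2 * \<sigma> * n))) * ennreal e"
          using e(2)[of m] by (intro mult_left_mono) (simp_all only: m zero_le)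
        also have "\<dots> = ennreal (e * 2 powr (- (2 * \<sigma> * n)))"
          by (subst mult.commute) (simp only: ennreal_mult' e(1))
        finally show ?thesis .
      qed
      have "sobolev_norm_fun (- \<alpha>) (\<lambda>x. of_real (\<rho> x) *
          (heat_conv (\<lambda>s y. V n \<omega> (s, y)) t x - heat_conv (\<lambda>s y. N n \<omega> (s, y)) t x))
        \<le> ennreal (A * (2 * exp (r\<^sup>2 / 8)) * sqrt (2 * r) * sqrt (e * 2 powr (- (2 * \<sigma> * n))))"
        by (rule sobolev_heat_conv_diff[OF V_sec N_sec fin In[unfolded I_def] _ _ _ \<alpha> \<rho>(1,2,4,3)]) (use t e in auto)
      also have "sqrt (e * 2 powr (- (2 * \<sigma> * n))) = sqrt e * 2 powr (- \<sigma> * n)"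
        by (simp add: real_sqrt_mult powr_half_sqrt[symmetric] powr_powr)
      also have "A * (2 * exp (r\<^sup>2 / 8)) * sqrt (2 * r) * (sqrt e * 2 powr (- \<sigma> * n)) = C * 2 powr (- \<sigma> * n)"
        by (simp only: C_def mult.assoc)
      finally show "sobolev_norm_fun (- \<alpha>) (\<lambda>x. of_real (\<rho> x) *
          (lin_sol (\<lambda>t x. B n t x \<omega>) t x - lin_sol_discrete n (\<lambda>t x. B n t x \<omega>) t x))
        \<le> ennreal (C * 2 powr (- \<sigma> * n))"
        by (simp add: lin_sol_def lin_sol_discrete_def deriv V_def N_def)
    qed
  qed
qed

end
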